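(* Let $k$ be a field of characteristic $0$, let $n\geq 2$ be an integer, and let $\mathcal{A}=\{a_{ij}\in k\mid 1\le i<j\le n\}$ be a set of scalars. Let $V_n(\mathcal{A})$ be the $k$-algebra generated by $x_1,\dots,x_n$ subject to the relations $x_ix_j+x_jx_i=a_{ij}$ for all $1\le i<j\le n$. Then the group $\operatorname{Aut}(V_n(\mathcal{A}))$ either is virtually solvable or contains a free subgroup of rank two.
   Context: $\operatorname{Aut}(A)$ denotes the group of $k$-algebra automorphisms of a $k$-algebra $A$. A group is virtually solvable if it has a solvable subgroup of finite index. *)

theory Defs
  imports "HOL-Algebra.Algebra" "HOL-Library.Poly_Mapping"
begin

section \<open>Free associative algebras\<close>

text \<open>
  The free monoid is written additively because \<^typ>\<open>'a \<Rightarrow>\<^sub>0 'b\<close> carries the convolution product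
  when \<^typ>\<open>'a\<close> is of class \<^class>\<open>monoid_add\<close>.  Hence \<open>'a word \<Rightarrow>\<^sub>0 'k\<close> is the monoid algebra of the
  free monoid, that is, the algebra of noncommutative polynomials.
\<close>

datatype 'a word = Word (letters: "'a list")

instantiation word :: (type) monoid_add
begin

definition zero_word :: "'a word" where
  "0 = Word []"

definition plus_word :: "'a word \<Rightarrow> 'a word \<Rightarrow> 'a word" where
  "u + v = Word (letters u @ letters v)"

instance
  by standard (simp_all add: zero_word_def plus_word_def)

end

lemma letters_zero [simp]: "letters 0 = []"
  by (simp add: zero_word_def)

lemma letters_plus [simp]: "letters (u + v) = letters u @ letters v"
  by (simp add: plus_word_def)

text \<open>The free unital \<open>k\<close>-algebra on the letters \<open>1, \<dots>, n\<close>.\<close>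

definition free_algebra :: "nat \<Rightarrow> ('k::field, nat word \<Rightarrow>\<^sub>0 'k) module" where
  "free_algebra n =
    \<lparr>carrier = {f. \<forall>w \<in> Poly_Mapping.keys f. set (letters w) \<subseteq> {1..n}},
     monoid.mult = (*), one = 1, ring.zero = 0, add = (+),
     smult = \<lambda>c. Poly_Mapping.map ((*) c)\<rparr>"

definition free_gen :: "nat \<Rightarrow> (nat word \<Rightarrow>\<^sub>0 'k::field)" where
  "free_gen i = Poly_Mapping.single (Word [i]) 1"

definition free_scalar :: "'k::field \<Rightarrow> (nat word \<Rightarrow>\<^sub>0 'k)" where
  "free_scalar c = Poly_Mapping.single 0 c"


section \<open>Quotients and automorphisms of (not necessarily commutative) algebras\<close>

text \<open>
  The ring is \<^term>\<open>A Quot I\<close>; as with \<^const>\<open>rcoset_mult\<close>, the union is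
  over representatives of the coset \<open>C\<close> and has the value \<open>I + c f\<close> for any \<open>f \<in> C\<close>.
\<close>

definition quot_algebra :: "('k, 'm, 'c) module_scheme \<Rightarrow> 'm set \<Rightarrow> ('k, 'm set) module" where
  "quot_algebra A I = ring.extend (A Quot I)
     \<lparr>smult = \<lambda>c C. \<Union>f\<in>C. I +>\<^bsub>A\<^esub> (c \<odot>\<^bsub>A\<^esub> f)\<rparr>"

text \<open>The scalars range over the whole type \<^typ>\<open>'k\<close>, which is the ground field.\<close>

definition alg_auto :: "('k, 'm, 'c) module_scheme \<Rightarrow> ('m \<Rightarrow> 'm) set" where
  "alg_auto A = {h \<in> ring_hom A A \<inter> Bij (carrier A).
     \<forall>c. \<forall>x \<in> carrier A. h (c \<odot>\<^bsub>A\<^esub> x) = c \<odot>\<^bsub>A\<^esub> h x}"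

definition AlgAut :: "('k, 'm, 'c) module_scheme \<Rightarrow> ('m \<Rightarrow> 'm) monoid" where
  "AlgAut A = BijGroup (carrier A) \<lparr>carrier := alg_auto A\<rparr>"


section \<open>The algebra \<open>V\<^sub>n(a)\<close>\<close>

text \<open>Only the values \<open>a i j\<close> with \<open>1 \<le> i < j \<le> n\<close> are used.\<close>

definition V_relators :: "nat \<Rightarrow> (nat \<Rightarrow> nat \<Rightarrow> 'k::field) \<Rightarrow> (nat word \<Rightarrow>\<^sub>0 'k) set" where
  "V_relators n a =
    {free_gen i * free_gen j + free_gen j * free_gen i - free_scalar (a i j) | i j.
       1 \<le> i \<and> i < j \<and> j \<le> n}"

definition V_algebra ::
  "nat \<Rightarrow> (nat \<Rightarrow> nat \<Rightarrow> 'k::field) \<Rightarrow> ('k, (nat word \<Rightarrow>\<^sub>0 'k) set) module" where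
  "V_algebra n a = quot_algebra (free_algebra n) (Idl\<^bsub>free_algebra n\<^esub> (V_relators n a))"


section \<open>Virtually solvable groups and free groups\<close>

definition virtually_solvable :: "('a, 'b) monoid_scheme \<Rightarrow> bool" where
  "virtually_solvable G \<longleftrightarrow>
    (\<exists>H. subgroup H G \<and> finite (rcosets\<^bsub>G\<^esub> H) \<and> solvable (G\<lparr>carrier := H\<rparr>))"

text \<open>
  The letter \<open>(s, True)\<close> stands for the generator \<open>s\<close> and \<open>(s, False)\<close> for its inverse.
\<close>

definition inv_letter :: "'a \<times> bool \<Rightarrow> 'a \<times> bool" where
  "inv_letter l = (fst l, \<not> snd l)"

definition reduced :: "('a \<times> bool) list \<Rightarrow> bool" where
  "reduced w \<longleftrightarrow> (\<forall>i. Suc i < length w \<longrightarrow> w ! Suc i \<noteq> inv_letter (w ! i))"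

text \<open>For reduced \<open>w\<close>, the reduced form of \<open>l # w\<close>.\<close>

fun cons_letter :: "'a \<times> bool \<Rightarrow> ('a \<times> bool) list \<Rightarrow> ('a \<times> bool) list" where
  "cons_letter l [] = [l]"
| "cons_letter l (m # w) = (if m = inv_letter l then w else l # m # w)"

definition free_group :: "'a set \<Rightarrow> ('a \<times> bool) list monoid" where
  "free_group S =
    \<lparr>carrier = {w. reduced w \<and> set w \<subseteq> S \<times> UNIV},
     monoid.mult = \<lambda>u v. foldr cons_letter u v,
     one = []\<rparr>"

definition has_free_subgroup_rank2 :: "('a, 'b) monoid_scheme \<Rightarrow> bool" where
  "has_free_subgroup_rank2 G \<longleftrightarrow>
    (\<exists>H. subgroup H G \<and> G\<lparr>carrier := H\<rparr> \<cong> free_group {0, 1 :: nat})"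


section \<open>Well-definedness\<close>

lemma free_algebra_simps [simp]:
  "monoid.mult (free_algebra n) = (*)" "one (free_algebra n) = 1"
  "ring.zero (free_algebra n) = 0" "add (free_algebra n) = (+)"
  "smult (free_algebra n) c f = Poly_Mapping.map ((*) c) f"
  by (simp_all add: free_algebra_def)

lemma free_algebra_carrier:
  "f \<in> carrier (free_algebra n) \<longleftrightarrow> (\<forall>w \<in> Poly_Mapping.keys f. set (letters w) \<subseteq> {1..n})"
  by (simp add: free_algebra_def)

lemma smult_free_algebra: "smult (free_algebra n) c f = free_scalar c * f"
  by (simp add: free_scalar_def mult_map_scale_conv_mult)

lemma free_scalar_closed: "free_scalar c \<in> carrier (free_algebra n)"
  by (simp add: free_algebra_carrier free_scalar_def)

lemma free_gen_closed: "1 \<le> i \<Longrightarrow> i \<le> n \<Longrightarrow> free_gen i \<in> carrier (free_algebra n)"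
  by (simp add: free_algebra_carrier free_gen_def)

lemma free_algebra_add_closed:
  assumes "f \<in> carrier (free_algebra n)" "g \<in> carrier (free_algebra n)"
  shows "f + g \<in> carrier (free_algebra n)"
  using assms Poly_Mapping.keys_add[of f g] by (auto simp: free_algebra_carrier subset_iff)

lemma free_algebra_mult_closed:
  assumes "f \<in> carrier (free_algebra n)" "g \<in> carrier (free_algebra n)"
  shows "f * g \<in> carrier (free_algebra n)"
  using assms keys_mult[of f g] by (fastforce simp: free_algebra_carrier subset_iff)

lemma free_algebra_uminus_closed:
  assumes "f \<in> carrier (free_algebra n)"
  shows "- f \<in> carrier (free_algebra n)"
  using assms by (simp add: free_algebra_carrier)

lemma ring_free_algebra: "ring (free_algebra n :: ('k::field, _) module)"
proof (rule ringI)
  show "abelian_group (free_algebra n :: ('k, _) module)"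
  proof (rule abelian_groupI)
    fix f :: "nat word \<Rightarrow>\<^sub>0 'k"
    assume "f \<in> carrier (free_algebra n)"
    then show "\<exists>g \<in> carrier (free_algebra n). g \<oplus>\<^bsub>free_algebra n\<^esub> f = \<zero>\<^bsub>free_algebra n\<^esub>"
      by (intro bexI[of _ "- f"]) (simp_all add: free_algebra_uminus_closed)
  qed (simp_all add: free_algebra_add_closed add_ac, simp_all add: free_algebra_carrier)
  show "Group.monoid (free_algebra n :: ('k, _) module)"
    by (rule monoidI)
      (simp_all add: free_algebra_mult_closed mult.assoc, simp add: free_algebra_carrier)
qed (simp_all add: distrib_left distrib_right)

lemma V_relators_closed: "V_relators n a \<subseteq> carrier (free_algebra n)"
proof
  fix r assume "r \<in> V_relators n a"
  then obtain i j where r: "r = free_gen i * free_gen j + free_gen j * free_gen i - free_scalar (a i j)"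
    and ij: "1 \<le> i" "i < j" "j \<le> n"
    by (auto simp: V_relators_def)
  have i: "free_gen i \<in> carrier (free_algebra n)" and j: "free_gen j \<in> carrier (free_algebra n)"
    using ij by (auto intro: free_gen_closed)
  show "r \<in> carrier (free_algebra n)"
    unfolding r diff_conv_add_uminus
    by (intro free_algebra_add_closed free_algebra_mult_closed free_algebra_uminus_closed
        free_scalar_closed i j)
qed

lemma ideal_V_relators: "ideal (Idl\<^bsub>free_algebra n\<^esub> (V_relators n a)) (free_algebra n)"
  by (rule ring.genideal_ideal[OF ring_free_algebra V_relators_closed])

lemma quot_algebra_simps [simp]:
  "carrier (quot_algebra A I) = carrier (A Quot I)"
  "monoid.mult (quot_algebra A I) = monoid.mult (A Quot I)" "one (quot_algebra A I) = one (A Quot I)"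
  "add (quot_algebra A I) = add (A Quot I)" "ring.zero (quot_algebra A I) = ring.zero (A Quot I)"
  "smult (quot_algebra A I) c C = (\<Union>f\<in>C. I +>\<^bsub>A\<^esub> (c \<odot>\<^bsub>A\<^esub> f))"
  by (simp_all add: quot_algebra_def ring.defs FactRing_def)

lemma ring_quot_algebra:
  assumes "ideal I A"
  shows "ring (quot_algebra A I)"
proof -
  interpret Q: ring "A Quot I"
    by (rule ideal.quotient_is_ring[OF assms])
  show ?thesis
  proof (rule ringI)
    show "abelian_group (quot_algebra A I)"
      by (rule abelian_groupI)
        (auto simp: Q.add.m_ac intro: Q.l_neg Q.a_inv_closed)
    show "Group.monoid (quot_algebra A I)"
      by (rule monoidI) (simp_all add: Q.m_assoc)
  qed (simp_all add: Q.l_distr Q.r_distr)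
qed

lemma ring_V_algebra: "ring (V_algebra n a)"
  unfolding V_algebra_def by (rule ring_quot_algebra[OF ideal_V_relators])

lemma smult_V_algebra:
  fixes a :: "nat \<Rightarrow> nat \<Rightarrow> 'k::field"
  assumes f: "f \<in> carrier (free_algebra n)"
  defines "I \<equiv> Idl\<^bsub>free_algebra n\<^esub> (V_relators n a)"
  shows "c \<odot>\<^bsub>V_algebra n a\<^esub> (I +>\<^bsub>free_algebra n\<^esub> f) =
    I +>\<^bsub>free_algebra n\<^esub> (c \<odot>\<^bsub>free_algebra n\<^esub> f)"
proof -
  interpret ideal I "free_algebra n"
    unfolding I_def by (rule ideal_V_relators)
  have "I +>\<^bsub>free_algebra n\<^esub> (c \<odot>\<^bsub>free_algebra n\<^esub> g) =
      I +>\<^bsub>free_algebra n\<^esub> (c \<odot>\<^bsub>free_algebra n\<^esub> f)"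
    if g: "g \<in> I +>\<^bsub>free_algebra n\<^esub> f" for g
  proof -
    obtain h where h: "h \<in> I" "g = h + f"
      using g by (auto simp: a_r_coset_def')
    have "free_scalar c * h \<in> I"
      using I_l_closed[OF h(1) free_scalar_closed[of c n]] by simp
    then have "c \<odot>\<^bsub>free_algebra n\<^esub> g \<in> I +>\<^bsub>free_algebra n\<^esub> (c \<odot>\<^bsub>free_algebra n\<^esub> f)"
      unfolding smult_free_algebra h(2) a_r_coset_def' by (auto simp: distrib_left)
    moreover have "c \<odot>\<^bsub>free_algebra n\<^esub> f \<in> carrier (free_algebra n)"
      unfolding smult_free_algebra by (rule free_algebra_mult_closed[OF free_scalar_closed f])
    ultimately show ?thesis
      using a_repr_independence is_additive_subgroup by (metis additive_subgroup_def)
  qed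
  moreover have "f \<in> I +>\<^bsub>free_algebra n\<^esub> f"
    by (rule a_rcos_self[OF f])
  ultimately show ?thesis
    unfolding V_algebra_def quot_algebra_simps I_def[symmetric] by blast
qed

lemma group_AlgAut:
  assumes A: "ring A"
    and closed: "\<And>c x. x \<in> carrier A \<Longrightarrow> c \<odot>\<^bsub>A\<^esub> x \<in> carrier A"
  shows "group (AlgAut A)"
proof -
  interpret ring A by (rule A)
  interpret B: group "BijGroup (carrier A)" by (rule group_BijGroup)
  have "subgroup (alg_auto A) (BijGroup (carrier A))"
  proof (rule B.subgroupI)
    show "alg_auto A \<subseteq> carrier (BijGroup (carrier A))"
      by (auto simp: alg_auto_def BijGroup_def)
    have "(\<lambda>x \<in> carrier A. x) \<in> alg_auto A"
      by (auto simp: alg_auto_def id_Bij ring_hom_def closed)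
    then show "alg_auto A \<noteq> {}" by blast
  next
    fix h g assume hg: "h \<in> alg_auto A" "g \<in> alg_auto A"
    then have hB: "h \<in> Bij (carrier A)" "g \<in> Bij (carrier A)"
      and hom: "h \<in> ring_hom A A" "g \<in> ring_hom A A"
      and lin: "\<And>c x. x \<in> carrier A \<Longrightarrow> h (c \<odot>\<^bsub>A\<^esub> x) = c \<odot>\<^bsub>A\<^esub> h x"
        "\<And>c x. x \<in> carrier A \<Longrightarrow> g (c \<odot>\<^bsub>A\<^esub> x) = c \<odot>\<^bsub>A\<^esub> g x"
      by (auto simp: alg_auto_def)
    note cl = ring_hom_closed[OF hom(1)] ring_hom_closed[OF hom(2)]
    have "compose (carrier A) h g \<in> ring_hom A A"
      by (rule ring_hom_memI)
        (simp_all add: compose_def cl ring_hom_mult[OF hom(1)] ring_hom_mult[OF hom(2)]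
          ring_hom_add[OF hom(1)] ring_hom_add[OF hom(2)] ring_hom_one[OF hom(1)]
          ring_hom_one[OF hom(2)])
    moreover have "compose (carrier A) h g (c \<odot>\<^bsub>A\<^esub> x) = c \<odot>\<^bsub>A\<^esub> compose (carrier A) h g x"
      if "x \<in> carrier A" for c x
      using that by (simp add: compose_def closed cl lin)
    ultimately show "h \<otimes>\<^bsub>BijGroup (carrier A)\<^esub> g \<in> alg_auto A"
      using hB by (simp add: alg_auto_def BijGroup_def compose_Bij)
  next
    fix h assume h: "h \<in> alg_auto A"
    then have hB: "h \<in> Bij (carrier A)" and hom: "h \<in> ring_hom A A"
      by (auto simp: alg_auto_def)
    define k where "k = inv_into (carrier A) h"
    have hk: "h (k x) = x" and kx: "k x \<in> carrier A" if "x \<in> carrier A" for x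
      using hB that unfolding k_def Bij_def bij_betw_def
      by (auto simp: f_inv_into_f inv_into_into)
    have kh: "k y = x" if "x \<in> carrier A" "h x = y" for x y
      using hB that unfolding k_def Bij_def bij_betw_def by auto
    have lin: "h (c \<odot>\<^bsub>A\<^esub> x) = c \<odot>\<^bsub>A\<^esub> h x" if "x \<in> carrier A" for c x
      using h that by (simp add: alg_auto_def)
    have "restrict k (carrier A) \<in> ring_hom A A"
    proof (rule ring_hom_memI)
      fix x y assume "x \<in> carrier A" "y \<in> carrier A"
      then show "restrict k (carrier A) (x \<otimes>\<^bsub>A\<^esub> y) =
            restrict k (carrier A) x \<otimes>\<^bsub>A\<^esub> restrict k (carrier A) y"
          "restrict k (carrier A) (x \<oplus>\<^bsub>A\<^esub> y) =
            restrict k (carrier A) x \<oplus>\<^bsub>A\<^esub> restrict k (carrier A) y"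
        by (simp_all add: kh kx hk ring_hom_mult[OF hom] ring_hom_add[OF hom])
    qed (simp_all add: kx kh ring_hom_one[OF hom])
    moreover have "restrict k (carrier A) (c \<odot>\<^bsub>A\<^esub> x) = c \<odot>\<^bsub>A\<^esub> restrict k (carrier A) x"
      if "x \<in> carrier A" for c x
      using that by (simp add: kh kx hk closed lin)
    moreover have "restrict k (carrier A) \<in> Bij (carrier A)"
      unfolding k_def by (rule restrict_inv_into_Bij[OF hB])
    ultimately have "restrict k (carrier A) \<in> alg_auto A"
      by (simp add: alg_auto_def)
    then show "inv\<^bsub>BijGroup (carrier A)\<^esub> h \<in> alg_auto A"
      by (simp add: inv_BijGroup[OF hB] k_def)
  qed
  then show ?thesis
    unfolding AlgAut_def by (rule B.subgroup_imp_group)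
qed

lemma group_AlgAut_V_algebra: "group (AlgAut (V_algebra n a))"
proof (rule group_AlgAut[OF ring_V_algebra])
  fix c C assume "C \<in> carrier (V_algebra n a)"
  then obtain f where f: "f \<in> carrier (free_algebra n)"
    and C: "C = (Idl\<^bsub>free_algebra n\<^esub> (V_relators n a)) +>\<^bsub>free_algebra n\<^esub> f"
    by (auto simp: V_algebra_def FactRing_def A_RCOSETS_def')
  have "c \<odot>\<^bsub>free_algebra n\<^esub> f \<in> carrier (free_algebra n)"
    unfolding smult_free_algebra by (rule free_algebra_mult_closed[OF free_scalar_closed f])
  then show "c \<odot>\<^bsub>V_algebra n a\<^esub> C \<in> carrier (V_algebra n a)"
    unfolding C smult_V_algebra[OF f]
    by (auto simp: V_algebra_def FactRing_def A_RCOSETS_def')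
qed

lemma inv_letter_inv_letter [simp]: "inv_letter (inv_letter l) = l"
  by (simp add: inv_letter_def)

lemma inv_letter_neq [simp]: "inv_letter l \<noteq> l"
  by (cases l) (simp add: inv_letter_def)

lemma reduced_Nil [simp]: "reduced []"
  by (simp add: reduced_def)

lemma reduced_single [simp]: "reduced [l]"
  by (simp add: reduced_def)

lemma reduced_Cons_Cons [simp]:
  "reduced (l # m # w) \<longleftrightarrow> m \<noteq> inv_letter l \<and> reduced (m # w)"
  unfolding reduced_def by (auto simp: nth_Cons split: nat.splits)

lemma reduced_tl: "reduced (l # w) \<Longrightarrow> reduced w"
  by (cases w) auto

lemma reduced_cons_letter: "reduced w \<Longrightarrow> reduced (cons_letter l w)"
  by (cases w) (auto dest: reduced_tl)

lemma reduced_foldr_cons_letter: "reduced w \<Longrightarrow> reduced (foldr cons_letter u w)"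
  by (induction u) (auto intro: reduced_cons_letter)

lemma cons_letter_cancel: "reduced w \<Longrightarrow> cons_letter l (cons_letter (inv_letter l) w) = w"
  by (cases w rule: list.exhaust; cases "tl w") auto

lemma cons_letter_reduced: "reduced (l # w) \<Longrightarrow> cons_letter l w = l # w"
  by (cases w) auto

lemma foldr_cons_letter_Nil: "reduced w \<Longrightarrow> foldr cons_letter w [] = w"
proof (induction w)
  case (Cons l w)
  then show ?case
    using reduced_tl[OF Cons.prems] cons_letter_reduced[OF Cons.prems] by simp
qed simp

lemma set_cons_letter: "set (cons_letter l w) \<subseteq> insert l (set w)"
  by (cases w) auto

lemma set_foldr_cons_letter: "set (foldr cons_letter u w) \<subseteq> set u \<union> set w"
proof (induction u)
  case (Cons l u)
  then show ?case
    using set_cons_letter[of l "foldr cons_letter u w"] by auto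
qed simp

lemma foldr_cons_letter_cons:
  assumes "reduced v"
  shows "foldr cons_letter (cons_letter l u) v = cons_letter l (foldr cons_letter u v)"
proof (cases u)
  case (Cons m u')
  have "reduced (foldr cons_letter u' v)"
    using assms by (rule reduced_foldr_cons_letter)
  then show ?thesis
    using Cons by (simp add: cons_letter_cancel)
qed simp

lemma foldr_cons_letter_assoc:
  assumes "reduced w"
  shows "foldr cons_letter (foldr cons_letter u v) w = foldr cons_letter u (foldr cons_letter v w)"
  by (induction u) (simp_all add: foldr_cons_letter_cons[OF assms])

lemma foldr_cons_letter_inverse:
  "reduced v \<Longrightarrow> foldr cons_letter (rev (map inv_letter u)) (foldr cons_letter u v) = v"
proof (induction u)
  case (Cons l u)
  then show ?case
    using cons_letter_cancel[OF reduced_foldr_cons_letter[OF Cons.prems], of "inv_letter l" u]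
    by simp
qed simp

lemma group_free_group: "group (free_group S)"
proof (rule groupI)
  fix u v assume "u \<in> carrier (free_group S)" "v \<in> carrier (free_group S)"
  then show "u \<otimes>\<^bsub>free_group S\<^esub> v \<in> carrier (free_group S)"
    using set_foldr_cons_letter[of u v] by (auto simp: free_group_def reduced_foldr_cons_letter)
next
  fix u assume u: "u \<in> carrier (free_group S)"
  define v where "v = foldr cons_letter (rev (map inv_letter u)) []"
  have "set v \<subseteq> inv_letter ` set u"
    using set_foldr_cons_letter[of "rev (map inv_letter u)" "[]"] by (simp add: v_def)
  moreover have v_reduced: "reduced v"
    by (simp add: v_def reduced_foldr_cons_letter)
  ultimately have "v \<in> carrier (free_group S)"
    using u by (force simp: free_group_def v_def[symmetric] inv_letter_def
        v_reduced)
  moreover have "foldr cons_letter v u = []"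
    using u foldr_cons_letter_assoc[of u "rev (map inv_letter u)" "[]"]
      foldr_cons_letter_inverse[of "[]" u]
    by (simp add: v_def free_group_def foldr_cons_letter_Nil)
  ultimately show "\<exists>v \<in> carrier (free_group S). v \<otimes>\<^bsub>free_group S\<^esub> u = \<one>\<^bsub>free_group S\<^esub>"
    by (auto simp: free_group_def)
qed (simp_all add: free_group_def foldr_cons_letter_assoc)

end

theory Submission
  imports Defs "HOL-Library.Multiset_Order"
begin

text \<open>
  Write \<open>x\<^sub>1, \<dots>, x\<^sub>n\<close> for the generators of \<open>V\<close>.  Each square \<open>x\<^sub>i\<^sup>2\<close> is central, so \<open>V\<close> is a
  Clifford algebra over polynomials in these squares, and everything depends on the parity of \<open>n\<close>
  through the commutation rule of its pseudoscalar, the antisymmetrized product of the generators.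

  The relations sort every word, so the sorted words span \<open>V\<close>.  They are independent because \<open>V\<close>
  acts on functions of multisets (the monomials) by \<open>L\<^sub>i\<close>, the sum of a signed creation operator and
  of signed annihilation operators of smaller index, and a sorted word sends the empty monomial to
  its own monomial.  Hence \<open>V\<close> is isomorphic to an algebra \<open>Alg\<close> of operators
  (\<open>subst_eq_0_iff\<close>, \<open>iota_bij\<close>), whose elements have coefficients.  A product of sorted words is, up to sign, the sorted
  word of the sum of the multisets plus words of proper submultisets.  So leading terms multiply
  (\<open>has_top_mult\<close>), there are no zero divisors and degrees add.

  Let \<open>n\<close> be even.  The pseudoscalar \<open>\<Omega>\<close> anticommutes with all \<open>x\<^sub>i\<close>, and every element with this
  property is a left multiple of \<open>\<Omega>\<close> (\<open>anticommutant\<close>).  Let \<open>\<theta>\<close> be an automorphism, \<open>y\<^sub>i = \<theta>(x\<^sub>i)\<close>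
  and \<open>P = \<theta>(\<Omega>)\<close>.  The degree of \<open>P\<close> is the sum of the degrees of the \<open>y\<^sub>i\<close>
  (\<open>image_pseudoscalar_lead\<close>).  Conjugation by \<open>P\<close> preserves \<open>V\<close> and fixes the central \<open>x\<^sub>i\<^sup>2\<close>, so it
  sends \<open>x\<^sub>i\<close> to a square root of \<open>x\<^sub>i\<^sup>2\<close>, that is, to \<open>x\<^sub>i\<close> or \<open>-x\<^sub>i\<close> (\<open>sign_twist\<close>).  The
  pseudoscalar \<open>Q\<close> of a suitable subset of the generators changes the same signs
  (\<open>low_degree_twist\<close>), so \<open>Q\<close>, like \<open>P\<close>, anticommutes with all \<open>y\<^sub>i\<close>; then \<open>Q\<close> is a left multiple of \<open>P\<close>, and
  the degrees of the \<open>y\<^sub>i\<close> sum to at most \<open>n\<close>.  So all \<open>y\<^sub>i\<close> are affine, and the relations force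
  \<open>y\<^sub>i\<close> to be a scalar multiple of \<open>x\<^bsub>\<sigma> i\<^esub>\<close> for a permutation \<open>\<sigma>\<close> (\<open>automorphism_monomial\<close>).  The
  automorphisms with trivial \<open>\<sigma>\<close> form an abelian subgroup of finite index.

  Let \<open>n\<close> be odd, so that \<open>n \<ge> 3\<close>, and let \<open>\<Pi>\<close> be the pseudoscalar of \<open>x\<^sub>3, \<dots>, x\<^sub>n\<close>.  It commutes with
  these generators, and the bracket \<open>x\<^sub>2 \<Pi> - \<Pi> x\<^sub>2\<close> anticommutes with \<open>x\<^sub>2, \<dots>, x\<^sub>n\<close>.  So adding this bracket to \<open>x\<^sub>1\<close>
  defines an automorphism, and there is another one with \<open>x\<^sub>1\<close> and \<open>x\<^sub>2\<close> exchanged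
  (\<open>transv_aut\<close>).  Taking the bracket acts on leading terms as multiplication by
  \<open>x\<^sub>3 \<cdots> x\<^sub>n\<close>, so the two automorphisms resemble the elementary matrices with off-diagonal entry a
  variable: along a reduced word the degrees of the images of \<open>x\<^sub>1\<close> and \<open>x\<^sub>2\<close> grow in turn, and no
  reduced word is trivial (\<open>odd_free_subgroup\<close>).
\<close>

section \<open>Linear operators on functions of multisets\<close>

text \<open>
  Inside this type the scalars are central and equality is genuine equality, so computations in the
  quotient algebra become computations in a ring of class \<^class>\<open>ring_1\<close>.
\<close>

typedef (overloaded) 'k op =
  "{T :: (nat multiset \<Rightarrow> 'k::field) \<Rightarrow> nat multiset \<Rightarrow> 'k.
     (\<forall>f g. T (\<lambda>A. f A + g A) = (\<lambda>A. T f A + T g A)) \<and> (\<forall>c f. T (\<lambda>A. c * f A) = (\<lambda>A. c * T f A))}"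
  morphisms app Op
  by (rule exI[of _ id]) simp

setup_lifting type_definition_op

lemma app_add: "app T (\<lambda>A. f A + g A) B = app T f B + app T g B"
  and app_scale: "app T (\<lambda>A. c * f A) B = c * app T f B"
  using app[of T] by simp_all

lemma op_eqI: "(\<And>f A. app S f A = app T f A) \<Longrightarrow> S = T"
  by (metis app_inject ext)

instantiation op :: (field) ring_1
begin

lift_definition zero_op :: "'a op" is "\<lambda>f A. 0" by simp
lift_definition one_op :: "'a op" is "\<lambda>f A. f A" by simp
lift_definition plus_op :: "'a op \<Rightarrow> 'a op \<Rightarrow> 'a op" is "\<lambda>S T f A. S f A + T f A"
  by (simp add: algebra_simps)
lift_definition minus_op :: "'a op \<Rightarrow> 'a op \<Rightarrow> 'a op" is "\<lambda>S T f A. S f A - T f A"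
  by (simp add: algebra_simps)
lift_definition uminus_op :: "'a op \<Rightarrow> 'a op" is "\<lambda>T f A. - T f A"
  by simp
lift_definition times_op :: "'a op \<Rightarrow> 'a op \<Rightarrow> 'a op" is "\<lambda>S T f. S (T f)"
  by simp

lemma app_simps [simp]:
  "app 0 f A = 0" "app 1 f A = f A" "app (S + T) f A = app S f A + app T f A"
  "app (S - T) f A = app S f A - app T f A" "app (- T) f A = - app T f A"
  "app (S * T) f A = app S (app T f) A"
  by (transfer; simp)+

lemma app_fun:
  "app 0 f = (\<lambda>A. 0)" "app 1 f = f" "app (S + T) f = (\<lambda>A. app S f A + app T f A)"
  "app (S * T) f = app S (app T f)" "app (- T) f = (\<lambda>A. - app T f A)"
  by (rule ext; simp)+

instance
proof
  show "(0::'a op) \<noteq> 1"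
  proof
    assume "(0::'a op) = 1"
    then have "app (0::'a op) (\<lambda>A. 1) {#} = app 1 (\<lambda>A. 1) {#}" by simp
    then show False by simp
  qed
qed (rule op_eqI, simp add: app_fun app_add algebra_simps)+

end

lift_definition scal :: "'k::field \<Rightarrow> 'k op" is "\<lambda>c f A. c * f A"
  by (simp add: algebra_simps)

lemma app_scal [simp]: "app (scal c) f A = c * f A"
  by transfer simp

lemma scal_add: "scal (c + d) = scal c + scal d"
  and scal_mult: "scal (c * d) = scal c * scal d"
  and scal_uminus: "scal (- c) = - scal c"
  and scal_0 [simp]: "scal 0 = 0"
  and scal_1 [simp]: "scal 1 = 1"
  by (rule op_eqI; simp add: algebra_simps)+

lemma scal_central: "T * scal c = scal c * T"
proof (rule op_eqI)
  fix f A
  have "app (scal c) f = (\<lambda>A. c * f A)"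
    by (rule ext) simp
  then show "app (T * scal c) f A = app (scal c * T) f A"
    by (simp add: app_scale)
qed

lemma scal_left: "T * (scal c * S) = scal c * (T * S)"
  by (metis mult.assoc scal_central)

section \<open>Creation and annihilation\<close>

text \<open>
  The sign picked up by \<open>x\<^sub>i\<close> when it moves past the letters of \<open>A\<close> that are smaller than \<open>i\<close>, in
  the skew polynomial ring where distinct variables anticommute.
\<close>

definition sg :: "nat \<Rightarrow> nat multiset \<Rightarrow> 'k::field" where
  "sg i A = (- 1) ^ size (filter_mset (\<lambda>j. j < i) A)"

lemma sg_empty [simp]: "sg i {#} = 1"
  by (simp add: sg_def)

lemma sg_add_mset [simp]: "sg i (add_mset j A) = (if j < i then - sg i A else sg i A)"
  by (simp add: sg_def)

lemma sg_union: "sg i (A + B) = sg i A * sg i B"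
  by (simp add: sg_def power_add)

lemma sg_square: "sg i A * sg i A = 1"
  by (simp add: sg_def flip: power_mult_distrib)

lemma sg_cancel [simp]: "sg i A * (sg i A * c) = c"
  by (simp add: sg_square flip: mult.assoc)

lemma sg_nonzero [simp]: "sg i A \<noteq> 0"
  by (simp add: sg_def)

lemma sg_remove [simp]:
  assumes "j \<in># A"
  shows "sg i (A - {#j#}) = (if j < i then - sg i A else sg i A :: 'k::field)"
proof -
  have "sg i A = (sg i (add_mset j (A - {#j#})) :: 'k)"
    using assms by simp
  then show ?thesis
    by (cases "j < i") simp_all
qed

text \<open>
  In that ring with basis the sorted monomials, the first operator is left multiplication by \<open>x\<^sub>i\<close>.
  The second one removes a letter \<open>i\<close>, but only from odd powers of \<open>x\<^sub>i\<close>: this is what makes the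
  relation with \<open>creat i\<close> that of a Clifford algebra, even though \<open>x\<^sub>i\<^sup>2\<close> is not a scalar.
\<close>

lift_definition creat :: "nat \<Rightarrow> 'k::field op" is
  "\<lambda>i f A. if i \<in># A then sg i A * f (A - {#i#}) else 0"
  by (auto simp: algebra_simps)

lift_definition annih :: "nat \<Rightarrow> 'k::field op" is
  "\<lambda>i f A. if even (count A i) then sg i A * f (add_mset i A) else 0"
  by (auto simp: algebra_simps)

lemma app_creat [simp]: "app (creat i) f A = (if i \<in># A then sg i A * f (A - {#i#}) else 0)"
  and app_annih [simp]:
    "app (annih i) f A = (if even (count A i) then sg i A * f (add_mset i A) else 0)"
  by (transfer, simp)+

lemma creat_anticommute:
  assumes "i \<noteq> j"
  shows "creat i * creat j + creat j * creat i = (0 :: 'k::field op)"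
proof (rule op_eqI)
  fix f :: "nat multiset \<Rightarrow> 'k" and A :: "nat multiset"
  have "A - {#i#} - {#j#} = A - {#j#} - {#i#}"
    by (simp add: diff_union_swap2 add.commute diff_diff_add)
  then show "app (creat i * creat j + creat j * creat i) f A = app 0 f A"
    using assms by (cases i j rule: linorder_cases) (auto simp: in_diff_count algebra_simps)
qed

lemma annih_anticommute: "annih i * annih j + annih j * annih i = (0 :: 'k::field op)"
proof (rule op_eqI)
  fix f :: "nat multiset \<Rightarrow> 'k" and A :: "nat multiset"
  show "app (annih i * annih j + annih j * annih i) f A = app 0 f A"
    by (cases i j rule: linorder_cases) (auto simp: algebra_simps add_mset_commute)
qed

lemma annih_creat:
  "annih i * creat j + creat j * annih i = (if i = j then 1 else 0 :: 'k::field op)"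
proof (rule op_eqI)
  fix f :: "nat multiset \<Rightarrow> 'k" and A :: "nat multiset"
  consider "i = j" "even (count A i)" | "i = j" "odd (count A i)" "i \<in># A" | "i \<noteq> j"
    by (metis count_inI even_zero)
  then show
    "app (annih i * creat j + creat j * annih i) f A = app (if i = j then 1 else 0) f A"
  proof cases
    case 3
    moreover have "add_mset i (A - {#j#}) = add_mset i A - {#j#}"
      using 3 by simp
    ultimately show ?thesis
      by (cases i j rule: linorder_cases) auto
  qed (simp_all add: count_eq_zero_iff)
qed

section \<open>Substitution into the free algebra\<close>

abbreviation wprod :: "(nat \<Rightarrow> 'k::field op) \<Rightarrow> nat list \<Rightarrow> 'k op" where
  "wprod z w \<equiv> prod_list (map z w)"

definition subst :: "(nat \<Rightarrow> 'k::field op) \<Rightarrow> (nat word \<Rightarrow>\<^sub>0 'k) \<Rightarrow> 'k op" where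
  "subst z f = (\<Sum>w\<in>Poly_Mapping.keys f. scal (Poly_Mapping.lookup f w) * wprod z (letters w))"

lemma subst_superset:
  assumes "finite S" "Poly_Mapping.keys f \<subseteq> S"
  shows "subst z f = (\<Sum>w\<in>S. scal (Poly_Mapping.lookup f w) * wprod z (letters w))"
  unfolding subst_def
  by (rule sum.mono_neutral_left) (use assms in \<open>auto simp: in_keys_iff\<close>)

lemma subst_single: "subst z (Poly_Mapping.single w c) = scal c * wprod z (letters w)"
  by (subst subst_superset[of "{w}"]) auto

lemma subst_add: "subst z (f + g) = subst z f + subst z g"
proof -
  let ?S = "Poly_Mapping.keys f \<union> Poly_Mapping.keys g"
  have "finite ?S" "Poly_Mapping.keys (f + g) \<subseteq> ?S"
    using Poly_Mapping.keys_add[of f g] by simp_all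
  then show ?thesis
    by (simp add: subst_superset[of ?S] lookup_add scal_add distrib_right sum.distrib)
qed

lemma subst_zero [simp]: "subst z 0 = 0"
  by (simp add: subst_def)

lemma subst_uminus: "subst z (- f) = - subst z f"
  by (simp add: subst_def scal_uminus sum_negf)

lemma subst_diff: "subst z (f - g) = subst z f - subst z g"
  unfolding diff_conv_add_uminus by (simp only: subst_add subst_uminus)

lemma subst_one [simp]: "subst z 1 = 1"
  using subst_single[of z 0 1] by simp

lemma poly_mapping_single_induct [case_names zero single add]:
  fixes f :: "'w \<Rightarrow>\<^sub>0 'b::ab_group_add"
  assumes "P 0" "\<And>w c. P (Poly_Mapping.single w c)" "\<And>f g. P f \<Longrightarrow> P g \<Longrightarrow> P (f + g)"
  shows "P f"
proof (induction f rule: Poly_Mapping.update_induct)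
  case (update f a b)
  have "Poly_Mapping.update a b f = f + Poly_Mapping.single a b"
    by (rule poly_mapping_eqI)
      (use update in \<open>auto simp: lookup_add lookup_update lookup_single in_keys_iff when_def\<close>)
  with update assms show ?case by simp
qed (use assms in simp)

lemma subst_single_mult:
  "subst z (Poly_Mapping.single v c * g) = scal c * wprod z (letters v) * subst z g"
proof (induction g rule: poly_mapping_single_induct)
  case (single w d)
  show ?case
    by (simp add: mult_single subst_single scal_mult mult.assoc scal_left[of "wprod z (letters v)"])
qed (simp_all add: subst_add distrib_left)

lemma subst_mult: "subst z (f * g) = subst z f * subst z g"
proof (induction f rule: poly_mapping_single_induct)
  case (single w c)
  show ?case
    by (simp add: subst_single_mult subst_single)
qed (simp_all add: subst_add distrib_right)

lemma subst_free_gen [simp]: "subst z (free_gen i) = z i"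
  and subst_free_scalar [simp]: "subst z (free_scalar c) = scal c"
  by (simp_all add: free_gen_def free_scalar_def subst_single)

section \<open>Normal forms modulo the relations\<close>

locale V_data =
  fixes n :: nat and a :: "nat \<Rightarrow> nat \<Rightarrow> 'k::field_char_0"
begin

abbreviation "F \<equiv> (free_algebra n :: ('k, nat word \<Rightarrow>\<^sub>0 'k) module)"
abbreviation "I \<equiv> Idl\<^bsub>F\<^esub> (V_relators n a)"

sublocale I: ideal I F
  by (rule ideal_V_relators)

lemma F_add [simp]: "f \<in> carrier F \<Longrightarrow> g \<in> carrier F \<Longrightarrow> f + g \<in> carrier F"
  and F_mult [simp]: "f \<in> carrier F \<Longrightarrow> g \<in> carrier F \<Longrightarrow> f * g \<in> carrier F"
  and F_uminus [simp]: "f \<in> carrier F \<Longrightarrow> - f \<in> carrier F"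
  and F_scalar [simp]: "free_scalar c \<in> carrier F"
  and F_gen [simp]: "i \<in> {1..n} \<Longrightarrow> free_gen i \<in> carrier F"
  by (auto intro: free_algebra_add_closed free_algebra_mult_closed free_algebra_uminus_closed
      free_scalar_closed free_gen_closed)

lemma F_diff [simp]: "f \<in> carrier F \<Longrightarrow> g \<in> carrier F \<Longrightarrow> f - g \<in> carrier F"
  using F_add[OF _ F_uminus] by (metis diff_conv_add_uminus)

lemma F_one [simp]: "1 \<in> carrier F" and F_zero [simp]: "0 \<in> carrier F"
  by (simp_all add: free_algebra_carrier)

lemma F_single: "set w \<subseteq> {1..n} \<Longrightarrow> Poly_Mapping.single (Word w) c \<in> carrier F"
  by (simp add: free_algebra_carrier)

lemma I_zero [simp]: "0 \<in> I"
  using additive_subgroup.zero_closed[OF I.is_additive_subgroup] by simp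

lemma I_add: "f \<in> I \<Longrightarrow> g \<in> I \<Longrightarrow> f + g \<in> I"
  using additive_subgroup.a_closed[OF I.is_additive_subgroup, of f g] by simp

lemma I_left: "f \<in> I \<Longrightarrow> g \<in> carrier F \<Longrightarrow> g * f \<in> I"
  and I_right: "f \<in> I \<Longrightarrow> g \<in> carrier F \<Longrightarrow> f * g \<in> I"
  using I.I_l_closed[of f g] I.I_r_closed[of f g] by simp_all

lemma I_relator: "1 \<le> i \<Longrightarrow> i < j \<Longrightarrow> j \<le> n \<Longrightarrow>
    free_gen i * free_gen j + free_gen j * free_gen i - free_scalar (a i j) \<in> I"
  by (rule subsetD[OF ring.genideal_self[OF ring_free_algebra V_relators_closed]])
    (auto simp: V_relators_def)

definition sorted_form :: "(nat word \<Rightarrow>\<^sub>0 'k) \<Rightarrow> bool" where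
  "sorted_form g \<longleftrightarrow> g \<in> carrier F \<and> (\<forall>w\<in>Poly_Mapping.keys g. sorted (letters w))"

lemma sorted_form_add: "sorted_form f \<Longrightarrow> sorted_form g \<Longrightarrow> sorted_form (f + g)"
  unfolding sorted_form_def using Poly_Mapping.keys_add[of f g] F_add[of f g] by blast

lemma sorted_form_scale:
  assumes "sorted_form f"
  shows "sorted_form (free_scalar c * f)"
proof -
  have "Poly_Mapping.keys (free_scalar c * f) \<subseteq> Poly_Mapping.keys f"
    using keys_mult[of "free_scalar c" f] by (auto simp: free_scalar_def split: if_splits)
  moreover have "free_scalar c * f \<in> carrier F"
    using assms by (intro F_mult F_scalar) (simp add: sorted_form_def)
  ultimately show ?thesis
    using assms unfolding sorted_form_def by blast
qed

definition reducible_form :: "(nat word \<Rightarrow>\<^sub>0 'k) \<Rightarrow> bool" where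
  "reducible_form f \<longleftrightarrow> (\<exists>g. sorted_form g \<and> f - g \<in> I)"

lemma reducible_form_add:
  assumes "reducible_form f" "reducible_form g"
  shows "reducible_form (f + g)"
proof -
  obtain f' g' where "sorted_form f'" "f - f' \<in> I" "sorted_form g'" "g - g' \<in> I"
    using assms by (auto simp: reducible_form_def)
  then have "sorted_form (f' + g')" "(f + g) - (f' + g') \<in> I"
    using I_add[of "f - f'" "g - g'"] by (simp_all add: sorted_form_add algebra_simps)
  then show ?thesis
    by (auto simp: reducible_form_def)
qed

lemma reducible_form_scale:
  assumes "reducible_form f"
  shows "reducible_form (free_scalar c * f)"
proof -
  obtain g where "sorted_form g" "f - g \<in> I"
    using assms by (auto simp: reducible_form_def)
  then have "sorted_form (free_scalar c * g)" "free_scalar c * f - free_scalar c * g \<in> I"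
    using I_left[of "f - g" "free_scalar c"] by (simp_all add: sorted_form_scale algebra_simps)
  then show ?thesis
    by (auto simp: reducible_form_def)
qed

lemma reducible_form_cong:
  assumes "f - g \<in> I" "reducible_form g"
  shows "reducible_form f"
proof -
  obtain h where "sorted_form h" "g - h \<in> I"
    using assms by (auto simp: reducible_form_def)
  moreover have "f - h \<in> I"
    using I_add[OF assms(1) \<open>g - h \<in> I\<close>] by simp
  ultimately show ?thesis
    by (auto simp: reducible_form_def)
qed

text \<open>
  At a descent the relation replaces the word by a lexicographically smaller word of the same length
  and by a shorter one.  Both precede it in the well-founded length-lexicographic order.
\<close>

lemma reducible_form_word:
  assumes "set w \<subseteq> {1..n}"
  shows "reducible_form (Poly_Mapping.single (Word w) 1)"
  using wf_lenlex[OF wf_less_than] assms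
proof (induction w rule: wf_induct_rule)
  case (less w)
  let ?m = "\<lambda>w. Poly_Mapping.single (Word w) (1::'k)"
  show ?case
  proof (cases "sorted w")
    case True
    then have "sorted_form (?m w)"
      using less.prems by (simp add: sorted_form_def F_single)
    then show ?thesis
      unfolding reducible_form_def by (metis I_zero cancel_comm_monoid_add_class.diff_cancel)
  next
    case False
    then obtain p where p: "Suc p < length w" "w ! p > w ! Suc p"
      by (metis linorder_not_le sorted_iff_nth_Suc)
    define u v i j where "u = take p w" "v = drop (Suc (Suc p)) w" "i = w ! Suc p" "j = w ! p"
    have w: "w = u @ [j, i] @ v"
      using p unfolding u_v_i_j_def
      by (metis Cons_nth_drop_Suc Suc_lessD append_Cons append_Nil id_take_nth_drop)
    have "i < j"
      using p by (simp add: u_v_i_j_def)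
    moreover have "set u \<union> {j, i} \<union> set v \<subseteq> {1..n}"
      using less.prems w by (metis list.simps(15) empty_set set_append Un_assoc)
    ultimately have ij: "i < j" "1 \<le> i" "j \<le> n"
      and uv: "set u \<subseteq> {1..n}" "set v \<subseteq> {1..n}"
      by auto
    have "(u @ [i, j] @ v, w) \<in> lenlex less_than"
      using ij unfolding w lenlex_conv by (auto intro!: lex_append_leftI simp: Cons_in_lex)
    then have 1: "reducible_form (?m (u @ [i, j] @ v))"
      using less.IH uv ij by simp
    have "(u @ v, w) \<in> lenlex less_than"
      unfolding w by (simp add: lenlex_conv)
    then have 2: "reducible_form (?m (u @ v))"
      using less.IH uv ij by simp
    let ?r = "free_gen i * free_gen j + free_gen j * free_gen i - free_scalar (a i j)"
    have "?m u * ?r * ?m v \<in> I"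
      using I_relator[OF ij(2,1,3)] uv by (intro I_left I_right F_single)
    also have "?m u * ?r * ?m v =
        ?m w - (free_scalar (- 1) * ?m (u @ [i, j] @ v) + free_scalar (a i j) * ?m (u @ v))"
      unfolding w by (simp add: algebra_simps free_gen_def free_scalar_def mult_single plus_word_def
          single_uminus zero_word_def)
    finally show ?thesis
      using reducible_form_cong reducible_form_add reducible_form_scale 1 2 by blast
  qed
qed

lemma reducible_form:
  assumes "f \<in> carrier F"
  shows "reducible_form f"
proof -
  have "(\<forall>w\<in>Poly_Mapping.keys f. set (letters w) \<subseteq> {1..n}) \<Longrightarrow> reducible_form f"
  proof (induction f rule: Poly_Mapping.update_induct)
    case const
    have "sorted_form 0"
      by (simp add: sorted_form_def)
    then show ?case
      unfolding reducible_form_def by (metis I_zero diff_zero)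
  next
    case (update f w c)
    have "Poly_Mapping.update w c f = free_scalar c * Poly_Mapping.single w 1 + f"
      by (rule poly_mapping_eqI)
        (use update in \<open>auto simp: free_scalar_def mult_single lookup_add lookup_update lookup_single
            in_keys_iff when_def\<close>)
    moreover have "reducible_form f"
      using update by (auto simp: keys_update)
    moreover have "reducible_form (Poly_Mapping.single (Word (letters w)) 1)"
      using update by (intro reducible_form_word) (auto simp: keys_update)
    ultimately show ?case
      using reducible_form_add reducible_form_scale by simp
  qed
  then show ?thesis
    using assms by (simp add: free_algebra_carrier)
qed

end

section \<open>Coefficients\<close>

lemma app_sum_op: "app (\<Sum>x\<in>S. T x) f A = (\<Sum>x\<in>S. app (T x) f A)"
  by (induction S rule: infinite_finite_induct) simp_all

definition delta :: "nat multiset \<Rightarrow> nat multiset \<Rightarrow> 'k::field" where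
  "delta A = (\<lambda>B. if B = A then 1 else 0)"

text \<open>
  Applying an operator to the empty monomial turns it into a vector.  On the algebra of interest this
  loses nothing, because the sorted words are sent to distinct basis functions.
\<close>

definition coef :: "'k::field op \<Rightarrow> nat multiset \<Rightarrow> 'k" where
  "coef u = app u (delta {#})"

lemma coef_simps [simp]:
  "coef 0 B = 0" "coef (u + v) B = coef u B + coef v B" "coef (u - v) B = coef u B - coef v B"
  "coef (- u) B = - coef u B" "coef (scal c * u) B = c * coef u B"
  "coef (scal c) B = (if B = {#} then c else 0)" "coef 1 B = (if B = {#} then 1 else 0)"
  by (simp_all add: coef_def delta_def)

lemma coef_sum: "coef (\<Sum>x\<in>S. u x) B = (\<Sum>x\<in>S. coef (u x) B)"
  by (simp add: coef_def app_sum_op)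

text \<open>
  The sign with which the sorted monomial of \<open>A\<close> times that of \<open>B\<close> is the sorted monomial of
  \<open>A + B\<close> in the skew polynomial ring.
\<close>

definition msgn :: "nat multiset \<Rightarrow> nat multiset \<Rightarrow> 'k::field" where
  "msgn A B = (\<Prod>i\<in>#A. sg i B)"

lemma msgn_union_left: "msgn (A + B) C = msgn A C * msgn B C"
  and msgn_add_left [simp]: "msgn (add_mset i A) C = sg i C * msgn A C"
  and msgn_empty [simp]: "msgn {#} C = 1" "msgn C {#} = 1"
  by (simp_all add: msgn_def)

lemma msgn_union_right: "msgn A (B + C) = msgn A B * msgn A C"
  by (simp add: msgn_def sg_union prod_mset.distrib)

lemma msgn_nonzero [simp]: "msgn A B \<noteq> 0"
  by (induction A) simp_all

lemma sg_eq_1: "(\<And>j. j \<in># A \<Longrightarrow> i \<le> j) \<Longrightarrow> sg i A = 1"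
  by (induction A) (simp, force simp: not_less)

context V_data
begin

definition V_rel :: "(nat \<Rightarrow> 'k op) \<Rightarrow> bool" where
  "V_rel z \<longleftrightarrow> (\<forall>i j. 1 \<le> i \<longrightarrow> i < j \<longrightarrow> j \<le> n \<longrightarrow> z i * z j + z j * z i = scal (a i j))"

lemma subst_ideal:
  assumes "V_rel z" "f \<in> I"
  shows "subst z f = 0"
proof -
  let ?K = "{f \<in> carrier F. subst z f = 0}"
  have "ideal ?K F"
  proof (rule idealI)
    show "subgroup ?K (add_monoid F)"
    proof (rule group.subgroupI)
      show "group (add_monoid F)"
        using abelian_group.a_group[OF ring.is_abelian_group[OF ring_free_algebra]] .
      have "\<zero>\<^bsub>F\<^esub> \<in> ?K" by simp
      then show "?K \<noteq> {}" by blast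
      fix f assume f: "f \<in> ?K"
      have "\<ominus>\<^bsub>F\<^esub> f = - f"
        by (rule abelian_group.minus_equality[OF ring.is_abelian_group[OF ring_free_algebra]])
          (use f in simp_all)
      then show "inv\<^bsub>add_monoid F\<^esub> f \<in> ?K"
        using f by (simp add: a_inv_def subst_uminus)
    qed (auto simp: subst_add)
  qed (auto simp: ring_free_algebra subst_mult)
  moreover have "V_relators n a \<subseteq> ?K"
    using assms(1) subsetD[OF V_relators_closed[of n a]]
    by (auto simp: V_relators_def V_rel_def subst_diff subst_add subst_mult)
  ultimately show ?thesis
    using ring.genideal_minimal[OF ring_free_algebra] assms(2) by blast
qed

section \<open>The generators\<close>

text \<open>
  Left multiplication by \<open>x\<^sub>i\<close> on sorted words is read off by moving \<open>x\<^sub>i\<close> to its place.  Passing a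
  smaller letter \<open>j\<close> produces a sign and, from the relation, a term in which \<open>j\<close> is removed.  The
  removals are the part \<open>contr i\<close>.
\<close>

definition contr :: "nat \<Rightarrow> 'k op" where
  "contr i = (\<Sum>j\<in>{1..<i}. scal (a j i) * annih j)"

definition L :: "nat \<Rightarrow> 'k op" where
  "L i = creat i + contr i"

lemma contr_creat: "contr i * creat j + creat j * contr i = (if j \<in> {1..<i} then scal (a j i) else 0)"
proof -
  have "contr i * creat j + creat j * contr i =
      (\<Sum>l\<in>{1..<i}. scal (a l i) * (annih l * creat j + creat j * annih l))"
    unfolding contr_def sum_distrib_left sum_distrib_right distrib_left sum.distrib
    by (simp add: mult.assoc scal_left[of "creat j"])
  also have "\<dots> = (\<Sum>l\<in>{1..<i}. if l = j then scal (a l i) else 0)"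
    by (rule sum.cong) (simp_all add: annih_creat)
  also have "\<dots> = (if j \<in> {1..<i} then scal (a j i) else 0)"
    by (subst sum.delta) simp_all
  finally show ?thesis .
qed

lemma contr_contr: "contr i * contr j + contr j * contr i = 0"
proof -
  have "contr i * contr j =
      (\<Sum>l\<in>{1..<i}. \<Sum>m\<in>{1..<j}. scal (a l i) * scal (a m j) * (annih l * annih m))" for i j
    unfolding contr_def sum_product
    by (intro sum.cong refl) (simp add: mult.assoc scal_left[of "annih _"])
  then have "contr i * contr j + contr j * contr i =
     (\<Sum>l\<in>{1..<i}. \<Sum>m\<in>{1..<j}. scal (a l i) * scal (a m j) * (annih l * annih m)) +
     (\<Sum>l\<in>{1..<j}. \<Sum>m\<in>{1..<i}. scal (a l j) * scal (a m i) * (annih l * annih m))"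
    by simp
  also have "(\<Sum>l\<in>{1..<j}. \<Sum>m\<in>{1..<i}. scal (a l j) * scal (a m i) * (annih l * annih m)) =
     (\<Sum>l\<in>{1..<i}. \<Sum>m\<in>{1..<j}. scal (a l i) * scal (a m j) * (annih m * annih l))"
    by (subst sum.swap) (simp add: mult.commute flip: scal_mult)
  also have "(\<Sum>l\<in>{1..<i}. \<Sum>m\<in>{1..<j}. scal (a l i) * scal (a m j) * (annih l * annih m)) +
     (\<Sum>l\<in>{1..<i}. \<Sum>m\<in>{1..<j}. scal (a l i) * scal (a m j) * (annih m * annih l)) =
     (\<Sum>l\<in>{1..<i}. \<Sum>m\<in>{1..<j}. scal (a l i) * scal (a m j) *
        (annih l * annih m + annih m * annih l))"
    by (simp add: sum.distrib distrib_left)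
  also have "\<dots> = 0"
    by (simp add: annih_anticommute)
  finally show ?thesis .
qed

text \<open>
  Only the annihilations of smaller index occur in \<open>L\<close>, so for \<open>i < j\<close> exactly one mixed term
  survives, namely \<open>a\<^sub>i\<^sub>j\<close>.
\<close>

lemma V_rel_L: "V_rel L"
  unfolding V_rel_def
proof (intro allI impI)
  fix i j assume ij: "1 \<le> i" "i < j" "j \<le> n"
  have "L i * L j + L j * L i = (creat i * creat j + creat j * creat i) +
      (contr i * creat j + creat j * contr i) + (contr j * creat i + creat i * contr j) +
      (contr i * contr j + contr j * contr i)"
    by (simp add: L_def algebra_simps)
  also have "\<dots> = scal (a i j)"
    using ij by (simp only: creat_anticommute contr_creat contr_contr) simp
  finally show "L i * L j + L j * L i = scal (a i j)" .
qed

text \<open>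
  Every letter acts by inserting itself or removing another letter, so the support of the result stays
  below the multiset of all letters involved; the coefficient at the top is tracked exactly.
\<close>

definition topf :: "(nat multiset \<Rightarrow> 'k) \<Rightarrow> nat multiset \<Rightarrow> 'k \<Rightarrow> bool" where
  "topf f G c \<longleftrightarrow> f G = c \<and> (\<forall>D. f D \<noteq> 0 \<longrightarrow> D \<subseteq># G)"

lemma app_L_creat:
  assumes "\<And>j. j \<in> {1..<i} \<Longrightarrow> f (add_mset j A) = 0"
  shows "app (L i) f A = (if i \<in># A then sg i A * f (A - {#i#}) else 0)"
proof -
  have "app (contr i) f A = 0"
    unfolding contr_def app_sum_op by (rule sum.neutral) (use assms in auto)
  then show ?thesis
    by (simp add: L_def)
qed

lemma topf_L:
  assumes "topf f G c"
  shows "topf (app (L i) f) (add_mset i G) (sg i G * c)"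
proof -
  have 1: "f (add_mset j A) = 0" if "\<not> A \<subseteq># G" for j A
    using assms that unfolding topf_def by (meson mset_subset_eq_insertD subset_mset.less_imp_le)
  have "\<not> add_mset i G \<subseteq># G"
    by (metis add_mset_add_single mset_subset_eq_insertD subset_mset.less_irrefl)
  then have "f (add_mset j (add_mset i G)) = 0" for j
    by (rule 1)
  then have "app (L i) f (add_mset i G) = sg i G * c"
    using assms by (simp add: app_L_creat topf_def)
  moreover have "D \<subseteq># add_mset i G" if "app (L i) f D \<noteq> 0" for D
  proof (rule ccontr)
    assume *: "\<not> D \<subseteq># add_mset i G"
    then have "\<not> D \<subseteq># G"
      by (metis add_mset_add_single mset_subset_eq_add_left subset_mset.order_trans)
    then have "f (add_mset j D) = 0" for j
      by (rule 1)
    moreover have "f (D - {#i#}) = 0"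
    proof -
      have "\<not> D - {#i#} \<subseteq># G"
        using * by (simp add: subset_eq_diff_conv)
      then show ?thesis
        using assms unfolding topf_def by blast
    qed
    ultimately show False
      using that by (simp add: app_L_creat split: if_splits)
  qed
  ultimately show ?thesis
    by (simp add: topf_def)
qed

lemma topf_word:
  assumes "topf f G c" "sorted w"
  shows "topf (app (wprod L w) f) (mset w + G) (msgn (mset w) G * c)"
  using assms(2)
proof (induction w)
  case Nil
  then show ?case using assms(1) by (simp add: app_fun)
next
  case (Cons i w)
  have "sg i (mset w) = (1 :: 'k)"
    using Cons.prems by (intro sg_eq_1) auto
  then have "sg i (mset w + G) = (sg i G :: 'k)"
    by (simp add: sg_union)
  with topf_L[OF Cons.IH, of i] Cons.prems show ?case
    by (simp add: app_fun mult.assoc)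
qed

text \<open>
  A letter not exceeding those already present finds nothing smaller to remove, so no contraction
  occurs.
\<close>

lemma app_sorted_word: "sorted w \<Longrightarrow> app (wprod L w) (delta {#}) = delta (mset w)"
proof (induction w)
  case (Cons i w)
  have sg: "sg i (mset w) = (1 :: 'k)"
    using Cons.prems by (intro sg_eq_1) auto
  show ?case
  proof (rule ext)
    fix A
    have "delta (mset w) (add_mset j A) = (0 :: 'k)" if "j \<in> {1..<i}" for j
      using Cons.prems that by (auto simp: delta_def) (metis leD set_mset_mset union_single_eq_member)
    then have "app (wprod L (i # w)) (delta {#}) A =
        (if i \<in># A then sg i A * delta (mset w) (A - {#i#}) else 0)"
      using Cons app_L_creat[of i "delta (mset w)" A] by (simp add: app_fun)
    moreover have "i \<in># A \<Longrightarrow> (A - {#i#} = mset w) = (A = add_mset i (mset w))"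
      by (metis add_mset_remove_trivial insert_DiffM)
    ultimately show "app (wprod L (i # w)) (delta {#}) A = delta (mset (i # w)) A"
      using sg by (auto simp: delta_def)
  qed
qed (simp add: app_fun)

abbreviation W :: "nat multiset \<Rightarrow> 'k op" where
  "W B \<equiv> wprod L (sorted_list_of_multiset B)"

lemma topf_W: "topf (app (W B) (delta C)) (B + C) (msgn B C)"
  using topf_word[of "delta C" C 1 "sorted_list_of_multiset B"] by (simp add: topf_def delta_def)

lemma app_W: "app (W B) (delta {#}) = delta B"
  by (simp add: app_sorted_word)

lemma coef_W [simp]: "coef (W B) C = (if C = B then 1 else 0)"
  unfolding coef_def app_W by (simp add: delta_def)

section \<open>The algebra as an algebra of operators\<close>

definition Alg :: "'k op set" where
  "Alg = subst L ` carrier F"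

definition supp :: "'k op \<Rightarrow> nat multiset set" where
  "supp u = {B. coef u B \<noteq> 0}"

lemma subst_sorted_form:
  assumes "sorted_form g"
  shows "coef (subst L g) B = Poly_Mapping.lookup g (Word (sorted_list_of_multiset B))"
proof -
  have "coef (subst L g) B = (\<Sum>w\<in>Poly_Mapping.keys g. Poly_Mapping.lookup g w * coef (wprod L (letters w)) B)"
    by (simp add: subst_def coef_sum)
  also have "\<dots> = (\<Sum>w\<in>Poly_Mapping.keys g.
      if w = Word (sorted_list_of_multiset B) then Poly_Mapping.lookup g w else 0)"
  proof (rule sum.cong[OF refl])
    fix w assume "w \<in> Poly_Mapping.keys g"
    then have s: "sorted (letters w)"
      using assms by (simp add: sorted_form_def)
    then have "B = mset (letters w) \<longleftrightarrow> w = Word (sorted_list_of_multiset B)"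
      by (metis mset_sorted_list_of_multiset sorted_list_of_multiset_mset sorted_sort_id word.collapse word.sel)
    then show "Poly_Mapping.lookup g w * coef (wprod L (letters w)) B =
        (if w = Word (sorted_list_of_multiset B) then Poly_Mapping.lookup g w else 0)"
      unfolding coef_def app_sorted_word[OF s] by (auto simp: delta_def)
  qed
  also have "\<dots> = Poly_Mapping.lookup g (Word (sorted_list_of_multiset B))"
    by (simp add: in_keys_iff)
  finally show ?thesis .
qed

text \<open>
  Linear independence of the sorted words: their coefficients are recovered from the action.
\<close>

lemma sorted_form_eq_0:
  assumes "sorted_form g" "subst L g = 0"
  shows "g = 0"
proof (rule poly_mapping_eqI)
  fix w
  show "Poly_Mapping.lookup g w = Poly_Mapping.lookup 0 w"
  proof (rule ccontr)
    assume "Poly_Mapping.lookup g w \<noteq> Poly_Mapping.lookup 0 w"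
    then have "Poly_Mapping.lookup g w \<noteq> 0" "sorted (letters w)"
      using assms(1) by (auto simp: sorted_form_def in_keys_iff)
    then have "coef (subst L g) (mset (letters w)) \<noteq> 0"
      using assms(1) by (simp add: subst_sorted_form sorted_sort_id)
    then show False
      using assms(2) by simp
  qed
qed

text \<open>
  The operators satisfy no relation beyond the given ones: modulo the ideal \<open>f\<close> is a combination of
  sorted words, and these are independent.
\<close>

lemma subst_eq_0_iff:
  assumes "f \<in> carrier F"
  shows "subst L f = 0 \<longleftrightarrow> f \<in> I"
proof
  assume f: "subst L f = 0"
  obtain g where g: "sorted_form g" "f - g \<in> I"
    using reducible_form[OF assms] by (auto simp: reducible_form_def)
  then have "subst L g = 0"
    using subst_ideal[OF V_rel_L g(2)] f by (simp add: subst_diff)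
  then have "g = 0"
    using g(1) by (rule sorted_form_eq_0[rotated])
  then show "f \<in> I"
    using g(2) by simp
qed (rule subst_ideal[OF V_rel_L])

lemma Alg_sorted_form:
  assumes "u \<in> Alg"
  obtains g where "sorted_form g" "u = subst L g"
proof -
  obtain f where f: "f \<in> carrier F" "u = subst L f"
    using assms by (auto simp: Alg_def)
  obtain g where g: "sorted_form g" "f - g \<in> I"
    using reducible_form[OF f(1)] by (auto simp: reducible_form_def)
  have "subst L (f - g) = 0"
    using g(2) by (rule subst_ideal[OF V_rel_L])
  then show ?thesis
    using that g(1) f(2) by (simp add: subst_diff)
qed

lemma Alg_expand:
  assumes "u \<in> Alg"
  shows "finite (supp u)" "\<And>B. B \<in> supp u \<Longrightarrow> set_mset B \<subseteq> {1..n}"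
    "u = (\<Sum>B\<in>supp u. scal (coef u B) * W B)"
proof -
  obtain g where g: "sorted_form g" "u = subst L g"
    using assms by (rule Alg_sorted_form)
  have "bij_betw (\<lambda>B. Word (sorted_list_of_multiset B)) (supp u) (Poly_Mapping.keys g)"
  proof (rule bij_betwI[where g = "\<lambda>w. mset (letters w)"])
    show "(\<lambda>B. Word (sorted_list_of_multiset B)) \<in> supp u \<rightarrow> Poly_Mapping.keys g"
      by (auto simp: supp_def g(2) subst_sorted_form[OF g(1)] in_keys_iff)
    show "(\<lambda>w. mset (letters w)) \<in> Poly_Mapping.keys g \<rightarrow> supp u"
      using g(1) by (auto simp: supp_def g(2) subst_sorted_form[OF g(1)] in_keys_iff
          sorted_form_def sorted_sort_id)
    show "Word (sorted_list_of_multiset (mset (letters w))) = w" if "w \<in> Poly_Mapping.keys g" for w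
      using that g(1) by (simp add: sorted_form_def sorted_sort_id)
  qed simp
  note bij = this
  show "finite (supp u)"
    using bij_betw_finite[OF bij] by simp
  show "set_mset B \<subseteq> {1..n}" if "B \<in> supp u" for B
  proof -
    have "Word (sorted_list_of_multiset B) \<in> Poly_Mapping.keys g"
      using bij that by (auto simp: bij_betw_def)
    then show ?thesis
      using g(1) unfolding sorted_form_def free_algebra_carrier
      by (metis set_sorted_list_of_multiset word.sel)
  qed
  show "u = (\<Sum>B\<in>supp u. scal (coef u B) * W B)"
    unfolding g(2) subst_sorted_form[OF g(1)] unfolding g(2)[symmetric]
    unfolding subst_def
    using sum.reindex_bij_betw[OF bij, of "\<lambda>w. scal (Poly_Mapping.lookup g w) * wprod L (letters w)"]
    by (simp add: g(2) subst_def)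
qed

lemma Alg_scal [simp]: "scal c \<in> Alg"
  and Alg_L [simp]: "i \<in> {1..n} \<Longrightarrow> L i \<in> Alg"
  unfolding Alg_def by (metis image_eqI subst_free_scalar F_scalar, metis image_eqI subst_free_gen F_gen)

lemma Alg_add [simp]: "u \<in> Alg \<Longrightarrow> v \<in> Alg \<Longrightarrow> u + v \<in> Alg"
  and Alg_mult [simp]: "u \<in> Alg \<Longrightarrow> v \<in> Alg \<Longrightarrow> u * v \<in> Alg"
  and Alg_diff [simp]: "u \<in> Alg \<Longrightarrow> v \<in> Alg \<Longrightarrow> u - v \<in> Alg"
  and Alg_uminus [simp]: "u \<in> Alg \<Longrightarrow> - u \<in> Alg"
  unfolding Alg_def by (auto simp flip: subst_add subst_mult subst_diff subst_uminus)

lemma Alg_0 [simp]: "0 \<in> Alg" and Alg_1 [simp]: "1 \<in> Alg"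
  using Alg_scal[of 0] Alg_scal[of 1] by simp_all

lemma Alg_sum: "(\<And>x. x \<in> S \<Longrightarrow> u x \<in> Alg) \<Longrightarrow> (\<Sum>x\<in>S. u x) \<in> Alg"
  by (induction S rule: infinite_finite_induct) simp_all

lemma Alg_wprod:
  "set w \<subseteq> {1..n} \<Longrightarrow> (\<And>i. i \<in> {1..n} \<Longrightarrow> z i \<in> Alg) \<Longrightarrow> wprod z w \<in> Alg"
  by (induction w) auto

lemma Alg_induct [consumes 1, case_names scal gen add mult]:
  assumes "u \<in> Alg" and "\<And>c. P (scal c)" and "\<And>i. i \<in> {1..n} \<Longrightarrow> P (L i)"
    and "\<And>u v. u \<in> Alg \<Longrightarrow> v \<in> Alg \<Longrightarrow> P u \<Longrightarrow> P v \<Longrightarrow> P (u + v)"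
    and "\<And>u v. u \<in> Alg \<Longrightarrow> v \<in> Alg \<Longrightarrow> P u \<Longrightarrow> P v \<Longrightarrow> P (u * v)"
  shows "P u"
proof -
  have word: "P (wprod L w) \<and> wprod L w \<in> Alg" if "set w \<subseteq> {1..n}" for w
    using that
  proof (induction w)
    case Nil
    then show ?case using assms(2)[of 1] by simp
  next
    case (Cons i w)
    then show ?case using assms(3,5) by simp
  qed
  obtain f where f: "f \<in> carrier F" "u = subst L f"
    using assms(1) by (auto simp: Alg_def)
  have "P (\<Sum>w\<in>S. scal (c w) * wprod L (letters w)) \<and>
      (\<Sum>w\<in>S. scal (c w) * wprod L (letters w)) \<in> Alg"
    if "finite S" "\<forall>w\<in>S. set (letters w) \<subseteq> {1..n}" for S and c :: "nat word \<Rightarrow> 'k"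
    using that
  proof (induction S rule: finite_induct)
    case empty
    then show ?case using assms(2)[of 0] by simp
  next
    case (insert w S)
    then show ?case
      using assms(2,4,5) word[of "letters w"] by simp
  qed
  then show ?thesis
    using f by (simp add: subst_def free_algebra_carrier)
qed

text \<open>
  The product of two sorted words is understood through its action on a basis function, so the bounds
  of \<open>topf_W\<close> apply to products.
\<close>

lemma coef_mult:
  assumes "u \<in> Alg" "v \<in> Alg"
  shows "coef (u * v) D =
    (\<Sum>B\<in>supp u. \<Sum>C\<in>supp v. coef u B * coef v C * app (W B) (delta C) D)"
proof -
  have "u * v = (\<Sum>B\<in>supp u. scal (coef u B) * W B) * (\<Sum>C\<in>supp v. scal (coef v C) * W C)"
    using Alg_expand(3)[OF assms(1)] Alg_expand(3)[OF assms(2)] by argo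
  also have "\<dots> = (\<Sum>B\<in>supp u. \<Sum>C\<in>supp v. scal (coef u B * coef v C) * (W B * W C))"
    by (simp add: sum_product scal_mult mult.assoc scal_left[of "W _"])
  finally have "coef (u * v) D =
      (\<Sum>B\<in>supp u. \<Sum>C\<in>supp v. coef u B * coef v C * coef (W B * W C) D)"
    by (simp add: coef_sum)
  then show ?thesis
    by (simp add: coef_def app_W app_fun)
qed

lemma Alg_eqI:
  assumes "u \<in> Alg" "v \<in> Alg" "\<And>B. coef u B = coef v B"
  shows "u = v"
proof -
  have "supp (u - v) = {}"
    using assms(3) by (simp add: supp_def)
  then show ?thesis
    using Alg_expand(3)[of "u - v"] assms(1,2) by simp
qed

end

section \<open>Leading terms\<close>

text \<open>
  Two orders are needed: inclusion, which controls how a multilinear element changes under a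
  substitution, and a total order by degree, for which every nonzero element has a leading term.
\<close>

definition compatible :: "(nat multiset \<Rightarrow> nat multiset \<Rightarrow> bool) \<Rightarrow> bool" where
  "compatible R \<longleftrightarrow> (\<forall>A B. A \<subseteq># B \<longrightarrow> R A B) \<and> (\<forall>A B C. R A B \<longrightarrow> R B C \<longrightarrow> R A C) \<and>
     (\<forall>A B. R A B \<longrightarrow> R B A \<longrightarrow> A = B) \<and> (\<forall>A B C. R (A + C) (B + C) \<longleftrightarrow> R A B)"

lemma compatibleD:
  assumes "compatible R"
  shows "A \<subseteq># B \<Longrightarrow> R A B" "R A B \<Longrightarrow> R B C \<Longrightarrow> R A C" "R A B \<Longrightarrow> R B A \<Longrightarrow> A = B"
    "R (A + C) (B + C) \<longleftrightarrow> R A B" "R (C + A) (C + B) \<longleftrightarrow> R A B"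
  using assms unfolding compatible_def by (blast, blast, blast, blast, metis add.commute)

lemma compatible_subset: "compatible (\<subseteq>#)"
  unfolding compatible_def
  by (auto intro: subset_mset.order_trans subset_mset.antisym)

text \<open>
  Ties in degree are broken by the multiset order, which is total, well-founded and invariant under
  addition.
\<close>

definition deglex :: "nat multiset \<Rightarrow> nat multiset \<Rightarrow> bool" where
  "deglex A B \<longleftrightarrow> size A < size B \<or> size A = size B \<and> A \<le> B"

lemma compatible_deglex: "compatible deglex"
proof -
  have "deglex A B" if "A \<subseteq># B" for A B
    using that size_mset_mono[OF that] subset_eq_imp_le_multiset[OF that] by (auto simp: deglex_def)
  then show ?thesis
    unfolding compatible_def by (auto simp: deglex_def)
qed

lemma deglex_total: "deglex A B \<or> deglex B A"
  by (auto simp: deglex_def)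

lemma deglex_max:
  assumes "finite S" "S \<noteq> {}"
  shows "\<exists>G\<in>S. \<forall>B\<in>S. deglex B G"
  using assms
proof (induction S rule: finite_ne_induct)
  case (insert A S)
  then obtain G where G: "G \<in> S" "\<And>B. B \<in> S \<Longrightarrow> deglex B G" by blast
  have "deglex A A" by (simp add: deglex_def)
  show ?case
  proof (cases "deglex A G")
    case False
    then have "deglex B A" if "B \<in> S" for B
      using G(2)[OF that] deglex_total compatibleD(2)[OF compatible_deglex] by blast
    then show ?thesis using \<open>deglex A A\<close> by blast
  qed (use G in blast)
qed (simp add: deglex_def)

lemma wf_deglex: "wf {(A, B). deglex A B \<and> A \<noteq> B}"
proof -
  have "wf (inv_image (less_than <*lex*> {(A, B). A < B}) (\<lambda>A :: nat multiset. (size A, A)))"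
    by (intro wf_inv_image wf_lex_prod wf_less_than wf)
  then show ?thesis
    by (rule wf_subset) (auto simp: deglex_def)
qed

text \<open>
  The letters greater than \<open>i\<close> contribute to the left-hand side and the smaller ones to \<open>sg i B\<close>;
  together these are all letters other than \<open>i\<close>.
\<close>

lemma msgn_single_right: "msgn B {#i#} = (- 1) ^ (size B + count B i) * sg i B"
  by (induction B) auto

context V_data
begin

text \<open>
  The coefficient \<open>c\<close> may vanish; it is nonzero where \<open>G\<close> is meant to be a leading monomial.
\<close>

definition has_top :: "(nat multiset \<Rightarrow> nat multiset \<Rightarrow> bool) \<Rightarrow> 'k op \<Rightarrow> nat multiset \<Rightarrow> 'k \<Rightarrow> bool" where
  "has_top R u G c \<longleftrightarrow> u \<in> Alg \<and> coef u G = c \<and> (\<forall>D. coef u D \<noteq> 0 \<longrightarrow> R D G)"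

text \<open>
  A contribution to the coefficient at \<open>G + H\<close> comes from \<open>B\<close>, \<open>C\<close> with \<open>B\<close> below \<open>G\<close>, \<open>C\<close> below
  \<open>H\<close> and \<open>G + H\<close> below \<open>B + C\<close>.  Cancellation in the order then leaves only the pair \<open>G\<close>, \<open>H\<close>.
\<close>

lemma has_top_mult:
  assumes R: "compatible R" and u: "has_top R u G c" and v: "has_top R v H d"
  shows "has_top R (u * v) (G + H) (msgn G H * c * d)"
proof -
  have uv: "u \<in> Alg" "v \<in> Alg" "coef u G = c" "coef v H = d"
    using u v by (auto simp: has_top_def)
  have le_sum: "R (B + C) (G + C)" "R (G + C) (G + H)" if "B \<in> supp u" "C \<in> supp v" for B C
    using that u v compatibleD(4,5)[OF R] by (auto simp: has_top_def supp_def)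
  have bound: "R D (B + C)" if "app (W B) (delta C) D \<noteq> 0" for B C D
    using topf_W[of B C] that compatibleD(1)[OF R] by (auto simp: topf_def)
  have le_top: "R D (G + H)" if "coef (u * v) D \<noteq> 0" for D
  proof -
    obtain B C where "B \<in> supp u" "C \<in> supp v" "app (W B) (delta C) D \<noteq> 0"
      using \<open>coef (u * v) D \<noteq> 0\<close> unfolding coef_mult[OF uv(1,2)]
      by (metis (no_types, lifting) mult_not_zero sum.neutral)
    then show ?thesis
      using bound le_sum compatibleD(2)[OF R] by meson
  qed
  have "coef u B * coef v C * app (W B) (delta C) (G + H) =
      (if B = G then if C = H then msgn G H * c * d else 0 else 0)"
    if BC: "B \<in> supp u" "C \<in> supp v" for B C
  proof (cases "app (W B) (delta C) (G + H) = 0")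
    case True
    then show ?thesis
      using topf_W[of G H] by (auto simp: topf_def)
  next
    case False
    then have "R (G + H) (B + C)" by (rule bound)
    then have "R (G + H) (G + C)" "R (G + C) (B + C)"
      using le_sum[OF BC] compatibleD(2)[OF R] by blast+
    then have "R H C" "R G B"
      using compatibleD(4,5)[OF R] by blast+
    moreover have "R C H" "R B G"
      using BC u v by (auto simp: has_top_def supp_def)
    ultimately have "C = H" "B = G"
      using compatibleD(3)[OF R] by blast+
    then show ?thesis
      using topf_W[of G H] uv by (simp add: topf_def)
  qed
  then have "coef (u * v) (G + H) =
      (\<Sum>B\<in>supp u. \<Sum>C\<in>supp v. if B = G then if C = H then msgn G H * c * d else 0 else 0)"
    unfolding coef_mult[OF uv(1,2)] by (intro sum.cong) auto
  also have "\<dots> = (\<Sum>B\<in>supp u. if B = G then \<Sum>C\<in>supp v. if C = H then msgn G H * c * d else 0 else 0)"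
    by (intro sum.cong) auto
  also have "\<dots> = msgn G H * c * d"
    using uv Alg_expand(1)[OF uv(1)] Alg_expand(1)[OF uv(2)] by (simp add: supp_def)
  finally have "coef (u * v) (G + H) = msgn G H * c * d" .
  then show ?thesis
    using le_top uv by (simp add: has_top_def)
qed

lemma has_top_add:
  assumes "has_top R u G c" "v \<in> Alg" "\<And>D. coef v D \<noteq> 0 \<Longrightarrow> R D G"
  shows "has_top R (u + v) G (c + coef v G)"
  using assms unfolding has_top_def by (metis Alg_add add_cancel_right_right coef_simps(2))

lemma has_top_add': "has_top R u G c \<Longrightarrow> has_top R v G d \<Longrightarrow> has_top R (u + v) G (c + d)"
  using has_top_add[of R u G c v] by (auto simp: has_top_def)

lemma has_top_scale: "has_top R u G c \<Longrightarrow> has_top R (scal d * u) G (d * c)"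
  by (simp add: has_top_def)

lemma has_top_scal: "compatible R \<Longrightarrow> has_top R (scal c) {#} c"
  using compatibleD(1)[of R] by (simp add: has_top_def)

lemma has_top_unique:
  "compatible R \<Longrightarrow> has_top R u G c \<Longrightarrow> c \<noteq> 0 \<Longrightarrow> has_top R u H d \<Longrightarrow> d \<noteq> 0 \<Longrightarrow> G = H \<and> c = d"
  using compatibleD(3)[of R G H] unfolding has_top_def by blast

lemma has_top_nonzero: "has_top R u G c \<Longrightarrow> c \<noteq> 0 \<Longrightarrow> u \<noteq> 0"
  by (auto simp: has_top_def)

lemma has_top_subset_deglex: "has_top (\<subseteq>#) u G c \<Longrightarrow> has_top deglex u G c"
  using compatibleD(1)[OF compatible_deglex] by (simp add: has_top_def)

lemma coef_L [simp]: "coef (L i) B = (if B = {#i#} then 1 else 0)"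
  using coef_W[of "{#i#}" B] by simp

lemma has_top_L: "compatible R \<Longrightarrow> i \<in> {1..n} \<Longrightarrow> has_top R (L i) {#i#} 1"
  using compatibleD(1)[of R] by (simp add: has_top_def)

lemma exists_lead:
  assumes "u \<in> Alg" "u \<noteq> 0"
  obtains G c where "has_top deglex u G c" "c \<noteq> 0"
proof -
  have "supp u \<noteq> {}"
    using Alg_expand(3)[OF assms(1)] assms(2) by auto
  then have "\<exists>G\<in>supp u. \<forall>B\<in>supp u. deglex B G"
    using deglex_max Alg_expand(1)[OF assms(1)] by blast
  then obtain G where "G \<in> supp u" "\<forall>B\<in>supp u. deglex B G" by blast
  then have "has_top deglex u G (coef u G)" "coef u G \<noteq> 0"
    using assms(1) by (auto simp: has_top_def supp_def)
  then show ?thesis by (rule that)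
qed

lemma lead_set:
  assumes "has_top R u G c" "c \<noteq> 0"
  shows "set_mset G \<subseteq> {1..n}"
  using assms Alg_expand(2)[of u G] by (simp add: has_top_def supp_def)

lemma Alg_domain:
  assumes "u \<in> Alg" "v \<in> Alg" "u * v = 0"
  shows "u = 0 \<or> v = 0"
proof (rule ccontr)
  assume *: "\<not> (u = 0 \<or> v = 0)"
  obtain G c where u: "has_top deglex u G c" "c \<noteq> 0"
    using exists_lead[of u] assms * by blast
  obtain H d where v: "has_top deglex v H d" "d \<noteq> 0"
    using exists_lead[of v] assms * by blast
  from has_top_mult[OF compatible_deglex u(1) v(1)] show False
    using has_top_nonzero u(2) v(2) assms(3) by (metis mult_eq_0_iff msgn_nonzero)
qed

lemma Alg_cancel_right:
  assumes "u \<in> Alg" "v \<in> Alg" "w \<in> Alg" "u * w = v * w" "w \<noteq> 0"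
  shows "u = v"
  using Alg_domain[of "u - v" w] assms by (simp add: left_diff_distrib)

section \<open>Pseudoscalars\<close>

text \<open>
  The structure constants, extended symmetrically to all pairs of distinct indices.
\<close>

definition sym_a :: "nat \<Rightarrow> nat \<Rightarrow> 'k" where
  "sym_a i j = a (min i j) (max i j)"

lemma V_rel_sym:
  assumes "V_rel z" "i \<in> {1..n}" "j \<in> {1..n}" "i \<noteq> j"
  shows "z i * z j + z j * z i = scal (sym_a i j)"
proof (cases "i < j")
  case True
  then show ?thesis using assms by (simp add: V_rel_def sym_a_def)
next
  case False
  then have "j < i" using assms by simp
  then have "z j * z i + z i * z j = scal (a j i)" using assms by (simp add: V_rel_def)
  with \<open>j < i\<close> show ?thesis by (simp add: sym_a_def add.commute)
qed

text \<open>
  An anticommutator that is scalar makes the square commute: the two corrections cancel.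
\<close>

lemma square_commute:
  assumes "x * y + y * x = scal (c :: 'k)"
  shows "x * (y * y) = (y * y) * x"
proof -
  have xy: "x * y = scal c - y * x"
    using assms by (simp add: algebra_simps)
  have "x * (y * y) = (x * y) * y"
    by (simp add: mult.assoc)
  also have "\<dots> = scal c * y - y * (x * y)"
    unfolding xy by (simp add: left_diff_distrib mult.assoc xy)
  also have "\<dots> = (y * y) * x"
    unfolding xy by (simp add: right_diff_distrib mult.assoc scal_central[of y])
  finally show ?thesis .
qed

lemma V_rel_square_commute:
  assumes "V_rel z" "i \<in> {1..n}" "j \<in> {1..n}"
  shows "z j * (z i * z i) = (z i * z i) * z j"
  using square_commute[OF V_rel_sym[OF assms(1)], of j i] assms by (cases "i = j") (auto simp: mult.assoc)

lemma central_if_generators: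
  assumes "\<And>j. j \<in> {1..n} \<Longrightarrow> L j * u = u * L j" "v \<in> Alg"
  shows "v * u = u * v"
  using assms(2)
proof (induction v rule: Alg_induct)
  case (mult v w)
  then show ?case by (metis mult.assoc)
qed (auto simp: assms(1) scal_central distrib_left distrib_right)

lemma L_square_central: "i \<in> {1..n} \<Longrightarrow> v \<in> Alg \<Longrightarrow> v * (L i * L i) = (L i * L i) * v"
  by (rule central_if_generators) (auto intro: V_rel_square_commute V_rel_L)

text \<open>
  Up to scalars this is the antisymmetrized product of the generators of the list.  The recursion takes
  a commutator or an anticommutator according to parity; it avoids an orthogonal basis, for which one
  would have to invert polynomials in the squares.
\<close>

primrec pseudoscalar :: "nat list \<Rightarrow> 'k op" where
  "pseudoscalar [] = 1"
| "pseudoscalar (i # w) = L i * pseudoscalar w + scal ((- 1) ^ length w) * (pseudoscalar w * L i)"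

lemma pseudoscalar_Alg: "set w \<subseteq> {1..n} \<Longrightarrow> pseudoscalar w \<in> Alg"
  by (induction w) auto

lemma pm_power: "(- 1 :: 'k) ^ m = 1 \<or> (- 1 :: 'k) ^ m = - 1"
  by (simp add: minus_one_power_iff)

text \<open>
  The step of the recursion for \<open>pseudoscalar\<close>, from the pseudoscalar \<open>O'\<close> of the old generators to that with \<open>y\<close>
  added.  The relation of \<open>x\<close> and \<open>y\<close> contributes its scalar twice, and by the choice of the sign
  these contributions cancel.
\<close>

lemma pseudo_step_inside:
  assumes xy: "x * y + y * x = scal (c :: 'k)" and s: "s = 1 \<or> s = (- 1 :: 'k)"
    and xO: "x * O' = scal (- s) * (O' * x)"
  shows "x * (y * O' + scal s * (O' * y)) = scal s * ((y * O' + scal s * (O' * y)) * x)"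
proof -
  have xy': "x * y = scal c - y * x"
    using xy by (simp add: algebra_simps)
  have "x * (y * O') = (x * y) * O'" "x * (O' * y) = scal (- s) * (O' * (x * y))"
    using xO by (simp_all add: mult.assoc[symmetric])
  then have "x * (y * O') = scal c * O' - y * (scal (- s) * (O' * x))"
      "x * (O' * y) = scal (- s) * (scal c * O' - O' * (y * x))"
    unfolding xy' by (simp_all add: left_diff_distrib right_diff_distrib mult.assoc xO scal_central[of O'])
  then show ?thesis
    using s by (auto simp: algebra_simps scal_uminus)
qed

lemma pseudo_step_outside:
  assumes xy: "x * y = - (y * x)" and s: "s = 1 \<or> s = (- 1 :: 'k)"
    and xO: "x * O' = scal s * (O' * x)"
  shows "x * (y * O' + scal s * (O' * y)) = scal (- s) * ((y * O' + scal s * (O' * y)) * x)"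
proof -
  have "x * (y * O') = (x * y) * O'" "x * (O' * y) = scal s * (O' * (x * y))"
    using xO by (simp_all add: mult.assoc[symmetric])
  then have "x * (y * O') = - (y * (scal s * (O' * x)))" "x * (O' * y) = - (scal s * (O' * (y * x)))"
    unfolding xy by (simp_all add: mult.assoc xO)
  then show ?thesis
    using s by (auto simp: algebra_simps scal_uminus)
qed

lemma pseudoscalar_inside:
  assumes "set w \<subseteq> {1..n}" "distinct w" "j \<in> set w"
  shows "L j * pseudoscalar w = scal (- ((- 1) ^ length w)) * (pseudoscalar w * L j)"
  using assms
proof (induction w arbitrary: j)
  case (Cons i w)
  show ?case
  proof (cases "j = i")
    case True
    have "pseudoscalar w * (L i * L i) = (L i * L i) * pseudoscalar w"
      using Cons.prems by (intro L_square_central pseudoscalar_Alg) auto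
    then show ?thesis
      using pm_power[of "length w"] True by (auto simp: algebra_simps scal_uminus)
  next
    case False
    have "L j * L i + L i * L j = scal (sym_a j i)"
      using Cons.prems False by (intro V_rel_sym[OF V_rel_L]) auto
    from pseudo_step_inside[OF this pm_power[of "length w"]] show ?thesis
      using Cons False by simp
  qed
qed simp

lemma pseudoscalar_outside:
  assumes "\<And>i. i \<in> set w \<Longrightarrow> x * L i = - (L i * x)"
  shows "x * pseudoscalar w = scal ((- 1) ^ length w) * (pseudoscalar w * x)"
  using assms
proof (induction w)
  case (Cons i w)
  from pseudo_step_outside[OF _ pm_power[of "length w"], of x "L i" "pseudoscalar w"] show ?case
    using Cons by simp
qed simp

text \<open>
  The two terms of the recursion have the same top coefficient: commuting \<open>x\<^sub>i\<close> past the other letters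
  costs exactly the sign put in front of the second term.  So the coefficient doubles in each step and
  survives in characteristic \<open>0\<close>.
\<close>

lemma pseudoscalar_top:
  assumes "set w \<subseteq> {1..n}" "distinct w"
  shows "\<exists>c. c \<noteq> 0 \<and> has_top (\<subseteq>#) (pseudoscalar w) (mset w) c"
  using assms
proof (induction w)
  case Nil
  then show ?case
    using has_top_scal[OF compatible_subset, of 1] by (intro exI[of _ 1]) simp
next
  case (Cons i w)
  then obtain c where c: "c \<noteq> 0" "has_top (\<subseteq>#) (pseudoscalar w) (mset w) c" by auto
  have Li: "has_top (\<subseteq>#) (L i) {#i#} 1"
    using Cons.prems by (intro has_top_L compatible_subset) auto
  have "has_top (\<subseteq>#) (L i * pseudoscalar w) (mset (i # w)) (sg i (mset w) * c)"
    using has_top_mult[OF compatible_subset Li c(2)] by simp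
  moreover have "has_top (\<subseteq>#) (scal ((- 1) ^ length w) * (pseudoscalar w * L i)) (mset (i # w)) (sg i (mset w) * c)"
  proof -
    have i: "count (mset w) i = 0"
      using Cons.prems by (simp add: count_eq_zero_iff)
    have "(- 1) ^ length w * ((- 1) ^ length w * (sg i (mset w) * c)) = sg i (mset w) * c"
      by (simp flip: mult.assoc power_mult_distrib)
    then show ?thesis
      using has_top_scale[OF has_top_mult[OF compatible_subset c(2) Li], of "(- 1) ^ length w"]
      by (simp add: i msgn_single_right mult.assoc)
  qed
  ultimately have "has_top (\<subseteq>#) (pseudoscalar (i # w)) (mset (i # w)) (sg i (mset w) * c + sg i (mset w) * c)"
    unfolding pseudoscalar.simps by (rule has_top_add')
  moreover have "sg i (mset w) * c + sg i (mset w) * c \<noteq> 0"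
    using c(1) by (simp add: sg_def flip: mult_2)
  ultimately show ?case by blast
qed

section \<open>Endomorphisms of the operator algebra\<close>

definition alg_end :: "('k op \<Rightarrow> 'k op) \<Rightarrow> bool" where
  "alg_end \<theta> \<longleftrightarrow> (\<forall>u\<in>Alg. \<theta> u \<in> Alg) \<and> (\<forall>c. \<theta> (scal c) = scal c) \<and>
     (\<forall>u\<in>Alg. \<forall>v\<in>Alg. \<theta> (u + v) = \<theta> u + \<theta> v \<and> \<theta> (u * v) = \<theta> u * \<theta> v)"

text \<open>
  The inverse is carried along, since all arguments below use an automorphism together with it.
\<close>

definition alg_aut :: "('k op \<Rightarrow> 'k op) \<Rightarrow> ('k op \<Rightarrow> 'k op) \<Rightarrow> bool" where
  "alg_aut \<theta> \<eta> \<longleftrightarrow> alg_end \<theta> \<and> alg_end \<eta> \<and> (\<forall>u\<in>Alg. \<eta> (\<theta> u) = u \<and> \<theta> (\<eta> u) = u)"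

lemma alg_end_simps:
  assumes "alg_end \<theta>"
  shows "\<theta> (scal c) = scal c" "\<theta> 0 = 0" "\<theta> 1 = 1"
    and "u \<in> Alg \<Longrightarrow> \<theta> u \<in> Alg"
    and "u \<in> Alg \<Longrightarrow> v \<in> Alg \<Longrightarrow> \<theta> (u + v) = \<theta> u + \<theta> v"
    and "u \<in> Alg \<Longrightarrow> v \<in> Alg \<Longrightarrow> \<theta> (u * v) = \<theta> u * \<theta> v"
    and "u \<in> Alg \<Longrightarrow> \<theta> (scal c * u) = scal c * \<theta> u"
    and "u \<in> Alg \<Longrightarrow> \<theta> (- u) = - \<theta> u"
    and "u \<in> Alg \<Longrightarrow> v \<in> Alg \<Longrightarrow> \<theta> (u - v) = \<theta> u - \<theta> v"
proof -
  note th = assms[unfolded alg_end_def]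
  have s: "\<theta> (scal c) = scal c" for c
    using th by blast
  show "\<theta> (scal c) = scal c" "\<theta> 0 = 0" "\<theta> 1 = 1"
    using s[of c] s[of 0] s[of 1] by simp_all
  show "u \<in> Alg \<Longrightarrow> \<theta> u \<in> Alg" "u \<in> Alg \<Longrightarrow> v \<in> Alg \<Longrightarrow> \<theta> (u + v) = \<theta> u + \<theta> v"
    "u \<in> Alg \<Longrightarrow> v \<in> Alg \<Longrightarrow> \<theta> (u * v) = \<theta> u * \<theta> v"
    using th by blast+
  have sc: "u \<in> Alg \<Longrightarrow> \<theta> (scal c * u) = scal c * \<theta> u" for u c
    using th s[of c] by (metis Alg_scal)
  then show "u \<in> Alg \<Longrightarrow> \<theta> (scal c * u) = scal c * \<theta> u" .
  have um: "u \<in> Alg \<Longrightarrow> \<theta> (- u) = - \<theta> u" for u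
    using sc[of u "- 1"] by (simp add: scal_uminus)
  then show "u \<in> Alg \<Longrightarrow> \<theta> (- u) = - \<theta> u" .
  show "u \<in> Alg \<Longrightarrow> v \<in> Alg \<Longrightarrow> \<theta> (u - v) = \<theta> u - \<theta> v"
    using th um[of v] by (metis Alg_uminus diff_conv_add_uminus)
qed

lemma alg_end_sum:
  assumes "alg_end \<theta>" "\<And>x. x \<in> S \<Longrightarrow> u x \<in> Alg"
  shows "\<theta> (\<Sum>x\<in>S. u x) = (\<Sum>x\<in>S. \<theta> (u x))"
  using assms(2)
  by (induction S rule: infinite_finite_induct)
    (auto simp: alg_end_simps(2,5)[OF assms(1)] Alg_sum)

lemma alg_end_wprod:
  assumes "alg_end \<theta>" "set w \<subseteq> {1..n}"
  shows "\<theta> (wprod L w) = wprod (\<lambda>i. \<theta> (L i)) w"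
  using assms(2)
proof (induction w)
  case (Cons i w)
  then show ?case
    using Alg_wprod[of w L] by (simp add: alg_end_simps(6)[OF assms(1)])
qed (simp add: alg_end_simps(3)[OF assms(1)])

lemma alg_aut_nonzero:
  assumes "alg_aut \<theta> \<eta>" "u \<in> Alg" "u \<noteq> 0"
  shows "\<theta> u \<noteq> 0"
proof
  assume "\<theta> u = 0"
  moreover have "\<eta> (\<theta> u) = u" "\<eta> 0 = 0"
    using assms(1,2) alg_end_simps(2) by (simp_all add: alg_aut_def)
  ultimately show False using assms(3) by simp
qed

lemma V_rel_image:
  assumes "alg_end \<theta>"
  shows "V_rel (\<lambda>i. \<theta> (L i))"
  unfolding V_rel_def
proof (intro allI impI)
  fix i j assume ij: "1 \<le> i" "i < j" "j \<le> n"
  have "\<theta> (L i * L j + L j * L i) = \<theta> (scal (a i j))"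
    using V_rel_L ij by (simp add: V_rel_def)
  then show "\<theta> (L i) * \<theta> (L j) + \<theta> (L j) * \<theta> (L i) = scal (a i j)"
    using ij by (simp add: alg_end_simps[OF assms])
qed

section \<open>Elements that anticommute with all generators\<close>

definition gens :: "nat list" where
  "gens = [1..<Suc n]"

lemma gens [simp]: "set gens = {1..n}" "distinct gens" "length gens = n"
  by (auto simp: gens_def)

lemma pseudoscalar_gens_Alg: "pseudoscalar gens \<in> Alg"
  by (rule pseudoscalar_Alg) simp

lemma pseudoscalar_gens_top: obtains c where "c \<noteq> 0" "has_top (\<subseteq>#) (pseudoscalar gens) (mset gens) c"
proof -
  have "\<exists>c. c \<noteq> 0 \<and> has_top (\<subseteq>#) (pseudoscalar gens) (mset gens) c"
    by (rule pseudoscalar_top) simp_all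
  then show ?thesis using that by blast
qed

lemma intertwine:
  fixes u u' v v' Y :: "'k op"
  assumes "u' * Y = Y * u" "v' * Y = Y * v"
  shows "u' * v' * Y = Y * (u * v)"
proof -
  have "u' * v' * Y = u' * Y * v"
    by (simp only: mult.assoc assms(2))
  also have "\<dots> = Y * (u * v)"
    by (simp only: assms(1)) (simp only: mult.assoc)
  finally show ?thesis .
qed

lemma commute_mult:
  fixes u v w :: "'k op"
  assumes "u * v = v * u" "u * w = w * u"
  shows "u * (v * w) = (v * w) * u"
proof -
  have "u * (v * w) = v * (u * w)"
    by (simp only: assms(1) flip: mult.assoc)
  then show ?thesis
    by (simp only: assms(2) mult.assoc)
qed

text \<open>
  Products of the central squares realize every monomial with even exponents as a leading term.
\<close>

lemma central_even_monomial:
  assumes "set_mset E \<subseteq> {1..n}"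
  shows "\<exists>z c. has_top deglex z (E + E) c \<and> c \<noteq> 0 \<and> (\<forall>v\<in>Alg. v * z = z * v)"
  using assms
proof (induction E)
  case empty
  then show ?case
    using has_top_scal[OF compatible_deglex, of 1] by (intro exI[of _ 1] exI[of _ 1]) simp
next
  case (add i E)
  then obtain z c where z: "has_top deglex z (E + E) c" "c \<noteq> 0" "\<forall>v\<in>Alg. v * z = z * v"
    by auto
  have i: "i \<in> {1..n}" using add.prems by simp
  note Li = has_top_L[OF compatible_deglex i]
  have "has_top deglex ((L i * L i) * z) (add_mset i E + add_mset i E) (msgn {#i, i#} (E + E) * c)"
    using has_top_mult[OF compatible_deglex has_top_mult[OF compatible_deglex Li Li] z(1)] by simp
  moreover have "v * ((L i * L i) * z) = ((L i * L i) * z) * v" if "v \<in> Alg" for v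
    using commute_mult[OF L_square_central[OF i that]] z(3) that by blast
  ultimately show ?case
    using z(2) by (intro exI[of _ "L i * L i * z"] exI[of _ "msgn {#i, i#} (E + E) * c"]) simp
qed

text \<open>
  Comparing leading terms of \<open>u x\<^sub>i\<close> and \<open>- x\<^sub>i u\<close> shows that, in the leading monomial, the number of
  letters different from \<open>i\<close> is odd for every \<open>i\<close>.  So all exponents have the same parity; if they were even,
  so would be the degree, a contradiction.  They are therefore odd, and the leading term is that of a
  central element times the pseudoscalar.  Subtracting a multiple of this product lowers the leading monomial.
\<close>

lemma anticommutant:
  assumes "even n" "u \<in> Alg" "\<And>i. i \<in> {1..n} \<Longrightarrow> u * L i = - (L i * u)"
  shows "\<exists>c\<in>Alg. u = c * pseudoscalar gens"
proof -
  obtain c0 where c0: "c0 \<noteq> 0" "has_top deglex (pseudoscalar gens) (mset gens) c0"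
    using pseudoscalar_gens_top has_top_subset_deglex by metis
  have pseudoscalar_anti: "pseudoscalar gens * L i = - (L i * pseudoscalar gens)" if "i \<in> {1..n}" for i
  proof -
    show ?thesis
      using pseudoscalar_inside[of gens i] that assms(1) by (simp add: scal_uminus)
  qed
  have main: "\<exists>c\<in>Alg. u = c * pseudoscalar gens"
    if "has_top deglex u G d" "d \<noteq> 0" "\<And>i. i \<in> {1..n} \<Longrightarrow> u * L i = - (L i * u)" for G d u
    using that
  proof (induction G arbitrary: u d rule: wf_induct_rule[OF wf_deglex])
    case (1 G)
    have uAlg: "u \<in> Alg" using 1 by (simp add: has_top_def)
    have G: "set_mset G \<subseteq> {1..n}" using 1 lead_set by blast
    have odd: "odd (size G + count G i)" if i: "i \<in> {1..n}" for i
    proof -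
      note Li = has_top_L[OF compatible_deglex i]
      have 2: "has_top deglex (u * L i) (add_mset i G) (msgn G {#i#} * d)"
        using has_top_mult[OF compatible_deglex 1(2) Li] by simp
      have "has_top deglex (- (L i * u)) (add_mset i G) (- (sg i G * d))"
        using has_top_scale[OF has_top_mult[OF compatible_deglex Li 1(2)], of "- 1"] by (simp add: scal_uminus)
      then have "msgn G {#i#} * d = - (sg i G * d)"
        using 2 1(4)[OF i] by (simp add: has_top_def)
      then have "(- 1) ^ (size G + count G i) * sg i G = (- sg i G :: 'k)"
        using 1(3) unfolding msgn_single_right by (metis mult_minus_left mult_right_cancel)
      then show ?thesis
        by (cases "even (size G + count G i)") (auto simp: sg_def)
    qed
    have "odd (count G i)" if i: "i \<in> {1..n}" for i
    proof (rule ccontr)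
      assume "\<not> odd (count G i)"
      then have "odd (size G)" using odd[OF i] by simp
      then have "even (count G j)" if "j \<in> {1..n}" for j
        using odd[OF that] by simp
      then have "even (\<Sum>j\<in>set_mset G. count G j)"
        using G by (intro dvd_sum) auto
      then show False
        using \<open>odd (size G)\<close> by (simp add: size_multiset_overloaded_eq)
    qed
    note cnt = this
    \<comment> \<open>Half of the even multiset that remains after removing one letter of each kind.\<close>
    define E where "E = Abs_multiset (\<lambda>i. count G i div 2)"
    have E: "count E i = count G i div 2" for i
    proof -
      have "finite {i. 0 < count G i div 2}"
        by (rule finite_subset[of _ "set_mset G"]) (auto intro: count_inI)
      then show ?thesis
        unfolding E_def by (simp add: count_Abs_multiset)
    qed
    have GE: "G = E + E + mset gens"
    proof (rule multiset_eqI)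
      fix i
      show "count G i = count (E + E + mset gens) i"
      proof (cases "i \<in> {1..n}")
        case True
        then have "count (mset gens) i = 1"
          using distinct_count_atmost_1[of gens] by simp
        then show ?thesis
          using cnt[OF True] by (simp add: E) presburger
      next
        case False
        then have "count G i = 0" "count (mset gens) i = 0"
          using G by (auto simp: count_eq_zero_iff)
        then show ?thesis by (simp add: E)
      qed
    qed
    have "set_mset E \<subseteq> {1..n}"
      using G GE by auto
    then obtain z c where z: "has_top deglex z (E + E) c" "c \<noteq> 0" "\<And>v. v \<in> Alg \<Longrightarrow> v * z = z * v"
      using central_even_monomial by blast
    define e where "e = msgn (E + E) (mset gens) * c * c0"
    have "e \<noteq> 0" using z(2) c0(1) by (simp add: e_def)
    have zO: "has_top deglex (z * pseudoscalar gens) G e"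
      using has_top_mult[OF compatible_deglex z(1) c0(2)] unfolding GE e_def .
    define v where "v = u - scal (d / e) * (z * pseudoscalar gens)"
    have zAlg: "z \<in> Alg" using z(1) by (simp add: has_top_def)
    have vAlg: "v \<in> Alg"
      unfolding v_def by (intro Alg_diff uAlg Alg_mult Alg_scal zAlg pseudoscalar_gens_Alg)
    have v_anti: "v * L i = - (L i * v)" if i: "i \<in> {1..n}" for i
    proof -
      have "z * pseudoscalar gens * L i = z * (- (L i * pseudoscalar gens))"
        using pseudoscalar_anti[OF i] by (simp add: mult.assoc)
      also have "\<dots> = - (L i * (z * pseudoscalar gens))"
        using z(3)[of "L i"] i by (simp add: mult.assoc[symmetric])
      finally show ?thesis
        unfolding v_def using 1(4)[OF i]
        by (simp add: left_diff_distrib right_diff_distrib mult.assoc scal_left[of "L i"])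
    qed
    have "\<exists>c\<in>Alg. v = c * pseudoscalar gens"
    proof (cases "v = 0")
      case True
      then show ?thesis by (intro bexI[of _ 0]) auto
    next
      case False
      then obtain H h where H: "has_top deglex v H h" "h \<noteq> 0"
        using exists_lead vAlg by blast
      have "coef v G = 0"
        using 1(2) zO \<open>e \<noteq> 0\<close> by (simp add: v_def has_top_def)
      moreover have "deglex D G" if "coef v D \<noteq> 0" for D
      proof (rule ccontr)
        assume "\<not> deglex D G"
        then have "coef u D = 0" "coef (z * pseudoscalar gens) D = 0"
          using 1(2) zO unfolding has_top_def by blast+
        then show False
          using that by (simp add: v_def)
      qed
      ultimately have "deglex H G" "H \<noteq> G"
        using H by (auto simp: has_top_def)
      then show ?thesis
        using 1(1)[of H v h] H v_anti by simp
    qed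
    then obtain c' where "c' \<in> Alg" "v = c' * pseudoscalar gens" by blast
    then have "u = (c' + scal (d / e) * z) * pseudoscalar gens" "c' + scal (d / e) * z \<in> Alg"
      using zAlg by (auto simp: v_def distrib_right mult.assoc diff_eq_eq)
    then show ?case by blast
  qed
  show ?thesis
  proof (cases "u = 0")
    case True
    then show ?thesis by (intro bexI[of _ 0]) auto
  next
    case False
    then show ?thesis
      using exists_lead[OF assms(2)] main assms(3) by metis
  qed
qed

text \<open>
  Two elements whose conjugations agree on the generators conjugate every element alike.  Inverses
  are avoided by speaking of some \<open>u'\<close> with \<open>u' P = P u\<close>.
\<close>

lemma twisted:
  assumes "\<And>i. i \<in> {1..n} \<Longrightarrow> \<exists>u'\<in>Alg. u' * P = P * L i \<and> u' * Q = Q * L i" "u \<in> Alg"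
  shows "\<exists>u'\<in>Alg. u' * P = P * u \<and> u' * Q = Q * u"
  using assms(2)
proof (induction u rule: Alg_induct)
  case (scal c)
  then show ?case by (intro bexI[of _ "scal c"]) (simp_all add: scal_central)
next
  case (gen i)
  then show ?case by (rule assms(1))
next
  case (add u v)
  then show ?case by (metis Alg_add distrib_left distrib_right)
next
  case (mult u v)
  then obtain u' v' where "u' \<in> Alg" "u' * P = P * u" "u' * Q = Q * u"
    "v' \<in> Alg" "v' * P = P * v" "v' * Q = Q * v" by blast
  then have "u' * v' * P = P * (u * v)" "u' * v' * Q = Q * (u * v)" "u' * v' \<in> Alg"
    by (simp_all add: intertwine)
  then show ?case by blast
qed

section \<open>Affine elements\<close>

definition affine :: "'k op \<Rightarrow> bool" where
  "affine u \<longleftrightarrow> u \<in> Alg \<and> (\<forall>B. coef u B \<noteq> 0 \<longrightarrow> size B \<le> 1)"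

lemma affine_expand:
  assumes "affine u"
  shows "u = scal (coef u {#}) + (\<Sum>m\<in>{1..n}. scal (coef u {#m#}) * L m)"
proof (rule Alg_eqI)
  show "u \<in> Alg" using assms by (simp add: affine_def)
  show "scal (coef u {#}) + (\<Sum>m\<in>{1..n}. scal (coef u {#m#}) * L m) \<in> Alg"
    by (intro Alg_add Alg_sum) auto
  fix B
  show "coef u B = coef (scal (coef u {#}) + (\<Sum>m\<in>{1..n}. scal (coef u {#m#}) * L m)) B"
  proof (cases "size B \<le> 1")
    case False
    then have "coef u B = 0" "B \<noteq> {#}" "\<And>m. B \<noteq> {#m#}"
      using assms by (auto simp: affine_def)
    then show ?thesis by (simp add: coef_sum)
  next
    case True
    then consider "B = {#}" | m where "B = {#m#}"
      by (metis One_nat_def le_Suc_eq le_zero_eq size_1_singleton_mset size_eq_0_iff_empty)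
    then show ?thesis
    proof cases
      case 2
      have "coef u {#m#} = 0" if "m \<notin> {1..n}"
        using that Alg_expand(2)[of u "{#m#}"] assms
        by (auto simp: affine_def supp_def)
      then show ?thesis
        using 2 by (auto simp: coef_sum if_distrib cong: if_cong)
    qed (simp add: coef_sum)
  qed
qed

lemma affine_coef_square:
  assumes "affine u" "affine v"
  shows "coef (u * v) {#m, m#} = coef u {#m#} * coef v {#m#}"
proof -
  have uv: "u \<in> Alg" "v \<in> Alg" using assms by (auto simp: affine_def)
  have "coef u B * coef v C * app (W B) (delta C) {#m, m#} =
      (if B = {#m#} then if C = {#m#} then coef u {#m#} * coef v {#m#} else 0 else 0)"
    if BC: "B \<in> supp u" "C \<in> supp v" for B C
  proof (cases "app (W B) (delta C) {#m, m#} = 0")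
    case True
    then show ?thesis
      using topf_W[of "{#m#}" "{#m#}"] by (auto simp: topf_def)
  next
    case False
    then have sub: "{#m, m#} \<subseteq># B + C"
      using topf_W[of B C] by (auto simp: topf_def)
    have "size B \<le> 1" "size C \<le> 1"
      using BC assms by (auto simp: affine_def supp_def)
    moreover have "size (B + C) \<ge> 2"
      using size_mset_mono[OF sub] by simp
    ultimately have "size B = 1" "size C = 1" by simp_all
    then obtain p q where pq: "B = {#p#}" "C = {#q#}"
      by (metis size_1_singleton_mset)
    then have "p = m" "q = m"
      using mset_subset_eq_count[OF sub, of m] by (auto split: if_splits)
    then show ?thesis
      using topf_W[of "{#m#}" "{#m#}"] pq by (simp add: topf_def)
  qed
  then have "coef (u * v) {#m, m#} = (\<Sum>B\<in>supp u. \<Sum>C\<in>supp v.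
      if B = {#m#} then if C = {#m#} then coef u {#m#} * coef v {#m#} else 0 else 0)"
    unfolding coef_mult[OF uv] by (intro sum.cong) auto
  also have "\<dots> = (\<Sum>B\<in>supp u. if B = {#m#} then
      \<Sum>C\<in>supp v. if C = {#m#} then coef u {#m#} * coef v {#m#} else 0 else 0)"
    by (intro sum.cong) auto
  also have "\<dots> = coef u {#m#} * coef v {#m#}"
    using Alg_expand(1)[OF uv(1)] Alg_expand(1)[OF uv(2)] by (simp add: supp_def)
  finally show ?thesis .
qed

text \<open>
  The relations change the length of a word by an even number.
\<close>

lemma coef_LL_single:
  assumes "p \<in> {1..n}" "q \<in> {1..n}"
  shows "coef (L p * L q) {#m#} = 0"
proof -
  have *: "coef (L p * L q) {#m#} = 0" if "p \<le> q" for p q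
    using app_sorted_word[of "[p, q]"] that by (simp add: coef_def delta_def)
  show ?thesis
  proof (cases "p \<le> q")
    case False
    then have "L p * L q = scal (sym_a p q) - L q * L p"
      using V_rel_sym[OF V_rel_L, of p q] assms by (simp add: algebra_simps)
    then show ?thesis
      using *[of q p] False by simp
  qed (rule *)
qed

lemma affine_coef_linear:
  assumes "affine u" "affine v"
  shows "coef (u * v) {#m#} = coef u {#} * coef v {#m#} + coef u {#m#} * coef v {#}"
proof -
  define u1 v1 where "u1 = (\<Sum>m\<in>{1..n}. scal (coef u {#m#}) * L m)"
    and "v1 = (\<Sum>m\<in>{1..n}. scal (coef v {#m#}) * L m)"
  have u: "u = scal (coef u {#}) + u1" and v: "v = scal (coef v {#}) + v1"
    using affine_expand assms by (simp_all add: u1_def v1_def)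
  have "coef (u1 * v1) {#m#} = 0"
    unfolding u1_def v1_def sum_product coef_sum
    by (simp add: mult.assoc scal_left[of "L _"] coef_LL_single)
  have 1: "coef u {#m#} = coef u1 {#m#}" "coef v {#m#} = coef v1 {#m#}"
    by (subst u, simp) (subst v, simp)
  have "u * v = scal (coef u {#}) * v + u1 * v"
    by (subst u) (simp add: distrib_right)
  moreover have "u1 * v = scal (coef v {#}) * u1 + u1 * v1"
    by (subst v) (simp add: distrib_left scal_central[of u1])
  ultimately show ?thesis
    using 1 \<open>coef (u1 * v1) {#m#} = 0\<close> by (simp add: mult.commute)
qed

lemma lead_affine:
  assumes "has_top deglex u G c" "size G \<le> 1"
  shows "affine u"
  using assms unfolding has_top_def affine_def deglex_def by fastforce

text \<open>
  A square root has degree one, hence is affine.  The squares \<open>x\<^sub>m\<^sup>2\<close> with \<open>m \<noteq> i\<close> exclude the other generators,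
  and the linear term of the square excludes a constant.
\<close>

lemma square_root_of_generator:
  assumes v: "v \<in> Alg" "v * v = L i * L i" and i: "i \<in> {1..n}"
  shows "\<exists>\<epsilon>. (\<epsilon> = 1 \<or> \<epsilon> = - 1) \<and> v = scal \<epsilon> * L i"
proof -
  have Li: "has_top deglex (L i * L i) {#i, i#} 1"
    using has_top_mult[OF compatible_deglex has_top_L[OF compatible_deglex i] has_top_L[OF compatible_deglex i]]
    by simp
  have "v \<noteq> 0"
    using has_top_nonzero[OF Li] v(2) by auto
  then obtain G c where G: "has_top deglex v G c" "c \<noteq> 0"
    using exists_lead v(1) by blast
  have "G + G = {#i, i#}"
    using has_top_unique[OF compatible_deglex has_top_mult[OF compatible_deglex G(1) G(1)] _ Li[folded v(2)]] G(2)
    by simp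
  then have "size (G + G) = 2" by simp
  then have "size G \<le> 1" by simp
  then have aff: "affine v" using G(1) lead_affine by blast
  have affL: "affine (L i)" using i by (simp add: affine_def)
  have "coef v {#m#} * coef v {#m#} = (if m = i then 1 else 0)" for m
    using affine_coef_square[OF aff aff, of m] affine_coef_square[OF affL affL, of m] v(2)
    by (cases "m = i") simp_all
  then have c: "coef v {#i#} = 1 \<or> coef v {#i#} = - 1" "\<And>m. m \<noteq> i \<Longrightarrow> coef v {#m#} = 0"
    by (metis square_eq_1_iff, metis mult_eq_0_iff)
  have "2 * (coef v {#} * coef v {#i#}) = 0"
    using affine_coef_linear[OF aff aff, of i] affine_coef_linear[OF affL affL, of i] v(2)
    by (simp add: mult.commute)
  then have "coef v {#} = 0" using c(1) by auto
  then have "v = (\<Sum>m\<in>{1..n}. scal (coef v {#m#}) * L m)"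
    using affine_expand[OF aff] by simp
  also have "\<dots> = (\<Sum>m\<in>{1..n}. if m = i then scal (coef v {#i#}) * L i else 0)"
    by (rule sum.cong) (auto simp: c(2))
  also have "\<dots> = scal (coef v {#i#}) * L i"
    using i by simp
  finally have "v = scal (coef v {#i#}) * L i" .
  then show ?thesis using c(1) by blast
qed


section \<open>Automorphisms for even \<open>n\<close> are monomial\<close>

lemma wprod_lead:
  assumes "\<And>i. i \<in> {1..n} \<Longrightarrow> has_top deglex (y i) (B i) (c i) \<and> c i \<noteq> 0" "set w \<subseteq> {1..n}"
  shows "\<exists>d. d \<noteq> 0 \<and> has_top deglex (wprod y w) (\<Sum>i\<in>#mset w. B i) d"
  using assms(2)
proof (induction w)
  case Nil
  then show ?case
    using has_top_scal[OF compatible_deglex, of 1] by (intro exI[of _ 1]) simp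
next
  case (Cons i w)
  then obtain d where d: "d \<noteq> 0" "has_top deglex (wprod y w) (\<Sum>i\<in>#mset w. B i) d" by auto
  have i: "has_top deglex (y i) (B i) (c i)" "c i \<noteq> 0"
    using assms(1) Cons.prems by auto
  show ?case
    using has_top_mult[OF compatible_deglex i(1) d(2)] d(1) i(2)
    by (intro exI[of _ "msgn (B i) (\<Sum>i\<in>#mset w. B i) * c i * d"]) simp
qed

lemma size_sum_mset:
  fixes f :: "'a \<Rightarrow> nat multiset"
  shows "size (\<Sum>i\<in>#M. f i) = (\<Sum>i\<in>#M. size (f i))"
  by (induction M) auto

text \<open>
  The pseudoscalar is the product of all generators plus products over proper submultisets.  As no
  image of a generator is constant, the images of the latter have smaller degree, and no cancellation
  can occur in the leading term.
\<close>

lemma image_pseudoscalar_lead: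
  assumes \<theta>: "alg_end \<theta>"
    and y: "\<And>i. i \<in> {1..n} \<Longrightarrow> has_top deglex (\<theta> (L i)) (B i) (c i) \<and> c i \<noteq> 0 \<and> B i \<noteq> {#}"
  shows "\<exists>d. d \<noteq> 0 \<and> has_top deglex (\<theta> (pseudoscalar gens)) (\<Sum>i\<in>#mset gens. B i) d"
proof -
  let ?y = "\<lambda>i. \<theta> (L i)" and ?S = "\<lambda>M. \<Sum>i\<in>#M. B i"
  obtain c0 where c0: "c0 \<noteq> 0" "has_top (\<subseteq>#) (pseudoscalar gens) (mset gens) c0"
    by (rule pseudoscalar_gens_top)
  have fin: "finite (supp (pseudoscalar gens))" and ex: "pseudoscalar gens = (\<Sum>D\<in>supp (pseudoscalar gens). scal (coef (pseudoscalar gens) D) * W D)"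
    and supp: "\<And>D. D \<in> supp (pseudoscalar gens) \<Longrightarrow> D \<subseteq># mset gens"
    and full: "mset gens \<in> supp (pseudoscalar gens)"
    and set: "\<And>D. D \<in> supp (pseudoscalar gens) \<Longrightarrow> set_mset D \<subseteq> {1..n}"
    using Alg_expand[OF pseudoscalar_gens_Alg] c0 by (auto simp: has_top_def supp_def)
  define t where "t = (\<lambda>D. scal (coef (pseudoscalar gens) D) * wprod ?y (sorted_list_of_multiset D))"
  have W: "W D \<in> Alg" if "D \<in> supp (pseudoscalar gens)" for D
    using set[OF that] by (intro Alg_wprod) auto
  have "\<theta> (pseudoscalar gens) = (\<Sum>D\<in>supp (pseudoscalar gens). \<theta> (scal (coef (pseudoscalar gens) D) * W D))"
    by (subst (1) ex, rule alg_end_sum[OF \<theta>]) (intro Alg_mult Alg_scal W)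
  also have "\<dots> = (\<Sum>D\<in>supp (pseudoscalar gens). t D)"
  proof (rule sum.cong[OF refl])
    fix D assume D: "D \<in> supp (pseudoscalar gens)"
    have "\<theta> (W D) = wprod ?y (sorted_list_of_multiset D)"
      by (rule alg_end_wprod[OF \<theta>]) (use set[OF D] in simp)
    then show "\<theta> (scal (coef (pseudoscalar gens) D) * W D) = t D"
      by (simp add: t_def alg_end_simps(7)[OF \<theta> W[OF D]])
  qed
  also have "\<dots> = t (mset gens) + (\<Sum>D\<in>supp (pseudoscalar gens) - {mset gens}. t D)"
    by (rule sum.remove[OF fin full])
  finally have eq: "\<theta> (pseudoscalar gens) = t (mset gens) + (\<Sum>D\<in>supp (pseudoscalar gens) - {mset gens}. t D)" .
  have top: "\<exists>d. d \<noteq> 0 \<and> has_top deglex (t D) (?S D) d" if D: "D \<in> supp (pseudoscalar gens)" for D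
  proof -
    obtain d where d: "d \<noteq> 0" "has_top deglex (wprod ?y (sorted_list_of_multiset D)) (?S D) d"
      using wprod_lead[of ?y B c "sorted_list_of_multiset D"] y set[OF D] by auto
    then show ?thesis
      using has_top_scale[OF d(2), of "coef (pseudoscalar gens) D"] D
      by (intro exI[of _ "coef (pseudoscalar gens) D * d"]) (simp add: t_def supp_def)
  qed
  have small: "deglex E (?S (mset gens))" "E \<noteq> ?S (mset gens)"
    if D: "D \<in> supp (pseudoscalar gens) - {mset gens}" and E: "coef (t D) E \<noteq> 0" for D E
  proof -
    obtain M where M: "mset gens = D + M"
      using supp D by (metis DiffD1 subset_mset.le_iff_add)
    have "M \<noteq> {#}" using M D by auto
    then obtain m where m: "m \<in># M" by blast
    then have "m \<in># mset gens" using M by simp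
    then have "m \<in> {1..n}" by simp
    then have "B m \<noteq> {#}" using y by blast
    then have "size (?S M) > 0"
      using multi_member_split[OF m] by (auto simp: nonempty_has_size)
    then have "size (?S D) < size (?S (mset gens))"
      unfolding M by simp
    moreover have "deglex E (?S D)"
      using top[of D] D E by (auto simp: has_top_def)
    ultimately show "deglex E (?S (mset gens))" "E \<noteq> ?S (mset gens)"
      by (auto simp: deglex_def)
  qed
  let ?r = "\<Sum>D\<in>supp (pseudoscalar gens) - {mset gens}. t D"
  have "?r \<in> Alg"
    using top by (intro Alg_sum) (auto simp: has_top_def)
  moreover have r: "\<exists>D\<in>supp (pseudoscalar gens) - {mset gens}. coef (t D) E \<noteq> 0" if "coef ?r E \<noteq> 0" for E
    using that unfolding coef_sum by (meson sum.neutral)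
  moreover have "coef ?r (?S (mset gens)) = 0"
    using r small(2) by blast
  moreover obtain d where d: "d \<noteq> 0" "has_top deglex (t (mset gens)) (?S (mset gens)) d"
    using top[OF full] by blast
  ultimately have "has_top deglex (\<theta> (pseudoscalar gens)) (?S (mset gens)) (d + 0)"
    unfolding eq using has_top_add[OF d(2), of ?r] r small(1) by metis
  then show ?thesis using d(1) by auto
qed

lemma pseudoscalar_twist:
  assumes "u \<in> Alg" "even n"
  shows "\<exists>u'\<in>Alg. u' * pseudoscalar gens = pseudoscalar gens * u"
proof -
  have "\<exists>u'\<in>Alg. u' * pseudoscalar gens = pseudoscalar gens * L i \<and> u' * pseudoscalar gens = pseudoscalar gens * L i"
    if i: "i \<in> {1..n}" for i
    using pseudoscalar_inside[of gens i] i assms(2)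
    by (intro bexI[of _ "- L i"]) (simp_all add: scal_uminus)
  from twisted[OF this assms(1)] show ?thesis by blast
qed

lemma pseudoscalar_anticommute:
  assumes "even n" "i \<in> {1..n}"
  shows "pseudoscalar gens * L i = - (L i * pseudoscalar gens)"
  using pseudoscalar_inside[of gens i] assms by (simp add: scal_uminus)

text \<open>
  If \<open>v x\<close> is short for the element with \<open>v P = P x\<close>, then \<open>v\<close> respects the relations and fixes the
  central squares.  Where two signs differ, the relation between the two generators is preserved with
  its scalar both kept and negated, so that this scalar is \<open>0\<close>.
\<close>

lemma sign_twist:
  assumes \<theta>: "alg_aut \<theta> \<eta>" and n: "even n"
  obtains \<epsilon> where "\<And>i. i \<in> {1..n} \<Longrightarrow> \<epsilon> i = 1 \<or> \<epsilon> i = - 1"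
    "\<And>i. i \<in> {1..n} \<Longrightarrow> scal (\<epsilon> i) * L i * \<theta> (pseudoscalar gens) = \<theta> (pseudoscalar gens) * L i"
    "\<And>i j. i \<in> {1..n} \<Longrightarrow> j \<in> {1..n} \<Longrightarrow> i \<noteq> j \<Longrightarrow> \<epsilon> i \<noteq> \<epsilon> j \<Longrightarrow> L i * L j = - (L j * L i)"
proof -
  let ?P = "\<theta> (pseudoscalar gens)"
  have end': "alg_end \<theta>" "alg_end \<eta>" and inv: "\<And>u. u \<in> Alg \<Longrightarrow> \<theta> (\<eta> u) = u"
    using \<theta> by (auto simp: alg_aut_def)
  note th = alg_end_simps[OF end'(1)] and et = alg_end_simps[OF end'(2)]
  have PA: "?P \<in> Alg" using th(4) pseudoscalar_gens_Alg by blast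
  have P0: "?P \<noteq> 0"
    using alg_aut_nonzero[OF \<theta> pseudoscalar_gens_Alg] pseudoscalar_gens_top has_top_nonzero by metis
  have "\<exists>v\<in>Alg. v * ?P = ?P * L i" if i: "i \<in> {1..n}" for i
  proof -
    have Li: "L i \<in> Alg" using i by simp
    obtain u' where u': "u' \<in> Alg" "u' * pseudoscalar gens = pseudoscalar gens * \<eta> (L i)"
      using pseudoscalar_twist[OF et(4)[OF Li] n] by blast
    have "\<theta> u' * ?P = \<theta> (u' * pseudoscalar gens)"
      using u'(1) th(6) pseudoscalar_gens_Alg by simp
    also have "\<dots> = ?P * \<theta> (\<eta> (L i))"
      unfolding u'(2) using th(6) pseudoscalar_gens_Alg et(4)[OF Li] by simp
    finally show ?thesis
      using u'(1) th(4) inv[OF Li] by (intro bexI[of _ "\<theta> u'"]) simp_all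
  qed
  then obtain v where v: "\<And>i. i \<in> {1..n} \<Longrightarrow> v i \<in> Alg" "\<And>i. i \<in> {1..n} \<Longrightarrow> v i * ?P = ?P * L i"
    by metis
  have vv: "v i * v j * ?P = ?P * (L i * L j)" if "i \<in> {1..n}" "j \<in> {1..n}" for i j
    using intertwine[OF v(2) v(2)] that by blast
  have "\<exists>e. (e = 1 \<or> e = - 1) \<and> v i = scal e * L i" if i: "i \<in> {1..n}" for i
  proof (rule square_root_of_generator[OF v(1)[OF i] _ i])
    have "v i * v i * ?P = L i * L i * ?P"
      using vv[OF i i] L_square_central[OF i PA] by simp
    then show "v i * v i = L i * L i"
      using Alg_cancel_right[OF _ _ PA _ P0] v(1)[OF i] i by simp
  qed
  then obtain \<epsilon> where e: "\<And>i. i \<in> {1..n} \<Longrightarrow> \<epsilon> i = 1 \<or> \<epsilon> i = - 1"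
      "\<And>i. i \<in> {1..n} \<Longrightarrow> v i = scal (\<epsilon> i) * L i"
    by metis
  have "L i * L j = - (L j * L i)"
    if ij: "i \<in> {1..n}" "j \<in> {1..n}" "i \<noteq> j" "\<epsilon> i \<noteq> \<epsilon> j" for i j
  proof -
    note rel = V_rel_sym[OF V_rel_L ij(1-3)]
    have "(v i * v j + v j * v i) * ?P = ?P * (L i * L j + L j * L i)"
      using vv ij by (simp add: distrib_left distrib_right)
    then have "(v i * v j + v j * v i) * ?P = scal (sym_a i j) * ?P"
      unfolding rel scal_central .
    then have "v i * v j + v j * v i = scal (sym_a i j)"
      using Alg_cancel_right[OF _ _ PA _ P0] v(1) ij by simp
    moreover have "v i * v j + v j * v i = - (L i * L j + L j * L i)"
      using e(1)[OF ij(1)] e(1)[OF ij(2)] ij(4) e(2)[OF ij(1)] e(2)[OF ij(2)]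
      by (auto simp: scal_uminus)
    ultimately have "- scal (sym_a i j) = scal (sym_a i j)"
      unfolding rel by simp
    then have "coef (- scal (sym_a i j)) {#} = coef (scal (sym_a i j)) {#}" by simp
    then have "sym_a i j = 0" by (simp only: coef_simps) simp
    then show ?thesis
      using rel by (simp add: eq_neg_iff_add_eq_0)
  qed
  then show ?thesis
    using that[of \<epsilon>] e v(2) by metis
qed

text \<open>
  The sets of generators with sign \<open>1\<close> and with sign \<open>- 1\<close> anticommute with each other and, as \<open>n\<close>
  is even, have sizes of the same parity.  If both are even, the pseudoscalar of the second set
  anticommutes inside and commutes outside; if both are odd, the pseudoscalar of the first set commutes
  inside and anticommutes outside.  Either way the prescribed signs appear.
\<close>

lemma low_degree_twist:
  assumes n: "even n"
    and e: "\<And>i. i \<in> {1..n} \<Longrightarrow> \<epsilon> i = 1 \<or> \<epsilon> i = (- 1 :: 'k)"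
    and anti: "\<And>i j. i \<in> {1..n} \<Longrightarrow> j \<in> {1..n} \<Longrightarrow> i \<noteq> j \<Longrightarrow> \<epsilon> i \<noteq> \<epsilon> j \<Longrightarrow> L i * L j = - (L j * L i)"
  obtains Q G c where "has_top deglex Q G c" "c \<noteq> 0" "size G \<le> n"
    "\<And>i. i \<in> {1..n} \<Longrightarrow> scal (\<epsilon> i) * L i * Q = Q * L i"
proof -
  define E where "E = (\<lambda>s. filter (\<lambda>i. \<epsilon> i = (s :: 'k)) gens)"
  have E: "set (E s) = {i \<in> {1..n}. \<epsilon> i = s}" "distinct (E s)" for s
    by (auto simp: E_def)
  have "length (E 1) + length (E (- 1)) = n"
  proof -
    have "filter (\<lambda>i. \<epsilon> i \<noteq> 1) gens = E (- 1)"
      unfolding E_def by (rule filter_cong) (use e in auto)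
    then show ?thesis
      using sum_length_filter_compl[of "\<lambda>i. \<epsilon> i = 1" gens] by (simp add: E_def)
  qed
  then obtain s where s: "s = - ((- 1) ^ length (E s))" "s = 1 \<or> s = - 1"
  proof (cases "even (length (E (- 1)))")
    case True
    then show ?thesis by (intro that[of "- 1"]) simp_all
  next
    case False
    then have "odd (length (E 1))"
      using \<open>length (E 1) + length (E (- 1)) = n\<close> n by presburger
    then show ?thesis by (intro that[of 1]) simp_all
  qed
  have sub: "set (E s) \<subseteq> {1..n}"
    using E by auto
  have "scal (\<epsilon> i) * L i * pseudoscalar (E s) = pseudoscalar (E s) * L i" if i: "i \<in> {1..n}" for i
  proof (cases "\<epsilon> i = s")
    case True
    then have "L i * pseudoscalar (E s) = scal s * (pseudoscalar (E s) * L i)"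
      using pseudoscalar_inside[OF sub E(2), of i] E(1)[of s] i s(1) by simp
    then show ?thesis
      using s(2) True by (auto simp: mult.assoc scal_uminus)
  next
    case False
    then have "L i * L j = - (L j * L i)" if "j \<in> set (E s)" for j
      using anti[OF i, of j] that E(1)[of s] by auto
    from pseudoscalar_outside[OF this] have "L i * pseudoscalar (E s) = scal (- s) * (pseudoscalar (E s) * L i)"
      by (subst s(1)) simp
    moreover have "\<epsilon> i = - s" using e[OF i] False s(2) by auto
    ultimately show ?thesis
      using s(2) by (auto simp: mult.assoc scal_uminus)
  qed
  moreover obtain c where "c \<noteq> 0" "has_top (\<subseteq>#) (pseudoscalar (E s)) (mset (E s)) c"
    using pseudoscalar_top[OF sub E(2)] by blast
  moreover have "size (mset (E s)) \<le> n"
    unfolding size_mset E_def using length_filter_le[of "\<lambda>i. \<epsilon> i = s" gens] by simp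
  ultimately show ?thesis
    using that has_top_subset_deglex by blast
qed

text \<open>
  The degree count: \<open>Q\<close> of degree at most \<open>n\<close> is a multiple of the image of the pseudoscalar, whose
  degree is the sum of the degrees of the images of the generators.
\<close>

lemma automorphism_affine:
  assumes \<theta>: "alg_aut \<theta> \<eta>" and n: "even n" and i: "i \<in> {1..n}"
  obtains m where "affine (\<theta> (L i))" "coef (\<theta> (L i)) {#m#} \<noteq> 0"
proof -
  let ?P = "\<theta> (pseudoscalar gens)"
  have end': "alg_end \<theta>" "alg_end \<eta>" and inv: "\<And>u. u \<in> Alg \<Longrightarrow> \<theta> (\<eta> u) = u"
      "\<And>u. u \<in> Alg \<Longrightarrow> \<eta> (\<theta> u) = u"
    using \<theta> by (auto simp: alg_aut_def)
  note th = alg_end_simps[OF end'(1)] and et = alg_end_simps[OF end'(2)]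
  have PA: "?P \<in> Alg" using th(4) pseudoscalar_gens_Alg by blast
  have P0: "?P \<noteq> 0"
    using alg_aut_nonzero[OF \<theta> pseudoscalar_gens_Alg] pseudoscalar_gens_top has_top_nonzero by metis
  have "\<exists>B c. has_top deglex (\<theta> (L j)) B c \<and> c \<noteq> 0 \<and> B \<noteq> {#}" if j: "j \<in> {1..n}" for j
  proof -
    have Lj: "L j \<in> Alg" using j by simp
    have "L j \<noteq> 0"
      using has_top_nonzero[OF has_top_L[OF compatible_deglex j]] by simp
    then obtain B c where B: "has_top deglex (\<theta> (L j)) B c" "c \<noteq> 0"
      using exists_lead[OF th(4)[OF Lj]] alg_aut_nonzero[OF \<theta> Lj] by metis
    moreover have "B \<noteq> {#}"
    proof
      assume "B = {#}"
      then have "coef (\<theta> (L j)) D = 0" if "D \<noteq> {#}" for D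
        using B(1) that by (auto simp: has_top_def deglex_def)
      then have "\<theta> (L j) = scal (coef (\<theta> (L j)) {#})"
        by (intro Alg_eqI) (auto simp: th(4)[OF Lj])
      then have "L j = scal (coef (\<theta> (L j)) {#})"
        using inv(2)[OF Lj] et(1) by metis
      then have "coef (L j) {#j#} = coef (scal (coef (\<theta> (L j)) {#})) {#j#}" by simp
      then show False by simp
    qed
    ultimately show ?thesis by blast
  qed
  then obtain B c where B: "\<And>j. j \<in> {1..n} \<Longrightarrow> has_top deglex (\<theta> (L j)) (B j) (c j) \<and> c j \<noteq> 0 \<and> B j \<noteq> {#}"
    by metis
  obtain d where d: "d \<noteq> 0" "has_top deglex ?P (\<Sum>i\<in>#mset gens. B i) d"
    using image_pseudoscalar_lead[OF end'(1) B] by blast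
  obtain \<epsilon> where e: "\<And>i. i \<in> {1..n} \<Longrightarrow> \<epsilon> i = 1 \<or> \<epsilon> i = - 1"
    "\<And>i. i \<in> {1..n} \<Longrightarrow> scal (\<epsilon> i) * L i * ?P = ?P * L i"
    "\<And>i j. i \<in> {1..n} \<Longrightarrow> j \<in> {1..n} \<Longrightarrow> i \<noteq> j \<Longrightarrow> \<epsilon> i \<noteq> \<epsilon> j \<Longrightarrow> L i * L j = - (L j * L i)"
    using sign_twist[OF \<theta> n] by metis
  obtain Q G q where Q: "has_top deglex Q G q" "q \<noteq> 0" "size G \<le> n"
    "\<And>i. i \<in> {1..n} \<Longrightarrow> scal (\<epsilon> i) * L i * Q = Q * L i"
    by (rule low_degree_twist[of \<epsilon>, OF n e(1,3)]) blast+
  have QA: "Q \<in> Alg" using Q(1) by (simp add: has_top_def)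
  have Q_anti: "Q * \<theta> (L j) = - (\<theta> (L j) * Q)" if j: "j \<in> {1..n}" for j
  proof -
    have yA: "\<theta> (L j) \<in> Alg" using th(4) j by simp
    have "\<exists>u'\<in>Alg. u' * ?P = ?P * \<theta> (L j) \<and> u' * Q = Q * \<theta> (L j)"
    proof (rule twisted[OF _ yA])
      show "\<exists>u'\<in>Alg. u' * ?P = ?P * L i \<and> u' * Q = Q * L i" if "i \<in> {1..n}" for i
        using e(2) Q(4) that by (intro bexI[of _ "scal (\<epsilon> i) * L i"]) auto
    qed
    then obtain u' where u': "u' \<in> Alg" "u' * ?P = ?P * \<theta> (L j)" "u' * Q = Q * \<theta> (L j)" by blast
    have "?P * \<theta> (L j) = \<theta> (- (L j * pseudoscalar gens))"
      using pseudoscalar_anticommute[OF n j] th(6) pseudoscalar_gens_Alg j by (metis Alg_L)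
    also have "\<dots> = (- \<theta> (L j)) * ?P"
      using th(6,8) pseudoscalar_gens_Alg j by simp
    finally have "u' = - \<theta> (L j)"
      using Alg_cancel_right[OF u'(1) _ PA _ P0] u'(2) yA by simp
    then show ?thesis using u'(3) by simp
  qed
  have "\<eta> Q * L j = - (L j * \<eta> Q)" if j: "j \<in> {1..n}" for j
  proof -
    have yA: "\<theta> (L j) \<in> Alg" using th(4) j by simp
    have "\<eta> (Q * \<theta> (L j)) = \<eta> (- (\<theta> (L j) * Q))"
      using Q_anti[OF j] by simp
    then show ?thesis
      using et(6,8) yA QA inv(2)[of "L j"] j by simp
  qed
  then obtain r where r: "r \<in> Alg" "\<eta> Q = r * pseudoscalar gens"
    using anticommutant[OF n et(4)[OF QA]] by blast
  have QrP: "Q = \<theta> r * ?P"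
    using inv(1)[OF QA] r th(6) pseudoscalar_gens_Alg by metis
  have "\<theta> r \<noteq> 0" using QrP has_top_nonzero[OF Q(1,2)] by auto
  then obtain H h where H: "has_top deglex (\<theta> r) H h" "h \<noteq> 0"
    using exists_lead th(4)[OF r(1)] by metis
  have "G = H + (\<Sum>i\<in>#mset gens. B i)"
    using has_top_unique[OF compatible_deglex Q(1,2) has_top_mult[OF compatible_deglex H(1) d(2), folded QrP]]
      H(2) d(1) by simp
  then have "size (\<Sum>i\<in>#mset gens. B i) \<le> n"
    using Q(3) by (metis le_add2 order_trans size_union)
  then have "(\<Sum>i\<in>#mset gens. size (B i)) \<le> n"
    unfolding size_sum_mset .
  moreover have "(\<Sum>i\<in>#mset gens. size (B i)) = (\<Sum>i\<in>{1..n}. size (B i))"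
    using sum_unfold_sum_mset[of "\<lambda>i. size (B i)" "{1..n}"] mset_set_set[of gens] by simp
  ultimately have le: "(\<Sum>j\<in>{1..n}. size (B j)) \<le> n" by simp
  have "size (B i) \<le> 1"
  proof (rule ccontr)
    assume *: "\<not> size (B i) \<le> 1"
    have "(\<Sum>j\<in>{1..n}. 1) < (\<Sum>j\<in>{1..n}. size (B j))"
    proof (rule sum_strict_mono_ex1)
      show "\<forall>j\<in>{1..n}. 1 \<le> size (B j)"
        using B by (metis One_nat_def Suc_leI nonempty_has_size)
      show "\<exists>j\<in>{1..n}. 1 < size (B j)"
        using * i by (intro bexI[of _ i]) auto
    qed simp
    then show False using le by simp
  qed
  moreover have "size (B i) \<noteq> 0" using B[OF i] by simp
  ultimately have "size (B i) = 1" by linarith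
  then obtain m where m: "B i = {#m#}" by (metis size_1_singleton_mset)
  show ?thesis
    using that[of m] lead_affine[of "\<theta> (L i)" "B i" "c i"] B[OF i] m
    by (simp add: has_top_def)
qed

text \<open>
  The coefficients of \<open>x\<^sub>m\<^sup>2\<close> in the relations say that the linear parts of the images have disjoint
  supports.  These are \<open>n\<close> nonempty disjoint subsets of \<open>n\<close> indices, hence singletons.  The
  coefficients of \<open>x\<^sub>m\<close> then exclude constant terms.
\<close>

lemma automorphism_monomial:
  assumes \<theta>: "alg_aut \<theta> \<eta>" and n: "even n" "n \<ge> 2"
  shows "\<exists>\<sigma> c. bij_betw \<sigma> {1..n} {1..n} \<and> (\<forall>i\<in>{1..n}. c i \<noteq> 0 \<and> \<theta> (L i) = scal (c i) * L (\<sigma> i))"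
proof -
  have end': "alg_end \<theta>" using \<theta> by (simp add: alg_aut_def)
  note th = alg_end_simps[OF end']
  let ?y = "\<lambda>i. \<theta> (L i)"
  define c where "c = (\<lambda>i m. coef (?y i) {#m#})"
  define d where "d = (\<lambda>i. coef (?y i) {#})"
  have aff: "affine (?y i)" if "i \<in> {1..n}" for i
    using automorphism_affine[OF \<theta> n(1) that] by metis
  have "\<exists>m. c i m \<noteq> 0" if "i \<in> {1..n}" for i
    using automorphism_affine[OF \<theta> n(1) that] unfolding c_def by metis
  then obtain \<sigma> where \<sigma>: "\<And>i. i \<in> {1..n} \<Longrightarrow> c i (\<sigma> i) \<noteq> 0" by metis
  have \<sigma>n: "\<sigma> i \<in> {1..n}" if i: "i \<in> {1..n}" for i
    using Alg_expand(2)[of "?y i" "{#\<sigma> i#}"] th(4) i \<sigma>[OF i] by (simp add: supp_def c_def)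
  have rel: "coef (?y i * ?y j) B + coef (?y j * ?y i) B = 0"
    if "i \<in> {1..n}" "j \<in> {1..n}" "i \<noteq> j" "B \<noteq> {#}" for i j B
  proof -
    have "coef (?y i * ?y j + ?y j * ?y i) B = coef (scal (sym_a i j)) B"
      using V_rel_sym[OF V_rel_image[OF end']] that by simp
    then show ?thesis using that by simp
  qed
  have cc: "c i m * c j m = 0" if ij: "i \<in> {1..n}" "j \<in> {1..n}" "i \<noteq> j" for i j m
    using rel[OF ij, of "{#m, m#}"] affine_coef_square[OF aff aff] ij
    by (simp add: c_def mult.commute)
  have dc: "d i * c j m + c i m * d j = 0" if ij: "i \<in> {1..n}" "j \<in> {1..n}" "i \<noteq> j" for i j m
  proof -
    have "2 * (d i * c j m + c i m * d j) = 0"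
      using rel[OF ij, of "{#m#}"] affine_coef_linear[OF aff[OF ij(1)] aff[OF ij(2)], of m]
        affine_coef_linear[OF aff[OF ij(2)] aff[OF ij(1)], of m]
      by (simp add: c_def d_def algebra_simps)
    then show ?thesis by (simp only: mult_eq_0_iff) simp
  qed
  have d0: "d j = 0" if j: "j \<in> {1..n}" for j
  proof -
    \<comment> \<open>Any index different from j, which exists because there are at least two generators.\<close>
    define i :: nat where "i = (if j = 1 then 2 else 1)"
    have i: "i \<in> {1..n}" "i \<noteq> j" using n(2) by (auto simp: i_def)
    have "c j (\<sigma> i) = 0" using cc[OF i(1) j i(2), of "\<sigma> i"] \<sigma>[OF i(1)] by simp
    then show ?thesis using dc[OF i(1) j i(2), of "\<sigma> i"] \<sigma>[OF i(1)] by simp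
  qed
  have inj: "inj_on \<sigma> {1..n}"
    using cc \<sigma> by (metis inj_onI mult_eq_0_iff)
  then have bij: "bij_betw \<sigma> {1..n} {1..n}"
    using \<sigma>n by (intro bij_betw_imageI endo_inj_surj) auto
  have "c i m = 0" if im: "i \<in> {1..n}" "m \<in> {1..n}" "m \<noteq> \<sigma> i" for i m
  proof -
    obtain j where j: "j \<in> {1..n}" "m = \<sigma> j"
      using bij im(2) unfolding bij_betw_def by (metis imageE)
    then have "c i m * c j m = 0"
      using cc[of i j m] im by auto
    then show ?thesis using \<sigma>[OF j(1)] j(2) by simp
  qed
  then have "?y i = scal (c i (\<sigma> i)) * L (\<sigma> i)" if i: "i \<in> {1..n}" for i
  proof -
    have "?y i = (\<Sum>m\<in>{1..n}. scal (c i m) * L m)"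
      using affine_expand[OF aff[OF i]] d0[OF i] by (simp add: c_def d_def)
    also have "\<dots> = (\<Sum>m\<in>{1..n}. if m = \<sigma> i then scal (c i (\<sigma> i)) * L (\<sigma> i) else 0)"
      by (rule sum.cong)
        (use \<open>\<And>m i. i \<in> {1..n} \<Longrightarrow> m \<in> {1..n} \<Longrightarrow> m \<noteq> \<sigma> i \<Longrightarrow> c i m = 0\<close> i in auto)
    also have "\<dots> = scal (c i (\<sigma> i)) * L (\<sigma> i)"
      using \<sigma>n[OF i] by simp
    finally show ?thesis .
  qed
  then show ?thesis
    using bij \<sigma> by (intro exI[of _ \<sigma>] exI[of _ "\<lambda>i. c i (\<sigma> i)"]) simp
qed

end

section \<open>Solvable groups and cosets\<close>

lemma (in comm_group) comm_group_solvable: "solvable G"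
proof -
  have "h \<otimes> g \<otimes> inv h \<otimes> inv g = \<one>" if "h \<in> carrier G" "g \<in> carrier G" for h g
  proof -
    have "h \<otimes> g \<otimes> inv h \<otimes> inv g = g \<otimes> (h \<otimes> inv h) \<otimes> inv g"
      using that by (simp add: m_assoc m_comm[of h g] del: r_inv)
    then show ?thesis using that by simp
  qed
  then have "derived_set G (carrier G) = {\<one>}"
    by (auto intro!: bexI[of _ \<one>])
  then have "derived G (carrier G) = {\<one>}"
    unfolding derived_def by (simp add: generate_one)
  then have "(derived G ^^ 1) (carrier G) = {\<one>}" by simp
  then show ?thesis
    using solvable_iff_trivial_derived_seq by blast
qed

text \<open>
  The coset of \<open>x\<close> depends only on \<open>f x\<close>, which takes finitely many values.
\<close>

lemma (in group) finite_rcosets_if_invariant: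
  assumes H: "subgroup H G" and fin: "finite (f ` carrier G)"
    and f: "\<And>x y. x \<in> carrier G \<Longrightarrow> y \<in> carrier G \<Longrightarrow> f x = f y \<Longrightarrow> x \<otimes> inv y \<in> H"
  shows "finite (rcosets H)"
proof -
  have "\<exists>g. \<forall>x\<in>carrier G. H #> x = g (f x)"
  proof (intro exI ballI)
    fix x assume x: "x \<in> carrier G"
    define y where "y = (SOME y. y \<in> carrier G \<and> f y = f x)"
    have y: "y \<in> carrier G \<and> f y = f x"
      unfolding y_def by (rule someI[of _ x]) (simp add: x)
    then have "x \<otimes> inv y \<in> H" using f x by simp
    then have "x \<in> H #> y"
      using x y by (auto simp: r_coset_def m_assoc intro!: bexI[of _ "x \<otimes> inv y"])
    then show "H #> x = (\<lambda>t. H #> (SOME y. y \<in> carrier G \<and> f y = t)) (f x)"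
      using repr_independence[OF _ _ H, of x y] y unfolding y_def by simp
  qed
  then obtain g where "\<And>x. x \<in> carrier G \<Longrightarrow> H #> x = g (f x)" by blast
  then have "rcosets H \<subseteq> g ` f ` carrier G"
    by (auto simp: RCOSETS_def)
  then show ?thesis
    using fin finite_subset by blast
qed

context V_data
begin

section \<open>The algebra of operators is the given algebra\<close>

abbreviation "V \<equiv> V_algebra n a"

definition cl :: "(nat word \<Rightarrow>\<^sub>0 'k) \<Rightarrow> (nat word \<Rightarrow>\<^sub>0 'k) set" where
  "cl f = I +>\<^bsub>F\<^esub> f"

lemma carrier_V: "carrier V = cl ` carrier F"
  by (auto simp: V_algebra_def FactRing_def A_RCOSETS_def' cl_def)

lemma cl_ops:
  assumes "f \<in> carrier F" "g \<in> carrier F"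
  shows "cl f \<otimes>\<^bsub>V\<^esub> cl g = cl (f * g)" "cl f \<oplus>\<^bsub>V\<^esub> cl g = cl (f + g)"
  using ring_hom_mult[OF I.rcos_ring_hom assms] ring_hom_add[OF I.rcos_ring_hom assms]
  by (simp_all add: V_algebra_def cl_def)

lemma cl_one: "\<one>\<^bsub>V\<^esub> = cl 1"
  using ring_hom_one[OF I.rcos_ring_hom] by (simp add: V_algebra_def cl_def)

lemma cl_smult: "f \<in> carrier F \<Longrightarrow> c \<odot>\<^bsub>V\<^esub> cl f = cl (free_scalar c * f)"
  using smult_V_algebra unfolding cl_def smult_free_algebra .

lemma cl_eq_iff:
  assumes "f \<in> carrier F" "g \<in> carrier F"
  shows "cl f = cl g \<longleftrightarrow> subst L f = subst L g"
proof
  assume "cl f = cl g"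
  then have "f \<in> I +>\<^bsub>F\<^esub> g"
    using I.a_rcos_self[OF assms(1)] by (simp add: cl_def)
  then obtain h where "h \<in> I" "f = h + g"
    by (auto simp: a_r_coset_def')
  then show "subst L f = subst L g"
    using subst_ideal[OF V_rel_L] by (simp add: subst_add)
next
  assume "subst L f = subst L g"
  then have "f - g \<in> I"
    using subst_eq_0_iff[of "f - g"] assms by (simp add: subst_diff)
  then have "f \<in> I +>\<^bsub>F\<^esub> g"
    unfolding a_r_coset_def' by (auto intro!: bexI[of _ "f - g"])
  then show "cl f = cl g"
    unfolding cl_def using I.a_repr_independence I.is_additive_subgroup assms
    by (metis additive_subgroup_def)
qed

definition iota :: "(nat word \<Rightarrow>\<^sub>0 'k) set \<Rightarrow> 'k op" where
  "iota C = subst L (SOME f. f \<in> carrier F \<and> cl f = C)"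

lemma iota_cl: "f \<in> carrier F \<Longrightarrow> iota (cl f) = subst L f"
  unfolding iota_def using cl_eq_iff by (metis (mono_tags, lifting) someI_ex)

lemma iota_bij: "bij_betw iota (carrier V) Alg"
  unfolding bij_betw_def inj_on_def carrier_V Alg_def
  by (auto simp: iota_cl cl_eq_iff image_iff)

lemma iota_ops:
  assumes "C \<in> carrier V" "D \<in> carrier V"
  shows "iota (C \<otimes>\<^bsub>V\<^esub> D) = iota C * iota D" "iota (C \<oplus>\<^bsub>V\<^esub> D) = iota C + iota D"
  using assms unfolding carrier_V
  by (auto simp: cl_ops iota_cl subst_mult subst_add)

lemma iota_one: "iota \<one>\<^bsub>V\<^esub> = 1"
  by (simp add: cl_one iota_cl)

lemma iota_smult: "C \<in> carrier V \<Longrightarrow> iota (c \<odot>\<^bsub>V\<^esub> C) = scal c * iota C"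
  unfolding carrier_V by (auto simp: cl_smult iota_cl subst_mult)

lemma V_closed:
  assumes "C \<in> carrier V" "D \<in> carrier V"
  shows "C \<otimes>\<^bsub>V\<^esub> D \<in> carrier V" "C \<oplus>\<^bsub>V\<^esub> D \<in> carrier V"
  using assms unfolding carrier_V by (auto simp: cl_ops)

lemma V_one_closed: "\<one>\<^bsub>V\<^esub> \<in> carrier V"
  by (simp add: carrier_V cl_one)

lemma V_smult_closed: "C \<in> carrier V \<Longrightarrow> c \<odot>\<^bsub>V\<^esub> C \<in> carrier V"
  unfolding carrier_V by (auto simp: cl_smult)

definition kappa :: "'k op \<Rightarrow> (nat word \<Rightarrow>\<^sub>0 'k) set" where
  "kappa = inv_into (carrier V) iota"

lemma kappa_carrier [simp]: "u \<in> Alg \<Longrightarrow> kappa u \<in> carrier V"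
  unfolding kappa_def using iota_bij by (metis bij_betw_def inv_into_into)

lemma iota_kappa [simp]: "u \<in> Alg \<Longrightarrow> iota (kappa u) = u"
  unfolding kappa_def using iota_bij by (rule bij_betw_inv_into_right)

lemma kappa_iota [simp]: "C \<in> carrier V \<Longrightarrow> kappa (iota C) = C"
  unfolding kappa_def using iota_bij by (rule bij_betw_inv_into_left)

lemma iota_Alg [simp]: "C \<in> carrier V \<Longrightarrow> iota C \<in> Alg"
  using iota_bij by (auto simp: bij_betw_def)

lemma kappa_ops:
  assumes "u \<in> Alg" "v \<in> Alg"
  shows "kappa (u * v) = kappa u \<otimes>\<^bsub>V\<^esub> kappa v" "kappa (u + v) = kappa u \<oplus>\<^bsub>V\<^esub> kappa v"
  using assms V_closed[of "kappa u" "kappa v"] iota_ops[of "kappa u" "kappa v"]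
  by (metis iota_kappa kappa_carrier kappa_iota)+

lemma kappa_one: "kappa 1 = \<one>\<^bsub>V\<^esub>"
  using kappa_iota[OF V_one_closed] by (simp add: iota_one)

lemma kappa_smult: "u \<in> Alg \<Longrightarrow> kappa (scal c * u) = c \<odot>\<^bsub>V\<^esub> kappa u"
  using kappa_iota[OF V_smult_closed, of "kappa u" c] by (simp add: iota_smult)

text \<open>
  Automorphisms of the quotient are studied through the action that they have on operators.
\<close>

definition act :: "((nat word \<Rightarrow>\<^sub>0 'k) set \<Rightarrow> (nat word \<Rightarrow>\<^sub>0 'k) set) \<Rightarrow> 'k op \<Rightarrow> 'k op" where
  "act h u = iota (h (kappa u))"

abbreviation "G \<equiv> AlgAut V"

sublocale G: group G
  by (rule group_AlgAut_V_algebra)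

lemma G_carrier: "carrier G = alg_auto V"
  by (simp add: AlgAut_def)

lemma G_hom:
  assumes "h \<in> carrier G"
  shows "h \<in> ring_hom V V" "\<And>c C. C \<in> carrier V \<Longrightarrow> h (c \<odot>\<^bsub>V\<^esub> C) = c \<odot>\<^bsub>V\<^esub> h C"
    "h \<in> extensional (carrier V)" "bij_betw h (carrier V) (carrier V)"
    "\<And>C. C \<in> carrier V \<Longrightarrow> h C \<in> carrier V"
  using assms by (auto simp: G_carrier alg_auto_def Bij_def bij_betw_def)

lemma G_mult: "h \<in> carrier G \<Longrightarrow> g \<in> carrier G \<Longrightarrow> h \<otimes>\<^bsub>G\<^esub> g = compose (carrier V) h g"
  by (simp add: AlgAut_def BijGroup_def alg_auto_def)

lemma G_one: "\<one>\<^bsub>G\<^esub> = (\<lambda>x\<in>carrier V. x)"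
  by (simp add: AlgAut_def BijGroup_def)

lemma act_Alg: "h \<in> carrier G \<Longrightarrow> u \<in> Alg \<Longrightarrow> act h u \<in> Alg"
  unfolding act_def using G_hom(5) by simp

lemma act_end:
  assumes "h \<in> carrier G"
  shows "alg_end (act h)"
proof -
  note hom = G_hom[OF assms]
  have mult: "act h (u * v) = act h u * act h v" and add: "act h (u + v) = act h u + act h v"
    if "u \<in> Alg" "v \<in> Alg" for u v
    using that hom(5) ring_hom_mult[OF hom(1)] ring_hom_add[OF hom(1)]
    by (simp_all add: act_def kappa_ops iota_ops)
  have one: "act h 1 = 1"
    using ring_hom_one[OF hom(1)] by (simp add: act_def kappa_one iota_one)
  moreover have "act h (scal c) = scal c" for c
  proof -
    have "act h (scal c * 1) = scal c * act h 1"
      unfolding act_def using hom(2,5)[OF kappa_carrier[OF Alg_1]]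
      by (simp only: kappa_smult[OF Alg_1] iota_smult)
    then show ?thesis by (simp add: one)
  qed
  ultimately show ?thesis
    using mult add act_Alg[OF assms] by (simp add: alg_end_def)
qed

lemma act_mult:
  assumes "h \<in> carrier G" "g \<in> carrier G" "u \<in> Alg"
  shows "act (h \<otimes>\<^bsub>G\<^esub> g) u = act h (act g u)"
  using assms G_hom(5)[of g] by (simp add: act_def G_mult compose_def)

lemma act_one: "u \<in> Alg \<Longrightarrow> act \<one>\<^bsub>G\<^esub> u = u"
  by (simp add: act_def G_one)

lemma act_aut:
  assumes "h \<in> carrier G"
  shows "alg_aut (act h) (act (inv\<^bsub>G\<^esub> h))"
proof -
  have "act h (act (inv\<^bsub>G\<^esub> h) u) = u" "act (inv\<^bsub>G\<^esub> h) (act h u) = u" if "u \<in> Alg" for u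
    using act_mult[of h "inv\<^bsub>G\<^esub> h" u] act_mult[of "inv\<^bsub>G\<^esub> h" h u] assms that
    by (simp_all add: act_one G.r_inv G.l_inv)
  then show ?thesis
    using assms act_end by (simp add: alg_aut_def)
qed

lemma alg_end_eqI:
  assumes "alg_end \<theta>" "alg_end \<eta>" "\<And>i. i \<in> {1..n} \<Longrightarrow> \<theta> (L i) = \<eta> (L i)" "u \<in> Alg"
  shows "\<theta> u = \<eta> u"
  using assms(4)
  by (induction u rule: Alg_induct)
    (simp_all add: assms(3) alg_end_simps(1,5,6)[OF assms(1)] alg_end_simps(1,5,6)[OF assms(2)])

lemma act_eqI:
  assumes "h \<in> carrier G" "g \<in> carrier G" "\<And>i. i \<in> {1..n} \<Longrightarrow> act h (L i) = act g (L i)"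
  shows "h = g"
proof (rule extensionalityI[OF G_hom(3)[OF assms(1)] G_hom(3)[OF assms(2)]])
  fix C assume C: "C \<in> carrier V"
  have "act h (iota C) = act g (iota C)"
    by (rule alg_end_eqI[OF act_end act_end]) (use assms C in auto)
  then have "iota (h C) = iota (g C)"
    using C by (simp add: act_def)
  then show "h C = g C"
    using G_hom(5)[OF assms(1) C] G_hom(5)[OF assms(2) C] by (metis kappa_iota)
qed

text \<open>
  Conversely, every automorphism of the operator algebra comes from the quotient.  Its restriction to
  the carrier is needed since the bijections of a set are taken extensional.
\<close>

lemma exists_automorphism:
  assumes "alg_aut \<theta> \<eta>"
  obtains h where "h \<in> carrier G" "\<And>u. u \<in> Alg \<Longrightarrow> act h u = \<theta> u"
proof -
  have end': "alg_end \<theta>" "alg_end \<eta>" and inv: "\<And>u. u \<in> Alg \<Longrightarrow> \<theta> (\<eta> u) = u" "\<And>u. u \<in> Alg \<Longrightarrow> \<eta> (\<theta> u) = u"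
    using assms by (auto simp: alg_aut_def)
  note th = alg_end_simps[OF end'(1)] and et = alg_end_simps[OF end'(2)]
  define h where "h = (\<lambda>C\<in>carrier V. kappa (\<theta> (iota C)))"
  have "h \<in> ring_hom V V"
    by (rule ring_hom_memI)
      (simp_all add: h_def V_closed V_one_closed th iota_ops iota_one kappa_ops kappa_one)
  moreover have "bij_betw h (carrier V) (carrier V)"
    by (rule bij_betwI[where g = "\<lambda>C. kappa (\<eta> (iota C))"]) (auto simp: h_def th et inv)
  moreover have "h (c \<odot>\<^bsub>V\<^esub> C) = c \<odot>\<^bsub>V\<^esub> h C" if "C \<in> carrier V" for c C
    using that by (simp add: h_def V_smult_closed th iota_smult kappa_smult)
  ultimately have "h \<in> carrier G"
    by (simp add: G_carrier alg_auto_def Bij_def h_def)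
  moreover have "act h u = \<theta> u" if "u \<in> Alg" for u
    using that by (simp add: act_def h_def th)
  ultimately show ?thesis by (rule that)
qed

section \<open>Even \<open>n\<close>: the automorphism group is virtually abelian\<close>

lemma even_virtually_solvable:
  assumes n: "even n" "n \<ge> 2"
  shows "virtually_solvable G"
proof -
  define K where "K = {h \<in> carrier G. \<forall>i\<in>{1..n}. \<exists>c. act h (L i) = scal c * L i}"
  define mono where "mono = (\<lambda>h \<sigma> c. bij_betw \<sigma> {1..n} {1..n} \<and>
    (\<forall>i\<in>{1..n}. c i \<noteq> 0 \<and> act h (L i) = scal (c i) * L (\<sigma> i)))"
  have "\<exists>\<sigma> c. mono h \<sigma> c" if "h \<in> carrier G" for h
    unfolding mono_def using automorphism_monomial[OF act_aut[OF that] n] .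
  then obtain \<sigma> c where "\<And>h. h \<in> carrier G \<Longrightarrow> mono h (\<sigma> h) (c h)"
    by metis
  then have \<sigma>: "\<And>h. h \<in> carrier G \<Longrightarrow> bij_betw (\<sigma> h) {1..n} {1..n}"
    and c: "\<And>h i. h \<in> carrier G \<Longrightarrow> i \<in> {1..n} \<Longrightarrow> c h i \<noteq> 0"
      "\<And>h i. h \<in> carrier G \<Longrightarrow> i \<in> {1..n} \<Longrightarrow> act h (L i) = scal (c h i) * L (\<sigma> h i)"
    by (simp_all add: mono_def)
  have scal_act: "act h (scal d * L i) = scal d * act h (L i)" if "h \<in> carrier G" "i \<in> {1..n}" for h d i
    using alg_end_simps(7)[OF act_end[OF that(1)]] that(2) by simp
  have quotient: "h \<otimes>\<^bsub>G\<^esub> inv\<^bsub>G\<^esub> g \<in> K"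
    if hg: "h \<in> carrier G" "g \<in> carrier G" and eq: "\<And>i. i \<in> {1..n} \<Longrightarrow> \<sigma> h i = \<sigma> g i" for h g
  proof -
    have "\<exists>d. act (h \<otimes>\<^bsub>G\<^esub> inv\<^bsub>G\<^esub> g) (L j) = scal d * L j" if j: "j \<in> {1..n}" for j
    proof -
      obtain i where i: "i \<in> {1..n}" "j = \<sigma> g i"
        using \<sigma>[OF hg(2)] j unfolding bij_betw_def by (metis imageE)
      have "L j = scal (inverse (c g i)) * act g (L i)"
        using c[OF hg(2) i(1)] i(2) by (simp flip: mult.assoc scal_mult)
      moreover have "act (inv\<^bsub>G\<^esub> g) (act g (L i)) = L i"
        using act_aut[OF hg(2)] i(1) by (simp add: alg_aut_def)
      ultimately have "act (inv\<^bsub>G\<^esub> g) (L j) = scal (inverse (c g i)) * L i"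
        using alg_end_simps(7)[OF act_end[of "inv\<^bsub>G\<^esub> g"], of "act g (L i)"] hg(2) i(1) act_Alg
        by simp
      then have "act (h \<otimes>\<^bsub>G\<^esub> inv\<^bsub>G\<^esub> g) (L j) = scal (inverse (c g i)) * (scal (c h i) * L j)"
        using act_mult[of h "inv\<^bsub>G\<^esub> g" "L j"] hg j scal_act[OF hg(1) i(1)] c(2)[OF hg(1) i(1)] eq[OF i(1)] i(2)
        by simp
      then have "act (h \<otimes>\<^bsub>G\<^esub> inv\<^bsub>G\<^esub> g) (L j) = scal (inverse (c g i) * c h i) * L j"
        by (simp add: scal_mult mult.assoc)
      then show ?thesis by blast
    qed
    then show ?thesis using hg by (simp add: K_def)
  qed
  have K_mult: "act (h \<otimes>\<^bsub>G\<^esub> g) (L i) = scal (d * e) * L i"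
    if "h \<in> carrier G" "g \<in> carrier G" "i \<in> {1..n}" "act h (L i) = scal d * L i" "act g (L i) = scal e * L i"
    for h g i d e
    using that scal_act act_mult by (simp add: scal_mult mult.assoc scal_left[of "scal d"])
  have "subgroup K G"
  proof (rule G.subgroupI)
    have "act \<one>\<^bsub>G\<^esub> (L i) = scal 1 * L i" if "i \<in> {1..n}" for i
      using act_one that by simp
    then show "K \<noteq> {}"
      using G.one_closed unfolding K_def by blast
    fix h assume h: "h \<in> K"
    then have hG: "h \<in> carrier G" by (simp add: K_def)
    have "\<exists>d. act (inv\<^bsub>G\<^esub> h) (L i) = scal d * L i" if i: "i \<in> {1..n}" for i
    proof -
      obtain d where d: "act h (L i) = scal d * L i"
        using h i unfolding K_def by blast
      have inv: "act (inv\<^bsub>G\<^esub> h) (act h (L i)) = L i"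
        using act_aut[OF hG] i by (simp add: alg_aut_def)
      then have eq: "scal d * act (inv\<^bsub>G\<^esub> h) (L i) = L i"
        unfolding d using scal_act[of "inv\<^bsub>G\<^esub> h" i d] hG i by simp
      have "d \<noteq> 0"
        using arg_cong[OF eq, of "\<lambda>u. coef u {#i#}"] unfolding coef_simps coef_L by auto
      then have "act (inv\<^bsub>G\<^esub> h) (L i) = scal (inverse d) * (scal d * act (inv\<^bsub>G\<^esub> h) (L i))"
        by (simp flip: mult.assoc scal_mult)
      then show ?thesis unfolding eq by blast
    qed
    then show "inv\<^bsub>G\<^esub> h \<in> K" using hG by (simp add: K_def)
  next
    fix h g assume hg: "h \<in> K" "g \<in> K"
    then have G: "h \<in> carrier G" "g \<in> carrier G" by (simp_all add: K_def)
    have "\<exists>d. act (h \<otimes>\<^bsub>G\<^esub> g) (L i) = scal d * L i" if i: "i \<in> {1..n}" for i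
    proof -
      obtain d e where "act h (L i) = scal d * L i" "act g (L i) = scal e * L i"
        using hg i unfolding K_def by blast
      then show ?thesis using K_mult[OF G i] by blast
    qed
    then show "h \<otimes>\<^bsub>G\<^esub> g \<in> K" using G by (simp add: K_def)
  qed (auto simp: K_def)
  note K = this
  have "comm_group (G\<lparr>carrier := K\<rparr>)"
  proof (rule group.group_comm_groupI)
    show "group (G\<lparr>carrier := K\<rparr>)"
      by (rule subgroup.subgroup_is_group[OF K G.group_axioms])
    fix h g assume "h \<in> carrier (G\<lparr>carrier := K\<rparr>)" "g \<in> carrier (G\<lparr>carrier := K\<rparr>)"
    then have hg: "h \<in> K" "g \<in> K" by simp_all
    then have G: "h \<in> carrier G" "g \<in> carrier G" by (simp_all add: K_def)
    have "h \<otimes>\<^bsub>G\<^esub> g = g \<otimes>\<^bsub>G\<^esub> h"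
    proof (rule act_eqI)
      fix i assume i: "i \<in> {1..n}"
      obtain d e where "act h (L i) = scal d * L i" "act g (L i) = scal e * L i"
        using hg i unfolding K_def by blast
      then show "act (h \<otimes>\<^bsub>G\<^esub> g) (L i) = act (g \<otimes>\<^bsub>G\<^esub> h) (L i)"
        using K_mult G i by (simp add: mult.commute)
    qed (use G in simp_all)
    then show "h \<otimes>\<^bsub>G\<lparr>carrier := K\<rparr>\<^esub> g = g \<otimes>\<^bsub>G\<lparr>carrier := K\<rparr>\<^esub> h" by simp
  qed
  then have "solvable (G\<lparr>carrier := K\<rparr>)"
    by (rule comm_group.comm_group_solvable)
  moreover have "finite (rcosets\<^bsub>G\<^esub> K)"
  proof (rule G.finite_rcosets_if_invariant[OF K])
    have "(\<lambda>h. restrict (\<sigma> h) {1..n}) ` carrier G \<subseteq> {1..n} \<rightarrow>\<^sub>E {1..n}"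
      using bij_betwE[OF \<sigma>] by (auto simp: restrict_PiE_iff)
    then show "finite ((\<lambda>h. restrict (\<sigma> h) {1..n}) ` carrier G)"
      by (rule finite_subset) (simp add: finite_PiE)
    fix h g assume "h \<in> carrier G" "g \<in> carrier G" "restrict (\<sigma> h) {1..n} = restrict (\<sigma> g) {1..n}"
    then show "h \<otimes>\<^bsub>G\<^esub> inv\<^bsub>G\<^esub> g \<in> K"
      by (intro quotient) (metis restrict_apply')+
  qed
  ultimately show ?thesis
    using K unfolding virtually_solvable_def by blast
qed

end

section \<open>Recognizing free subgroups\<close>

context group
begin

definition word_value :: "('s \<Rightarrow> 'a) \<Rightarrow> ('s \<times> bool) list \<Rightarrow> 'a" where
  "word_value g w = foldr (\<lambda>l x. (if snd l then g (fst l) else inv (g (fst l))) \<otimes> x) w \<one>"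

lemma word_value_Nil: "word_value g [] = \<one>"
  by (simp add: word_value_def)

lemma word_value_Cons:
  "word_value g (l # w) = (if snd l then g (fst l) else inv (g (fst l))) \<otimes> word_value g w"
  by (simp add: word_value_def)

lemma word_value_closed:
  "(\<And>s. g s \<in> carrier G) \<Longrightarrow> word_value g w \<in> carrier G"
  by (induction w) (auto simp: word_value_Nil word_value_Cons)

lemma word_value_append:
  "(\<And>s. g s \<in> carrier G) \<Longrightarrow> word_value g (u @ v) = word_value g u \<otimes> word_value g v"
  by (induction u) (auto simp: word_value_Nil word_value_Cons word_value_closed m_assoc)

lemma word_value_cons_letter:
  assumes "\<And>s. g s \<in> carrier G"
  shows "word_value g (cons_letter l w) = word_value g (l # w)"
proof (cases w)
  case (Cons m v)
  then show ?thesis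
    using assms word_value_closed[of g v]
    by (auto simp: word_value_Cons inv_letter_def m_assoc[symmetric])
qed (simp add: word_value_Nil)

lemma word_value_foldr:
  assumes "\<And>s. g s \<in> carrier G"
  shows "word_value g (foldr cons_letter u v) = word_value g u \<otimes> word_value g v"
proof -
  have closed: "word_value g w \<in> carrier G" for w
    by (rule word_value_closed) (rule assms)
  show ?thesis
    by (induction u)
      (simp_all add: word_value_cons_letter[OF assms] word_value_Cons word_value_Nil m_assoc closed assms)
qed

text \<open>
  Evaluation of reduced words is a homomorphism, and its kernel is trivial by assumption.
\<close>

lemma has_free_subgroup_rank2_if:
  assumes g: "\<And>s. g s \<in> carrier G"
    and free: "\<And>w. reduced w \<Longrightarrow> w \<noteq> [] \<Longrightarrow> set w \<subseteq> {0, 1 :: nat} \<times> UNIV \<Longrightarrow> word_value g w \<noteq> \<one>"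
  shows "has_free_subgroup_rank2 G"
proof -
  let ?F = "free_group {0, 1 :: nat}"
  have closed: "word_value g w \<in> carrier G" for w
    by (rule word_value_closed) (rule g)
  have "word_value g \<in> hom ?F G"
    by (rule homI) (simp_all add: closed free_group_def word_value_foldr[OF g])
  then interpret hom: group_hom ?F G "word_value g"
    by (intro group_hom.intro group_free_group group_axioms) (simp add: group_hom_axioms_def)
  have inj: "inj_on (word_value g) (carrier ?F)"
    unfolding hom.inj_on_one_iff using free by (auto simp: free_group_def)
  define H where "H = word_value g ` carrier ?F"
  have H: "subgroup H G"
    unfolding H_def by (rule hom.img_is_subgroup)
  have "word_value g \<in> iso ?F (G\<lparr>carrier := H\<rparr>)"
    using inj hom.homh by (auto simp: iso_def hom_def bij_betw_def H_def)
  then have "?F \<cong> G\<lparr>carrier := H\<rparr>"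
    by (auto simp: is_iso_def)
  then have "G\<lparr>carrier := H\<rparr> \<cong> ?F"
    by (rule group.iso_sym[OF group_free_group])
  then show ?thesis
    using H unfolding has_free_subgroup_rank2_def by blast
qed

end

lemma reduced_snoc:
  "reduced (w @ [l]) \<longleftrightarrow> reduced w \<and> (w \<noteq> [] \<longrightarrow> l \<noteq> inv_letter (last w))"
proof (induction w)
  case (Cons m w)
  then show ?case by (cases w) auto
qed simp

context V_data
begin

section \<open>Odd \<open>n\<close>: a free group of transvections\<close>

text \<open>
  The endomorphism that sends the generators to \<open>z\<close>.  The value does not depend on the chosen preimage
  when \<open>z\<close> satisfies the relations.
\<close>

definition ext :: "(nat \<Rightarrow> 'k op) \<Rightarrow> 'k op \<Rightarrow> 'k op" where
  "ext z u = subst z (SOME f. f \<in> carrier F \<and> subst L f = u)"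

lemma ext_subst:
  assumes "V_rel z" "f \<in> carrier F"
  shows "ext z (subst L f) = subst z f"
proof -
  define g where "g = (SOME g. g \<in> carrier F \<and> subst L g = subst L f)"
  have g: "g \<in> carrier F \<and> subst L g = subst L f"
    unfolding g_def by (rule someI[of _ f]) (simp add: assms)
  then have "g - f \<in> I"
    using subst_eq_0_iff[of "g - f"] assms by (simp add: subst_diff)
  then have "subst z g = subst z f"
    using subst_ideal[OF assms(1), of "g - f"] by (simp add: subst_diff)
  then show ?thesis
    unfolding ext_def g_def .
qed

lemma subst_in_Alg:
  assumes "\<And>i. i \<in> {1..n} \<Longrightarrow> z i \<in> Alg" "f \<in> carrier F"
  shows "subst z f \<in> Alg"
  unfolding subst_def
  by (intro Alg_sum Alg_mult Alg_scal Alg_wprod assms(1))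
    (use assms(2) in \<open>auto simp: free_algebra_carrier\<close>)

lemma ext_gen: "V_rel z \<Longrightarrow> i \<in> {1..n} \<Longrightarrow> ext z (L i) = z i"
  using ext_subst[of z "free_gen i"] by simp

lemma ext_end:
  assumes "V_rel z" "\<And>i. i \<in> {1..n} \<Longrightarrow> z i \<in> Alg"
  shows "alg_end (ext z)"
proof -
  have "ext z (scal c) = scal c" for c
    using ext_subst[OF assms(1), of "free_scalar c"] by simp
  moreover have "ext z u \<in> Alg" if "u \<in> Alg" for u
    using that subst_in_Alg[OF assms(2)] unfolding Alg_def by (auto simp: ext_subst[OF assms(1)])
  moreover have "ext z (u + v) = ext z u + ext z v \<and> ext z (u * v) = ext z u * ext z v"
    if uv: "u \<in> Alg" "v \<in> Alg" for u v
  proof -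
    obtain f g where f: "f \<in> carrier F" "u = subst L f" and g: "g \<in> carrier F" "v = subst L g"
      using uv by (auto simp: Alg_def)
    have "u + v = subst L (f + g)" "u * v = subst L (f * g)"
      by (simp_all add: f g subst_add subst_mult)
    then show ?thesis
      using f g by (simp add: ext_subst[OF assms(1)]) (simp add: subst_add subst_mult)
  qed
  ultimately show ?thesis by (simp add: alg_end_def)
qed

definition rest :: "nat list" where
  "rest = [3..<Suc n]"

lemma rest [simp]: "set rest = {3..n}" "distinct rest" "length rest = n - 2"
  by (auto simp: rest_def)

definition pseudo :: "'k op" where
  "pseudo = pseudoscalar rest"

text \<open>
  For \<open>u = x\<^sub>1\<close> and odd \<open>n\<close> this is the pseudoscalar of \<open>x\<^sub>1, x\<^sub>3, \<dots>, x\<^sub>n\<close>; being a commutator with a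
  fixed element, it makes sense for all \<open>u\<close> and commutes with endomorphisms that fix \<open>x\<^sub>3, \<dots>, x\<^sub>n\<close>.
\<close>

definition bracket :: "'k op \<Rightarrow> 'k op" where
  "bracket u = u * pseudo - pseudo * u"

lemma pseudo_Alg [simp]: "pseudo \<in> Alg"
  unfolding pseudo_def by (rule pseudoscalar_Alg) auto

lemma bracket_Alg [simp]: "u \<in> Alg \<Longrightarrow> bracket u \<in> Alg"
  by (simp add: bracket_def)

lemma alg_end_pseudoscalar:
  assumes "alg_end \<theta>" "set w \<subseteq> {1..n}" "\<And>i. i \<in> set w \<Longrightarrow> \<theta> (L i) = L i"
  shows "\<theta> (pseudoscalar w) = pseudoscalar w"
  using assms(2,3)
proof (induction w)
  case (Cons i w)
  then show ?case
    using pseudoscalar_Alg[of w] by (simp add: alg_end_simps(1,5,6)[OF assms(1)])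
qed (simp add: alg_end_simps(3)[OF assms(1)])

lemma alg_end_bracket:
  assumes "alg_end \<theta>" "\<And>i. i \<in> {3..n} \<Longrightarrow> \<theta> (L i) = L i" "u \<in> Alg"
  shows "\<theta> (bracket u) = bracket (\<theta> u)"
proof -
  have "\<theta> pseudo = pseudo"
    unfolding pseudo_def by (rule alg_end_pseudoscalar) (use assms in auto)
  then show ?thesis
    using assms(3) by (simp add: bracket_def alg_end_simps(6,9)[OF assms(1)])
qed

lemma pseudo_commute:
  assumes "odd n" "j \<in> {3..n}"
  shows "L j * pseudo = pseudo * L j"
proof -
  have "set rest \<subseteq> {1..n}" "odd (length rest)"
    using assms by auto
  then show ?thesis
    using pseudoscalar_inside[of rest j] assms(2) unfolding pseudo_def by simp
qed

lemma bracket_anticommute_same: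
  assumes "i \<in> {1..n}"
  shows "L i * bracket (L i) + bracket (L i) * L i = 0"
proof -
  have "L i * bracket (L i) + bracket (L i) * L i = (L i * L i) * pseudo - pseudo * (L i * L i)"
    by (simp add: bracket_def algebra_simps)
  also have "pseudo * (L i * L i) = (L i * L i) * pseudo"
    by (rule L_square_central[OF assms pseudo_Alg])
  finally show ?thesis by simp
qed

lemma bracket_anticommute:
  assumes xy: "x * y + y * x = scal (c :: 'k)" and comm: "x * pseudo = pseudo * x"
  shows "x * bracket y + bracket y * x = 0"
proof -
  have xy': "x * y = scal c - y * x" using xy by (simp add: algebra_simps)
  have "x * (y * pseudo) = scal c * pseudo - y * (pseudo * x)"
    unfolding mult.assoc[symmetric] xy' by (simp add: left_diff_distrib mult.assoc comm)
  moreover have "x * (pseudo * y) = pseudo * (scal c - y * x)"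
    unfolding mult.assoc[symmetric] comm by (simp add: mult.assoc xy')
  ultimately show ?thesis
    by (simp add: bracket_def right_diff_distrib left_diff_distrib mult.assoc scal_central[of pseudo])
qed

text \<open>
  For \<open>s\<close> equal to \<open>1\<close> or \<open>2\<close>, the other one of these two indices is \<open>3 - s\<close>.
\<close>

definition transv :: "nat \<Rightarrow> 'k \<Rightarrow> nat \<Rightarrow> 'k op" where
  "transv s t i = (if i = s then L s + scal t * bracket (L (3 - s)) else L i)"

lemma transv_rel:
  assumes n: "odd n" "n \<ge> 3" and s: "s = 1 \<or> s = 2"
  shows "V_rel (transv s t)"
proof -
  have s': "3 - s \<in> {1..n}" "s \<in> {1..n}" using n s by auto
  have anti: "L j * bracket (L (3 - s)) + bracket (L (3 - s)) * L j = 0" if j: "j \<in> {1..n}" "j \<noteq> s" for j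
  proof (cases "j = 3 - s")
    case True
    then show ?thesis using bracket_anticommute_same[OF s'(1)] by simp
  next
    case False
    then have "j \<in> {3..n}" using j s by auto
    then show ?thesis
      using bracket_anticommute[OF V_rel_sym[OF V_rel_L] pseudo_commute[OF n(1)]] j s'(1) False by blast
  qed
  have *: "transv s t s * L j + L j * transv s t s = L s * L j + L j * L s"
    if "j \<in> {1..n}" "j \<noteq> s" for j
  proof -
    have "transv s t s * L j + L j * transv s t s = L s * L j + L j * L s +
        scal t * (L j * bracket (L (3 - s)) + bracket (L (3 - s)) * L j)"
      by (simp add: transv_def algebra_simps scal_left[of "L j"])
    then show ?thesis using anti[OF that] by simp
  qed
  show ?thesis
    unfolding V_rel_def
  proof (intro allI impI)
    fix i j assume ij: "1 \<le> i" "i < j" "j \<le> n"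
    have rel: "L i * L j + L j * L i = scal (a i j)"
      using V_rel_L ij by (simp add: V_rel_def)
    consider "i = s" | "j = s" | "i \<noteq> s" "j \<noteq> s" by blast
    then show "transv s t i * transv s t j + transv s t j * transv s t i = scal (a i j)"
    proof cases
      case 1
      then have "transv s t j = L j" using ij by (simp add: transv_def)
      then show ?thesis using *[of j] 1 ij rel by simp
    next
      case 2
      then have "transv s t i = L i" using ij by (simp add: transv_def)
      then show ?thesis using *[of i] 2 ij rel by (simp add: add.commute)
    next
      case 3
      then show ?thesis using rel by (simp add: transv_def)
    qed
  qed
qed

lemma transv_aut:
  assumes n: "odd n" "n \<ge> 3" and s: "s = 1 \<or> s = 2"
  shows "alg_aut (ext (transv s t)) (ext (transv s (- t)))"
proof -
  have s': "3 - s \<in> {1..n}" "s \<in> {1..n}" "3 - s \<noteq> s" using n s by auto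
  have rel: "V_rel (transv s t)" for t by (rule transv_rel[OF assms])
  have Alg: "transv s t i \<in> Alg" if "i \<in> {1..n}" for t i
    using that s' by (simp add: transv_def)
  have end': "alg_end (ext (transv s t))" for t
    by (rule ext_end[OF rel Alg])
  have inv: "ext (transv s t) (ext (transv s (- t)) u) = u" if u: "u \<in> Alg" for t u
    using u
  proof (induction u rule: Alg_induct)
    case (gen i)
    have fixes_L: "ext (transv s t) (L j) = L j" if "j \<in> {1..n}" "j \<noteq> s" for t j
      using ext_gen[OF rel that(1)] that(2) by (simp add: transv_def)
    show ?case
    proof (cases "i = s")
      case True
      have "ext (transv s t) (bracket (L (3 - s))) = bracket (L (3 - s))"
        using alg_end_bracket[OF end'] fixes_L s s' by auto
      moreover have "ext (transv s (- t)) (L s) = L s - scal t * bracket (L (3 - s))"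
        using ext_gen[OF rel s'(2)] by (simp add: transv_def scal_uminus)
      moreover have "ext (transv s t) (L s) = L s + scal t * bracket (L (3 - s))"
        using ext_gen[OF rel s'(2)] by (simp add: transv_def)
      ultimately show ?thesis
        using True s' by (simp add: alg_end_simps(7,9)[OF end'])
    qed (use gen fixes_L in simp)
  qed (simp_all add: alg_end_simps(1,4,5,6)[OF end'])
  from inv[of _ "- t"] inv[of _ t] show ?thesis
    using end' by (simp add: alg_aut_def)
qed

abbreviation "tail \<equiv> mset rest"

lemma pseudo_top: obtains c where "c \<noteq> 0" "has_top deglex pseudo tail c"
proof -
  have "\<exists>c. c \<noteq> 0 \<and> has_top (\<subseteq>#) pseudo tail c"
    unfolding pseudo_def by (rule pseudoscalar_top) auto
  then show ?thesis using that has_top_subset_deglex by blast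
qed

text \<open>
  If the leading monomial of \<open>u\<close> anticommutes with \<open>x\<^sub>3 \<cdots> x\<^sub>n\<close>, then the two terms of the bracket
  have equal leading terms, which add up instead of cancelling.
\<close>

lemma bracket_top:
  assumes "has_top deglex u B c" "c \<noteq> 0" "msgn tail B = (- msgn B tail :: 'k)"
  shows "\<exists>d. d \<noteq> 0 \<and> has_top deglex (bracket u) (B + tail) d"
proof -
  obtain e where e: "e \<noteq> 0" "has_top deglex pseudo tail e" by (rule pseudo_top)
  have "has_top deglex (u * pseudo) (B + tail) (msgn B tail * c * e)"
    by (rule has_top_mult[OF compatible_deglex assms(1) e(2)])
  moreover have "has_top deglex (scal (- 1) * (pseudo * u)) (B + tail) (- 1 * (msgn tail B * e * c))"
    using has_top_scale[OF has_top_mult[OF compatible_deglex e(2) assms(1)], of "- 1"] by (simp only: add.commute[of B])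
  ultimately have "has_top deglex (u * pseudo + scal (- 1) * (pseudo * u)) (B + tail)
      (msgn B tail * c * e + - 1 * (msgn tail B * e * c))"
    by (rule has_top_add')
  moreover have "msgn B tail * c * e + - 1 * (msgn tail B * e * c) = 2 * (msgn B tail * c * e)"
    using assms(3) by simp
  moreover have "u * pseudo + scal (- 1) * (pseudo * u) = bracket u"
    by (simp add: bracket_def scal_uminus)
  ultimately have "has_top deglex (bracket u) (B + tail) (2 * (msgn B tail * c * e))"
    by (simp only:)
  then show ?thesis
    using assms(2) e(1) by (intro exI[of _ "2 * (msgn B tail * c * e)"]) simp
qed

lemma anticommute_add_tail: "msgn tail B = (- msgn B tail :: 'k) \<Longrightarrow> msgn tail (B + tail) = (- msgn (B + tail) tail :: 'k)"
  by (simp add: msgn_union_left msgn_union_right)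

lemma anticommute_single:
  assumes "odd n" "n \<ge> 3" "s < 3"
  shows "msgn tail {#s#} = (- msgn {#s#} tail :: 'k)"
proof -
  have "sg s tail = (1 :: 'k)"
    by (rule sg_eq_1) (use assms in auto)
  moreover have "count tail s = 0"
    using assms by (simp add: count_eq_zero_iff)
  moreover have "odd (size tail)"
    using assms by simp
  ultimately have "msgn tail {#s#} = (- 1 :: 'k)"
    unfolding msgn_single_right by (metis add.right_neutral mult_1_right neg_one_odd_power)
  then show ?thesis
    using \<open>sg s tail = 1\<close> by simp
qed

text \<open>
  The state of the pair of images after a word that ends in a positive number of letters moving \<open>U\<close>:
  these letters have added a nonzero multiple of the bracket of \<open>U'\<close> to an element that is no larger
  than \<open>U'\<close>.  Remembering the number \<open>Suc k\<close> is necessary, since equal consecutive letters change the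
  leading coefficient but not the degree.
\<close>

definition stretched :: "'k \<Rightarrow> 'k op \<Rightarrow> 'k op \<Rightarrow> bool" where
  "stretched t U U' \<longleftrightarrow> (\<exists>B c v k. has_top deglex U' B c \<and> c \<noteq> 0 \<and> msgn tail B = (- msgn B tail :: 'k) \<and> v \<in> Alg \<and>
     (\<forall>D. coef v D \<noteq> 0 \<longrightarrow> size D \<le> size B) \<and> U = v + scal (of_nat (Suc k) * t) * bracket U')"

lemma stretched_same:
  assumes "stretched t U U'"
  shows "stretched t (U + scal t * bracket U') U'"
proof -
  obtain B c v k where *: "has_top deglex U' B c" "c \<noteq> 0" "msgn tail B = (- msgn B tail :: 'k)" "v \<in> Alg"
    "\<forall>D. coef v D \<noteq> 0 \<longrightarrow> size D \<le> size B" "U = v + scal (of_nat (Suc k) * t) * bracket U'"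
    using assms unfolding stretched_def by blast
  have "U + scal t * bracket U' = v + scal (of_nat (Suc (Suc k)) * t) * bracket U'"
    unfolding *(6) by (simp only: of_nat_Suc[of "Suc k"] distrib_right scal_add mult_1_left)
      (simp add: add_ac)
  then show ?thesis
    using * unfolding stretched_def by blast
qed

lemma stretched_lead:
  assumes "stretched t U U'" "t \<noteq> 0" "n \<ge> 3"
  shows "\<exists>B c d. has_top deglex U' B c \<and> has_top deglex U (B + tail) d \<and> d \<noteq> 0 \<and> msgn tail (B + tail) = (- msgn (B + tail) tail :: 'k)"
proof -
  obtain B c v k where *: "has_top deglex U' B c" "c \<noteq> 0" "msgn tail B = (- msgn B tail :: 'k)" "v \<in> Alg"
    "\<forall>D. coef v D \<noteq> 0 \<longrightarrow> size D \<le> size B" "U = v + scal (of_nat (Suc k) * t) * bracket U'"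
    using assms unfolding stretched_def by blast
  obtain d where d: "d \<noteq> 0" "has_top deglex (bracket U') (B + tail) d"
    using bracket_top[OF *(1-3)] by blast
  let ?e = "of_nat (Suc k) * t * d"
  have lt: "size D < size (B + tail)" if "coef v D \<noteq> 0" for D
    using *(5) that assms(3) by fastforce
  then have "coef v (B + tail) = 0" by blast
  moreover have "has_top deglex (scal (of_nat (Suc k) * t) * bracket U' + v) (B + tail) (?e + coef v (B + tail))"
    using lt by (intro has_top_add[OF has_top_scale[OF d(2)] *(4)]) (auto simp: deglex_def)
  moreover have "?e \<noteq> 0"
    using d(1) assms(2) of_nat_neq_0[of k] by simp
  ultimately show ?thesis
    using *(1) anticommute_add_tail[OF *(3)] unfolding *(6) by (metis add.commute add.right_neutral)
qed

text \<open>
  The moved element now has larger degree than its partner, so the roles are exchanged.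
\<close>

lemma stretched_other:
  assumes "stretched t U U'" "t \<noteq> 0" "n \<ge> 3"
  shows "stretched t' (U' + scal t' * bracket U) U"
proof -
  obtain B c d where B: "has_top deglex U' B c" "has_top deglex U (B + tail) d" "d \<noteq> 0" "msgn tail (B + tail) = (- msgn (B + tail) tail :: 'k)"
    using stretched_lead[OF assms] by blast
  have "\<forall>D. coef U' D \<noteq> 0 \<longrightarrow> size D \<le> size (B + tail)"
    using B(1) by (auto simp: has_top_def deglex_def)
  then show ?thesis
    using B unfolding stretched_def
    by (intro exI[of _ "B + tail"] exI[of _ d] exI[of _ U'] exI[of _ 0]) (simp add: has_top_def)
qed

text \<open>
  Letters are appended on the right of the word, where they act first; then the images of \<open>x\<^sub>1\<close> and
  \<open>x\<^sub>2\<close> under the longer word arise from those under the shorter one by an elementary operation.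
\<close>

lemma odd_free_subgroup:
  assumes n: "odd n" "n \<ge> 3"
  shows "has_free_subgroup_rank2 G"
proof -
  define T where "T = (\<lambda>s t. SOME h. h \<in> carrier G \<and> (\<forall>u\<in>Alg. act h u = ext (transv s t) u))"
  have "T s t \<in> carrier G \<and> (\<forall>u\<in>Alg. act (T s t) u = ext (transv s t) u)" if s: "s = 1 \<or> s = 2" for s t
  proof -
    obtain h where "h \<in> carrier G" "\<And>u. u \<in> Alg \<Longrightarrow> act h u = ext (transv s t) u"
      by (rule exists_automorphism[OF transv_aut[OF n s]]) blast
    then have "\<exists>h. h \<in> carrier G \<and> (\<forall>u\<in>Alg. act h u = ext (transv s t) u)" by blast
    then show ?thesis
      unfolding T_def by (rule someI_ex)
  qed
  then have T: "\<And>s t. s = 1 \<or> s = 2 \<Longrightarrow> T s t \<in> carrier G"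
    "\<And>s t u. s = 1 \<or> s = 2 \<Longrightarrow> u \<in> Alg \<Longrightarrow> act (T s t) u = ext (transv s t) u"
    by blast+
  define idx where "idx = (\<lambda>s :: nat. if s = 0 then 1 else 2 :: nat)"
  define sig where "sig = (\<lambda>p :: bool. if p then 1 else - 1 :: 'k)"
  define g where "g = (\<lambda>s. T (idx s) 1)"
  have idx: "idx s = 1 \<or> idx s = 2" "3 - idx s \<noteq> idx s" "idx s \<in> {1..n}" "3 - idx s \<in> {1..n}" for s
    using n by (auto simp: idx_def)
  have g: "g s \<in> carrier G" for s
    unfolding g_def by (rule T(1)[OF idx(1)])
  have inv_g: "act (inv\<^bsub>G\<^esub> (g s)) u = ext (transv (idx s) (- 1)) u" if u: "u \<in> Alg" for s u
  proof -
    have A: "alg_aut (ext (transv (idx s) 1)) (ext (transv (idx s) (- 1)))"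
      using transv_aut[OF n idx(1), of s 1] .
    let ?v = "ext (transv (idx s) (- 1)) u"
    have v: "?v \<in> Alg"
      using A alg_end_simps(4) u unfolding alg_aut_def by blast
    have "act (g s) ?v = u"
      using A T(2)[OF idx(1) v] u unfolding g_def alg_aut_def by simp
    moreover have "act (inv\<^bsub>G\<^esub> (g s)) (act (g s) ?v) = ?v"
      using act_aut[OF g[of s]] v by (simp add: alg_aut_def)
    ultimately show ?thesis by simp
  qed
  have value_closed: "G.word_value g w \<in> carrier G" for w
    by (rule G.word_value_closed) (rule g)
  have letter: "act (G.word_value g [l]) u = ext (transv (idx (fst l)) (sig (snd l))) u"
    if "u \<in> Alg" for l u
    using g inv_g T(2)[OF idx(1)] that
    by (auto simp: G.word_value_Cons G.word_value_Nil sig_def g_def)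
  let ?U = "\<lambda>w i. act (G.word_value g w) (L i)"
  have step_fix: "?U (w @ [l]) i = ?U w i" if "i \<in> {1..n}" "i \<noteq> idx (fst l)" for w l i
  proof -
    have "act (G.word_value g [l]) (L i) = L i"
      using letter ext_gen[OF transv_rel[OF n idx(1)] that(1)] that by (simp add: transv_def)
    then show ?thesis
      using act_mult[OF value_closed value_closed, of "L i" w "[l]"] that(1)
      by (simp add: G.word_value_append[OF g])
  qed
  have fix_rest: "?U w i = L i" if "i \<in> {3..n}" for w i
  proof (induction w rule: rev_induct)
    case Nil
    then show ?case using act_one that by (simp add: G.word_value_Nil)
  next
    case (snoc l w)
    have "i \<noteq> idx (fst l)" using that by (simp add: idx_def)
    then show ?case using step_fix[of i l w] snoc that by simp
  qed
  have step_move: "?U (w @ [l]) (idx (fst l)) = ?U w (idx (fst l)) +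
      scal (sig (snd l)) * bracket (?U w (3 - idx (fst l)))" for w l
  proof -
    let ?h = "act (G.word_value g w)" and ?s = "idx (fst l)"
    note h = act_end[OF value_closed[of w]]
    have "act (G.word_value g [l]) (L ?s) = L ?s + scal (sig (snd l)) * bracket (L (3 - ?s))"
      using letter ext_gen[OF transv_rel[OF n idx(1)] idx(3)] idx(3) by (simp add: transv_def)
    then have "?U (w @ [l]) ?s = ?h (L ?s + scal (sig (snd l)) * bracket (L (3 - ?s)))"
      using act_mult[OF value_closed value_closed, of "L ?s" w "[l]"] idx(3)
      by (simp add: G.word_value_append[OF g])
    also have "\<dots> = ?h (L ?s) + scal (sig (snd l)) * ?h (bracket (L (3 - ?s)))"
      using idx(3)[of "fst l"] idx(4)[of "fst l"] by (simp add: alg_end_simps(5,7)[OF h])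
    also have "?h (bracket (L (3 - ?s))) = bracket (?h (L (3 - ?s)))"
      using fix_rest idx(4) by (intro alg_end_bracket[OF h]) auto
    finally show ?thesis .
  qed
  \<comment> \<open>A reduced word never follows a letter by its inverse, so each letter repeats the last one or moves the other generator.\<close>
  have main: "stretched (sig (snd (last w))) (?U w (idx (fst (last w)))) (?U w (3 - idx (fst (last w))))"
    if "reduced w" "w \<noteq> []" "set w \<subseteq> {0, 1} \<times> UNIV" for w
    using that
  proof (induction w rule: rev_induct)
    case (snoc l w)
    let ?s = "idx (fst l)" and ?t = "sig (snd l)"
    have sig0: "sig p \<noteq> 0" for p by (simp add: sig_def)
    have U': "?U (w @ [l]) (3 - ?s) = ?U w (3 - ?s)"
      using step_fix idx(2,4) by blast
    show ?case
    proof (cases "w = []")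
      case True
      have s: "?s \<in> {1..n}" "3 - ?s \<in> {1..n}" "3 - ?s < 3" using idx(3,4) idx(1)[of "fst l"] by auto
      have "stretched ?t (L ?s + scal ?t * bracket (L (3 - ?s))) (L (3 - ?s))"
        unfolding stretched_def
        using has_top_L[OF compatible_deglex s(2)] anticommute_single[OF n s(3)] s(1)
        by (intro exI[of _ "{#3 - ?s#}"] exI[of _ 1] exI[of _ "L ?s"] exI[of _ 0]) simp
      then show ?thesis
        using step_move[of "[]" l] U' act_one s(1,2) True by (simp add: G.word_value_Nil)
    next
      case False
      let ?m = "last w"
      have red: "reduced w" "l \<noteq> inv_letter ?m"
        using snoc.prems(1) False by (auto simp: reduced_snoc)
      have IH: "stretched (sig (snd ?m)) (?U w (idx (fst ?m))) (?U w (3 - idx (fst ?m)))"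
        using snoc.IH red(1) False snoc.prems(3) by simp
      have "?m \<in> {0, 1} \<times> UNIV" "l \<in> {0, 1} \<times> UNIV"
        using snoc.prems(3) last_in_set[OF False] by auto
      then consider "fst l = fst ?m" "snd l = snd ?m" | "idx (fst ?m) = 3 - ?s" "3 - idx (fst ?m) = ?s"
        using red(2) by (cases l; cases ?m) (auto simp: inv_letter_def idx_def)
      then show ?thesis
      proof cases
        case 1
        then show ?thesis
          using stretched_same[OF IH] step_move[of w l] U' by simp
      next
        case 2
        then show ?thesis
          using stretched_other[OF IH sig0 n(2), of ?t] step_move[of w l] U' by simp
      qed
    qed
  qed simp
  show ?thesis
  proof (rule G.has_free_subgroup_rank2_if[OF g])
    fix w :: "(nat \<times> bool) list" assume w: "reduced w" "w \<noteq> []" "set w \<subseteq> {0, 1} \<times> UNIV"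
    let ?s = "idx (fst (last w))"
    have "sig (snd (last w)) \<noteq> 0" by (simp add: sig_def)
    then obtain B d where d: "has_top deglex (?U w ?s) (B + tail) d" "d \<noteq> 0"
      using stretched_lead[OF main[OF w] _ n(2)] by blast
    show "G.word_value g w \<noteq> \<one>\<^bsub>G\<^esub>"
    proof
      assume "G.word_value g w = \<one>\<^bsub>G\<^esub>"
      then have "?U w ?s = L ?s" using act_one idx(3) by simp
      then have "B + tail = {#?s#}"
        using has_top_unique[OF compatible_deglex _ _ has_top_L[OF compatible_deglex idx(3)]] d
        by (metis one_neq_zero)
      \<comment> \<open>The leading monomial of the moved image contains the letter 3, that of a generator 1 or 2 does not.\<close>
      moreover have "3 \<in># B + tail" using n(2) by simp
      ultimately show False using idx(1)[of "fst (last w)"] by auto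
    qed
  qed
qed

end

theorem mainTheorem4:
  fixes n :: nat and a :: "nat \<Rightarrow> nat \<Rightarrow> 'k::field_char_0"
  assumes "n \<ge> 2"
  shows "virtually_solvable (AlgAut (V_algebra n a)) \<or>
         has_free_subgroup_rank2 (AlgAut (V_algebra n a))"
proof (cases "even n")
  case True
  then show ?thesis
    using V_data.even_virtually_solvable assms by blast
next
  case False
  then have "n \<ge> 3"
    using assms by (cases "n = 2") auto
  then show ?thesis
    using V_data.odd_free_subgroup False by blast
qed

end
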